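(* Let $d\ge 3$ be an integer. Then there is no Steinhaus set in dimension $d$; that is, there is no Lebesgue measurable set $E\subset\mathbb{R}^d$ such that for almost every isometry $S:\mathbb{R}^d\to\mathbb{R}^d$ and almost every $x\in\mathbb{R}^d$ one has $$\left|(S(E)+x)\cap\mathbb{Z}^d\right|=1.$$
   Context: A Steinhaus set in dimension $d$ (measurable version of the Steinhaus problem) is a Lebesgue measurable set $E\subset\mathbb{R}^d$ such that for almost every $x\in\mathbb{R}^d$ and almost every isometry $S$ of $\mathbb{R}^d$ the set $(S(E)+x)\cap\mathbb{Z}^d$ has exactly one element. Equivalently, for almost every isometry $S$, $\sum_{n\in\mathbb{Z}^d}\mathbf{1}_{S(E)}(x-n)=1$ for almost every $x\in\mathbb{R}^d$. Here $|\cdot|$ of a set of lattice points denotes cardinality, "almost every $x$" refers to Lebesgue measure, and "almost every isometry" refers to Haar measure on the group of isometries of Euclidean space $\mathbb{R}^d$. *)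

theory Defs
  imports "HOL-Analysis.Analysis"
begin

definition isometry_group :: "('a::metric_space \<Rightarrow> 'a) set" where
  "isometry_group = {S. surj S \<and> (\<forall>x y. dist (S x) (S y) = dist x y)}"

text \<open>
  The topology on the group of isometries is the one inherited from the function type, i.e.
  pointwise convergence; on isometries of a proper space it coincides with the compact-open
  topology. The trace of the Borel sets of the function type is the Borel sigma-algebra of this
  subspace. The isometry group of a Euclidean space is locally compact and second countable, so
  a Borel measure that is finite on compact sets is automatically regular; it is moreover
  unimodular, so left Haar measures are also right Haar measures. By Haar's theorem a measure as
  below exists and is unique up to a positive finite factor, so the quantifier ``for almost every
  isometry'' does not depend on its choice.
\<close>

definition haar_isometry :: "('a::metric_space \<Rightarrow> 'a) measure \<Rightarrow> bool" where
  "haar_isometry \<mu> \<longleftrightarrow>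
     sets \<mu> = sets (restrict_space borel isometry_group) \<and>
     (\<forall>S\<in>isometry_group. \<forall>A\<in>sets \<mu>. emeasure \<mu> ((\<lambda>T. S \<circ> T) ` A) = emeasure \<mu> A) \<and>
     (\<forall>K. K \<subseteq> isometry_group \<and> compact K \<longrightarrow> emeasure \<mu> K < \<infinity>) \<and>
     emeasure \<mu> isometry_group \<noteq> 0"

definition integer_lattice :: "(real ^ 'n) set" where
  "integer_lattice = {v. \<forall>i. v $ i \<in> \<int>}"

text \<open>Since \<open>card\<close> of an infinite set is 0, cardinality 1 here does mean exactly one element.\<close>

definition steinhaus_set ::
    "(real ^ 'n \<Rightarrow> real ^ 'n) measure \<Rightarrow> (real ^ 'n) set \<Rightarrow> bool" where
  "steinhaus_set \<mu> E \<longleftrightarrow>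
     E \<in> sets lebesgue \<and>
     (AE S in \<mu>. AE x in lebesgue. card ((\<lambda>y. S y + x) ` E \<inter> integer_lattice) = 1)"

end

theory Submission
  imports Defs "HOL-Number_Theory.Number_Theory" "HOL-Computational_Algebra.Squarefree" "HOL-Library.Discrete_Functions"
begin

text \<open>
  Let \<open>E\<close> be a Steinhaus set. For almost every isometry \<open>S\<close> the translates of \<open>S E\<close> along the integer
  lattice tile space, so integrating a lattice periodic function over \<open>S E\<close> or over the unit cube
  gives the same result. Hence \<open>E\<close> has measure 1, and the Fourier transform of its indicator vanishes
  at the preimage under the linear part of \<open>S\<close> of every nonzero lattice vector. The exceptional
  isometries form a Haar null set, their complement is dense, and the transform is continuous; so it
  vanishes on every sphere through a nonzero integer vector (\<open>steinhaus_fourier_zero\<close>), that is, at every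
  \<open>\<xi> \<noteq> 0\<close> for which \<open>\<bar>\<xi>\<bar>\<^sup>2\<close> is a sum of as many squares as the dimension.

  Now stretch one coordinate by \<open>\<surd>17\<close>. The stretched copy of \<open>E\<close> has measure \<open>\<surd>17\<close>, and by a linear change of
  variables its Fourier transform at an integer vector \<open>k\<close> is a multiple of the transform of \<open>E\<close> at
  a vector whose squared length is a value of the form \<open>x\<^sup>2 + y\<^sup>2 + 17 z\<^sup>2\<close> plus further squares. All these
  values are sums of squares of the required kind, by \<open>form_1_1_17_three_squares\<close>. So all nonconstant
  Fourier coefficients of the periodization of the stretched set vanish, and this periodization
  is almost everywhere equal to the constant \<open>\<surd>17\<close>
  (\<open>measure_eq_on_periodic_sets\<close>). But it counts points, so its values are integers or infinite.

  The arithmetic input holds since \<open>17 \<equiv> 1\<close> modulo 8: the form never represents a number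
  \<open>4\<^sup>a (8 b + 7)\<close>, and every other number is a sum of three squares. It suffices to represent a squarefree \<open>n\<close> by
  three rational squares (\<open>davenport_cassels\<close>), and for this to solve \<open>x\<^sup>2 + t y\<^sup>2 = n z\<^sup>2\<close> for some \<open>t\<close> that is a sum
  of two squares. With \<open>t\<close> equal to \<open>q\<close> or \<open>2 q\<close>, quadratic reciprocity turns the solvability conditions
  (\<open>legendre_equation\<close>) into the choice of a prime \<open>q\<close> with prescribed residue modulo 8 and prescribed
  quadratic symbols at the prime factors of \<open>n\<close>. Such primes exist by the argument of Dirichlet
  (\<open>prime_with_character_values\<close>); only real characters occur, so the delicate point, the
  non-vanishing at 1 of the L-series, has the elementary proof of \<open>L1_nonzero\<close>.
\<close>

section \<open>Real Dirichlet characters\<close>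

lemma summation_by_parts:
  fixes a b :: "nat \<Rightarrow> real"
  assumes "m \<le> n"
  shows "(\<Sum>i\<in>{m..<n}. a i * b i) = (\<Sum>i\<in>{m..<n}. a i) * b n +
           (\<Sum>i\<in>{m..<n}. (\<Sum>j\<in>{m..<Suc i}. a j) * (b i - b (Suc i)))"
  using assms
proof (induction n rule: dec_induct)
  case base
  then show ?case by simp
next
  case (step n)
  have "(\<Sum>i\<in>{m..<Suc n}. a i * b i) = (\<Sum>i\<in>{m..<n}. a i * b i) + a n * b n"
    using step by simp
  moreover have "(\<Sum>i\<in>{m..<Suc n}. a i) = (\<Sum>i\<in>{m..<n}. a i) + a n"
    using step by simp
  moreover have "(\<Sum>i\<in>{m..<Suc n}. (\<Sum>j\<in>{m..<Suc i}. a j) * (b i - b (Suc i))) =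
     (\<Sum>i\<in>{m..<n}. (\<Sum>j\<in>{m..<Suc i}. a j) * (b i - b (Suc i))) + (\<Sum>j\<in>{m..<Suc n}. a j) * (b n - b (Suc n))"
    using step by (subst sum.atLeastLessThan_Suc) auto
  ultimately show ?case using step by (simp add: algebra_simps)
qed

lemma bounded_times_decreasing:
  fixes a b :: "nat \<Rightarrow> real"
  assumes A: "\<And>j. \<bar>\<Sum>i\<in>{m..<j}. a i\<bar> \<le> K"
    and nonneg: "\<And>i. i \<ge> m \<Longrightarrow> b i \<ge> 0" and dec: "\<And>i. i \<ge> m \<Longrightarrow> b (Suc i) \<le> b i"
  shows "\<bar>\<Sum>i\<in>{m..<n}. a i * b i\<bar> \<le> K * b m"
proof (cases "m \<le> n")
  case False
  have "0 \<le> K" using A[of m] by simp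
  then show ?thesis using False nonneg[of m] by simp
next
  case True
  have "(\<Sum>i\<in>{m..<n}. (b i - b (Suc i))) = b m - b n"
    using True by (induction n rule: dec_induct) auto
  moreover have "\<bar>\<Sum>i\<in>{m..<n}. (\<Sum>j\<in>{m..<Suc i}. a j) * (b i - b (Suc i))\<bar>
     \<le> (\<Sum>i\<in>{m..<n}. K * (b i - b (Suc i)))"
  proof (rule order_trans[OF sum_abs], rule sum_mono)
    fix i assume "i \<in> {m..<n}"
    then show "\<bar>(\<Sum>j\<in>{m..<Suc i}. a j) * (b i - b (Suc i))\<bar> \<le> K * (b i - b (Suc i))"
      using mult_right_mono[OF A[of "Suc i"], of "b i - b (Suc i)"] dec[of i]
      by (simp only: abs_mult atLeastLessThan_iff abs_of_nonneg[of "b i - b (Suc i)"] diff_ge_0_iff_ge)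
  qed
  moreover have "\<bar>(\<Sum>i\<in>{m..<n}. a i) * b n\<bar> \<le> K * b n"
    using A[of n] nonneg[OF True] by (simp add: abs_mult mult_right_mono)
  ultimately show ?thesis
    unfolding sum_distrib_left[symmetric] by (subst summation_by_parts[OF True]) (simp add: right_diff_distrib)
qed

lemma dirichlet_test_tail:
  fixes a b :: "nat \<Rightarrow> real"
  assumes A: "\<And>i j. \<bar>\<Sum>k\<in>{i..<j}. a k\<bar> \<le> K"
    and nonneg: "\<And>i. i \<ge> m0 \<Longrightarrow> b i \<ge> 0" and dec: "\<And>i. i \<ge> m0 \<Longrightarrow> b (Suc i) \<le> b i"
    and lim: "b \<longlonglongrightarrow> 0"
  shows "summable (\<lambda>n. a n * b n)"
    and "m \<ge> m0 \<Longrightarrow> \<bar>(\<Sum>n. a n * b n) - (\<Sum>n<m. a n * b n)\<bar> \<le> K * b m"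
proof -
  have bd: "\<bar>\<Sum>i\<in>{m..<n}. a i * b i\<bar> \<le> K * b m" if "m \<ge> m0" for m n
    by (rule bounded_times_decreasing) (use that A nonneg dec in auto)
  show sm: "summable (\<lambda>n. a n * b n)"
    unfolding summable_Cauchy
  proof safe
    fix e :: real assume "e > 0"
    have "(\<lambda>m. K * b m) \<longlonglongrightarrow> K * 0" by (intro tendsto_intros lim)
    then have "\<forall>\<^sub>F m in sequentially. K * b m < e" using \<open>e > 0\<close>
      by (simp add: order_tendsto_iff)
    then obtain N where N: "\<And>m. m \<ge> N \<Longrightarrow> K * b m < e" by (auto simp: eventually_sequentially)
    show "\<exists>N. \<forall>m\<ge>N. \<forall>n. norm (\<Sum>k = m..<n. a k * b k) < e"
    proof (intro exI[of _ "max N m0"] allI impI)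
      fix m n assume m: "max N m0 \<le> m"
      then have "\<bar>\<Sum>k = m..<n. a k * b k\<bar> \<le> K * b m" by (intro bd) simp
      also have "\<dots> < e" using m by (intro N) simp
      finally show "norm (\<Sum>k = m..<n. a k * b k) < e" by simp
    qed
  qed
  assume m: "m \<ge> m0"
  have lim_diff: "(\<lambda>n. (\<Sum>k<n. a k * b k) - (\<Sum>k<m. a k * b k)) \<longlonglongrightarrow> (\<Sum>n. a n * b n) - (\<Sum>n<m. a n * b n)"
    by (intro tendsto_intros summable_LIMSEQ sm)
  have "(\<lambda>n. \<bar>(\<Sum>k<n. a k * b k) - (\<Sum>k<m. a k * b k)\<bar>) \<longlonglongrightarrow> \<bar>(\<Sum>n. a n * b n) - (\<Sum>n<m. a n * b n)\<bar>"
    by (rule tendsto_rabs[OF lim_diff])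
  moreover have "\<forall>\<^sub>F n in sequentially. \<bar>(\<Sum>k<n. a k * b k) - (\<Sum>k<m. a k * b k)\<bar> \<le> K * b m"
    unfolding eventually_sequentially
  proof (intro exI allI impI)
    fix n assume n: "m \<le> n"
    have "(\<Sum>k<n. a k * b k) - (\<Sum>k<m. a k * b k) = (\<Sum>k=m..<n. a k * b k)"
      using n by (simp add: atLeast0LessThan[symmetric] sum_diff_nat_ivl)
    then show "\<bar>(\<Sum>k<n. a k * b k) - (\<Sum>k<m. a k * b k)\<bar> \<le> K * b m" using bd[OF m] by simp
  qed
  ultimately show "\<bar>(\<Sum>n. a n * b n) - (\<Sum>n<m. a n * b n)\<bar> \<le> K * b m"
    by (rule tendsto_upperbound) simp
qed

text \<open>Only characters with values in \<open>{0, 1, -1}\<close> are considered: the primes sought below are described by quadratic symbols.\<close>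

definition real_character :: "nat \<Rightarrow> (nat \<Rightarrow> real) \<Rightarrow> bool" where
  "real_character N \<psi> \<longleftrightarrow> N > 0 \<and> (\<forall>m n. \<psi> (m * n) = \<psi> m * \<psi> n) \<and> (\<forall>n. \<psi> (n mod N) = \<psi> n) \<and>
     (\<forall>n. \<psi> n = (if coprime n N then 1 else 0) \<or> \<psi> n = (if coprime n N then - 1 else 0))"

context
  fixes N :: nat and \<psi> :: "nat \<Rightarrow> real"
  assumes chi: "real_character N \<psi>"
begin

lemma N_pos: "N > 0" and chi_mult: "\<psi> (m * n) = \<psi> m * \<psi> n" and chi_mod: "\<psi> (n mod N) = \<psi> n"
  and chi_noncoprime: "\<not> coprime n N \<Longrightarrow> \<psi> n = 0"
  and chi_coprime: "coprime n N \<Longrightarrow> \<psi> n = 1 \<or> \<psi> n = - 1"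
  using chi unfolding real_character_def by (blast | metis)+

lemma chi_cases: "\<psi> n = 0 \<or> \<psi> n = 1 \<or> \<psi> n = - 1"
  using chi_noncoprime chi_coprime by blast

lemma chi_abs_le: "\<bar>\<psi> n\<bar> \<le> 1"
  using chi_cases[of n] by auto

lemma chi_1: "\<psi> (Suc 0) = 1"
  using chi_mult[of 1 1] chi_coprime[of 1] by auto

lemma chi_power: "\<psi> (n ^ k) = \<psi> n ^ k"
  by (induction k) (simp_all add: chi_1 chi_mult)

context
  fixes a :: nat
  assumes a: "\<psi> a = - 1"
begin

lemma chi_0: "\<psi> 0 = 0"
  using chi_mult[of 0 a] a by simp

text \<open>Multiplication by \<open>a\<close> permutes the residues and changes the sign of the sum.\<close>

lemma chi_period_sum: "(\<Sum>n<N. \<psi> n) = 0"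
proof -
  have cop: "coprime a N" using chi_noncoprime[of a] a by auto
  have inj: "inj_on (\<lambda>n. a * n mod N) {..<N}"
  proof (rule inj_onI)
    fix x y assume xy: "x \<in> {..<N}" "y \<in> {..<N}" "a * x mod N = a * y mod N"
    then have "[a * x = a * y] (mod N)" by (simp add: cong_def)
    then have "[x = y] (mod N)" using cop cong_mult_lcancel_nat by blast
    then show "x = y" using xy by (simp add: cong_def)
  qed
  have img: "(\<lambda>n. a * n mod N) ` {..<N} = {..<N}"
    by (rule endo_inj_surj[OF _ _ inj]) (use N_pos in auto)
  have "(\<Sum>n<N. \<psi> n) = (\<Sum>n\<in>(\<lambda>n. a * n mod N) ` {..<N}. \<psi> n)" by (simp only: img)
  also have "\<dots> = (\<Sum>n<N. \<psi> (a * n mod N))" by (subst sum.reindex[OF inj]) simp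
  also have "\<dots> = (\<Sum>n<N. - \<psi> n)" by (simp add: chi_mod chi_mult a)
  finally show ?thesis by (simp add: sum_negf)
qed

lemma chi_sum_lessThan: "\<bar>\<Sum>n<m. \<psi> n\<bar> \<le> N"
proof -
  have per: "(\<Sum>n<q * N. \<psi> n) = 0" for q
  proof (induction q)
    case (Suc q)
    have "(\<Sum>n<Suc q * N. \<psi> n) = (\<Sum>n<q * N. \<psi> n) + (\<Sum>n\<in>{q*N..<q*N + N}. \<psi> n)"
      by (simp add: atLeast0LessThan[symmetric] sum.atLeastLessThan_concat add.commute)
    also have "(\<Sum>n\<in>{q*N..<q*N + N}. \<psi> n) = (\<Sum>n<N. \<psi> (n + q * N))"
      using sum.shift_bounds_nat_ivl[of \<psi> 0 "q*N" N] by (simp add: atLeast0LessThan add.commute)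
    also have "\<dots> = (\<Sum>n<N. \<psi> n)"
      by (intro sum.cong refl) (metis chi_mod mod_mult_self1)
    finally show ?case using Suc chi_period_sum by simp
  qed simp
  define q where "q = m div N"
  have m: "m = q * N + m mod N" by (simp add: q_def)
  have "(\<Sum>n<m. \<psi> n) = (\<Sum>n<q * N. \<psi> n) + (\<Sum>n\<in>{q*N..<m}. \<psi> n)"
    using m by (simp add: atLeast0LessThan[symmetric] sum.atLeastLessThan_concat)
  then have "\<bar>\<Sum>n<m. \<psi> n\<bar> \<le> (\<Sum>n\<in>{q*N..<m}. \<bar>\<psi> n\<bar>)" by (simp add: per sum_abs)
  also have "\<dots> \<le> (\<Sum>n\<in>{q*N..<m}. 1)" by (intro sum_mono chi_abs_le)
  also have "\<dots> = real (m - q * N)" by simp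
  also have "\<dots> \<le> N"
  proof -
    have "m - q * N = m mod N" using m by linarith
    then show ?thesis using N_pos by (simp add: less_imp_le)
  qed
  finally show ?thesis .
qed

lemma chi_interval_sum: "\<bar>\<Sum>n\<in>{i..<j}. \<psi> n\<bar> \<le> 2 * real N"
proof (cases "i \<le> j")
  case True
  then have "(\<Sum>n\<in>{i..<j}. \<psi> n) = (\<Sum>n<j. \<psi> n) - (\<Sum>n<i. \<psi> n)"
    by (simp add: atLeast0LessThan[symmetric] sum_diff_nat_ivl)
  then show ?thesis using chi_sum_lessThan[of i] chi_sum_lessThan[of j] by linarith
qed simp

lemmas chi_dirichlet = dirichlet_test_tail[where a = \<psi> and K = "2 * real N", OF chi_interval_sum]

end

lemma divisor_sum_chi_primepow:
  assumes p: "prime p" and m: "\<not> p dvd m" "m > 0"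
  shows "(\<Sum>d | d dvd p ^ k * m. \<psi> d) = (\<Sum>i\<le>k. \<psi> p ^ i) * (\<Sum>d | d dvd m. \<psi> d)"
proof -
  have cop: "coprime (p ^ i) d" if "d dvd m" for i d
    using p m that by (meson coprime_power_left_iff dvd_trans prime_imp_coprime)
  have "bij_betw (\<lambda>(i, d). p ^ i * d) ({..k} \<times> {d. d dvd m}) {d. d dvd p ^ k * m}"
  proof (rule bij_betwI')
    fix x y assume x: "x \<in> {..k} \<times> {d. d dvd m}" and y: "y \<in> {..k} \<times> {d. d dvd m}"
    obtain i d j e where xy: "x = (i, d)" "y = (j, e)" by (metis surj_pair)
    have "i = j \<and> d = e" if eq: "p ^ i * d = p ^ j * e"
    proof -
      have 1: "p ^ i dvd p ^ j" using eq cop[of e i] y xy by (metis coprime_dvd_mult_left_iff dvd_triv_left mem_Collect_eq mem_Sigma_iff)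
      have 2: "p ^ j dvd p ^ i" using eq cop[of d j] x xy by (metis coprime_dvd_mult_left_iff dvd_triv_left mem_Collect_eq mem_Sigma_iff)
      have "i = j" using 1 2 p by (metis dvd_antisym prime_gt_1_nat power_inject_exp)
      then show ?thesis using eq p by (auto simp: prime_gt_0_nat)
    qed
    then show "((case x of (i, d) \<Rightarrow> p ^ i * d) = (case y of (i, d) \<Rightarrow> p ^ i * d)) = (x = y)"
      using xy by auto
  next
    fix x assume "x \<in> {..k} \<times> {d. d dvd m}"
    then show "(case x of (i, d) \<Rightarrow> p ^ i * d) \<in> {d. d dvd p ^ k * m}"
      by (auto intro!: mult_dvd_mono le_imp_power_dvd)
  next
    fix y assume "y \<in> {d. d dvd p ^ k * m}"
    then obtain b c where bc: "y = b * c" "b dvd p ^ k" "c dvd m"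
      by (metis division_decomp mem_Collect_eq)
    then obtain i where "i \<le> k" "b = p ^ i" using p by (metis divides_primepow_nat)
    then show "\<exists>x\<in>{..k} \<times> {d. d dvd m}. y = (case x of (i, d) \<Rightarrow> p ^ i * d)"
      using bc by (intro bexI[of _ "(i, c)"]) auto
  qed
  from sum.reindex_bij_betw[OF this, of \<psi>, symmetric]
  have "(\<Sum>d | d dvd p ^ k * m. \<psi> d) = (\<Sum>(i, d)\<in>{..k} \<times> {d. d dvd m}. \<psi> p ^ i * \<psi> d)"
    by (simp add: case_prod_unfold chi_mult chi_power)
  then show ?thesis by (simp add: sum.cartesian_product[symmetric] sum_product)
qed

lemma sum_powers_chi: "(\<Sum>i\<le>k. \<psi> p ^ i) \<ge> (if even k then 1 else 0)"
proof (cases "\<psi> p = - 1")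
  case True
  then show ?thesis by (induction k) auto
next
  case False
  then have "\<psi> p = 0 \<or> \<psi> p = 1" using chi_cases by blast
  moreover have "(\<Sum>i\<le>k. (0::real) ^ i) = 1" by (induction k) auto
  ultimately show ?thesis by auto
qed

text \<open>These divisor sums are the coefficients of the product of the zeta function with the L-series. They
  factor over the prime powers \<open>p\<^sup>k\<close> exactly dividing \<open>n\<close>, with factors \<open>1 + \<psi> p + \<dots> + (\<psi> p)\<^sup>k\<close>; such a factor is
  nonnegative because \<open>\<psi>\<close> is real, and at least 1 when \<open>k\<close> is even.\<close>

lemma divisor_sum_chi:
  assumes "n > 0"
  shows "(\<Sum>d | d dvd n. \<psi> d) \<ge> (if \<exists>m. n = m ^ 2 then 1 else 0)"
  using assms
proof (induction n rule: less_induct)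
  case (less n)
  show ?case
  proof (cases "n = 1")
    case True
    then show ?thesis by (simp add: chi_1)
  next
    case False
    then obtain p where p: "prime p" "p dvd n" using prime_factor_nat by blast
    define k where "k = multiplicity p n"
    obtain m where m: "n = p ^ k * m" "\<not> p dvd m"
      using multiplicity_decompose'[of n p] p less.prems prime_elem_not_unit[of p] unfolding k_def
      by (metis not_prime_unit not_gr_zero)
    have k: "k > 0" using p less.prems unfolding k_def by (simp add: prime_multiplicity_gt_zero_iff)
    have m0: "m > 0" using m less.prems by (metis mult_0_right not_gr_zero)
    have "p ^ k > 1" using k p by (meson one_less_power prime_gt_1_nat)
    then have mn: "m < n" using m m0 by simp
    have sq: "even k \<and> (\<exists>m'. m = m' ^ 2)" if "n = r ^ 2" for r
    proof -
      have r: "r > 0" using that less.prems by (cases r) auto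
      have "k = 2 * multiplicity p r"
        unfolding k_def that using p r by (simp add: prime_elem_multiplicity_power_distrib)
      then have ev: "k = 2 * multiplicity p r" .
      have "(p ^ multiplicity p r) dvd r" by (rule multiplicity_dvd)
      then obtain s where s: "r = p ^ multiplicity p r * s" by blast
      have "p ^ k * m = p ^ k * s ^ 2"
        using m that s ev by (metis power_even_eq power_mult_distrib)
      then have "m = s ^ 2" using p by (simp add: prime_gt_0_nat)
      then show ?thesis using ev by auto
    qed
    have "(\<Sum>d | d dvd n. \<psi> d) = (\<Sum>i\<le>k. \<psi> p ^ i) * (\<Sum>d | d dvd m. \<psi> d)"
      using divisor_sum_chi_primepow[OF p(1) m(2) m0] m(1) by simp
    moreover have "(\<Sum>d | d dvd m. \<psi> d) \<ge> (if \<exists>s. m = s ^ 2 then 1 else 0)" by (rule less.IH[OF mn m0])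
    moreover have "(\<Sum>i\<le>k. \<psi> p ^ i) \<ge> (if even k then 1 else 0)" by (rule sum_powers_chi)
    ultimately show ?thesis using sq
      by (auto split: if_splits intro!: mult_nonneg_nonneg) (smt (verit) mult_le_cancel_left1 mult_less_cancel_right2)+
  qed
qed

end

section \<open>Non-vanishing at 1 of the L-series of a real character\<close>

text \<open>The non-vanishing proof compares the L-series at 1, scaled by \<open>1 / (1 - x)\<close>, with the Lambert
  series of the character. This is the difference of the two weights of \<open>\<psi> n\<close>.\<close>

definition lambert_gap :: "real \<Rightarrow> nat \<Rightarrow> real" where
  "lambert_gap x n = 1 / (real n * (1 - x)) - x ^ n / (1 - x ^ n)"

text \<open>The arithmetic-geometric mean inequality for the terms at positions \<open>i\<close> and \<open>n - 1 - i\<close>; \<open>y\<close> is a square root of the ratio, so that the middle exponent is integral.\<close>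

lemma geometric_sum_ge_middle:
  fixes y :: real
  assumes "y \<ge> 0"
  shows "(\<Sum>i<n. (y ^ 2) ^ i) \<ge> n * y ^ (n - 1)"
proof -
  have "2 * (\<Sum>i<n. (y ^ 2) ^ i) = (\<Sum>i<n. (y ^ 2) ^ i) + (\<Sum>i<n. (y ^ 2) ^ (n - Suc i))"
    by (simp only: sum.nat_diff_reindex mult_2)
  also have "\<dots> = (\<Sum>i<n. (y ^ 2) ^ i + (y ^ 2) ^ (n - Suc i))" by (simp add: sum.distrib)
  also have "\<dots> \<ge> (\<Sum>i<n. 2 * y ^ (n - 1))"
  proof (rule sum_mono)
    fix i assume i: "i \<in> {..<n}"
    have "(y ^ i - y ^ (n - Suc i)) ^ 2 \<ge> 0" by simp
    then have "2 * (y ^ i * y ^ (n - Suc i)) \<le> (y ^ i) ^ 2 + (y ^ (n - Suc i)) ^ 2"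
      by (simp add: power2_diff)
    moreover have "(y ^ 2) ^ k = (y ^ k) ^ 2" for k by (simp add: power_mult[symmetric] mult.commute)
    moreover have "y ^ i * y ^ (n - Suc i) = y ^ (n - 1)"
      using i by (simp add: power_add[symmetric])
    ultimately show "2 * y ^ (n - 1) \<le> (y ^ 2) ^ i + (y ^ 2) ^ (n - Suc i)"
      by simp
  qed
  finally show ?thesis by simp
qed

text \<open>With \<open>S k = 1 + x + \<dots> + x\<^sup>k\<^sup>-\<^sup>1\<close> the decrement is, up to a positive factor,
  \<open>1 / (n (n + 1)) - x\<^sup>n / (S n * S (n + 1))\<close>, which is nonnegative because each \<open>S k\<close> is at least \<open>k\<close> times its
  middle term.\<close>

lemma lambert_gap_decreasing:
  assumes x: "0 < x" "x < 1" and n: "n \<ge> 1"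
  shows "lambert_gap x (Suc n) \<le> lambert_gap x n"
proof -
  define y where "y = sqrt x"
  have y: "0 < y" "y < 1" "x = y ^ 2" using x by (auto simp: y_def)
  define S where "S k = (\<Sum>i<k. x ^ i)" for k
  have S: "1 - x ^ k = (1 - x) * S k" for k unfolding S_def by (rule one_diff_power_eq)
  have "real n * y ^ (n - 1) \<le> S n" "real (Suc n) * y ^ (Suc n - 1) \<le> S (Suc n)"
    unfolding S_def y(3) by (rule geometric_sum_ge_middle, use y in simp)+
  then have "(real n * y ^ (n - 1)) * (real (Suc n) * y ^ n) \<le> S n * S (Suc n)"
    using y x by (intro mult_mono) (auto simp: S_def intro!: sum_nonneg)
  moreover have "y ^ (n - 1) * y ^ n \<ge> x ^ n"
  proof -
    have "y ^ (2 * n) \<le> y ^ (n - 1 + n)" using y n by (intro power_decreasing) auto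
    then show ?thesis using y by (simp add: power_add power_mult)
  qed
  ultimately have key: "real n * real (Suc n) * x ^ n \<le> S n * S (Suc n)"
  proof -
    assume a: "(real n * y ^ (n - 1)) * (real (Suc n) * y ^ n) \<le> S n * S (Suc n)" "y ^ (n - 1) * y ^ n \<ge> x ^ n"
    have "real n * real (Suc n) * x ^ n \<le> real n * real (Suc n) * (y ^ (n - 1) * y ^ n)"
      by (intro mult_left_mono a) auto
    then show ?thesis using a(1) by (simp add: mult_ac)
  qed
  have Spos: "S k > 0" if "k > 0" for k
    unfolding S_def using x that by (intro sum_pos) auto
  have "lambert_gap x n - lambert_gap x (Suc n)
      = (1 / (1 - x)) * (1 / real n - 1 / real (Suc n) - (x ^ n / S n - x * x ^ n / S (Suc n)))"
  proof -
    have e: "1 / (a * (1 - x)) = 1 / (1 - x) * (1 / a)" "c / ((1 - x) * a) = 1 / (1 - x) * (c / a)" for a c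
      by simp_all
    have gap: "lambert_gap x k = 1 / (1 - x) * (1 / real k - x ^ k / S k)" for k
      unfolding lambert_gap_def S e by (rule right_diff_distrib[symmetric])
    have "k * (A - P) - k * (B - Q) = k * (A - B - (P - Q))" for k A B P Q :: real
      by (simp add: algebra_simps)
    then show ?thesis unfolding gap power_Suc .
  qed
  also have "1 / real n - 1 / real (Suc n) = 1 / (real n * real (Suc n))"
    using n by (simp add: field_simps)
  also have "x ^ n / S n - x * x ^ n / S (Suc n) = x ^ n * (S (Suc n) - x * S n) / (S n * S (Suc n))"
    using Spos[of n] Spos[of "Suc n"] n by (simp add: field_simps)
  also have "S (Suc n) - x * S n = 1"
    unfolding S_def by (subst sum.lessThan_Suc_shift) (simp add: sum_distrib_left)
  finally have "lambert_gap x n - lambert_gap x (Suc n)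
      = (1 / (1 - x)) * (1 / (real n * real (Suc n)) - x ^ n * 1 / (S n * S (Suc n)))" .
  moreover have "1 / (real n * real (Suc n)) - x ^ n * 1 / (S n * S (Suc n)) \<ge> 0"
    using key Spos[of n] Spos[of "Suc n"] n by (simp add: field_simps del: of_nat_Suc)
  ultimately have "lambert_gap x n - lambert_gap x (Suc n) \<ge> 0" using x by simp
  then show ?thesis by simp
qed

lemma lambert_gap_nonneg:
  assumes x: "0 < x" "x < 1" and n: "n \<ge> 1"
  shows "lambert_gap x n \<ge> 0"
proof -
  have "(\<Sum>i<n. x ^ n) \<le> (\<Sum>i<n. x ^ i)" using x by (intro sum_mono power_decreasing) auto
  then have "n * x ^ n * (1 - x) \<le> (1 - x) * (\<Sum>i<n. x ^ i)" using x by (simp add: mult.commute)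
  then have "n * x ^ n * (1 - x) \<le> 1 - x ^ n" using one_diff_power_eq[of x n] by simp
  moreover have "x ^ n < 1" using x n by (intro power_Suc_less_one[of x "n - 1", simplified] | simp add: power_less_one_iff)+
  moreover have "real n * (1 - x) > 0" using x n by simp
  ultimately have "x ^ n \<le> 1 / (real n * (1 - x)) * (1 - x ^ n)"
    by (simp add: pos_le_divide_eq mult_ac)
  then show ?thesis using \<open>x ^ n < 1\<close> unfolding lambert_gap_def by (simp add: pos_divide_le_eq)
qed

lemma lambert_gap_tendsto_0:
  assumes x: "0 < x" "x < 1"
  shows "lambert_gap x \<longlonglongrightarrow> 0"
proof -
  have "(\<lambda>n. x ^ n) \<longlonglongrightarrow> 0" using x by (intro LIMSEQ_power_zero) auto
  then have "(\<lambda>n. (1 / (1 - x)) * (1 / real n) - x ^ n / (1 - x ^ n)) \<longlonglongrightarrow> (1 / (1 - x)) * 0 - 0 / (1 - 0)"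
    using x by (intro tendsto_diff tendsto_mult tendsto_divide tendsto_const lim_1_over_n) auto
  then show ?thesis unfolding lambert_gap_def by (simp add: field_simps)
qed

lemma lambert_term:
  fixes x :: real
  assumes x: "0 < x" "x < 1" and d: "d \<ge> 1"
  shows "\<bar>x ^ d / (1 - x ^ d) - (\<Sum>j\<in>{1..D div d}. x ^ (d * j))\<bar> \<le> x ^ D / (1 - x)"
proof -
  define k where "k = D div d"
  have xd: "x ^ d < 1" using x d by (simp add: power_less_one_iff)
  have "(1 - x ^ d) * (\<Sum>j\<in>{1..k}. x ^ (d * j)) = x ^ d - x ^ (d * (k + 1))"
  proof (induction k)
    case (Suc k)
    have "(1 - x ^ d) * (\<Sum>j\<in>{1..Suc k}. x ^ (d * j)) = (1 - x ^ d) * (\<Sum>j\<in>{1..k}. x ^ (d * j)) + (1 - x ^ d) * x ^ (d * Suc k)"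
      by (simp add: distrib_left)
    also have "\<dots> = x ^ d - x ^ (d * (k + 1)) + (1 - x ^ d) * x ^ (d * Suc k)" by (simp only: Suc)
    also have "\<dots> = x ^ d - x ^ (d * (Suc k + 1))" by (simp add: algebra_simps power_add)
    finally show ?case .
  qed simp
  then have "(\<Sum>j\<in>{1..k}. x ^ (d * j)) = (x ^ d - x ^ (d * (k + 1))) / (1 - x ^ d)"
    using xd by (simp add: field_simps)
  then have "x ^ d / (1 - x ^ d) - (\<Sum>j\<in>{1..k}. x ^ (d * j)) = x ^ (d * (k + 1)) / (1 - x ^ d)"
    using xd by (simp add: field_simps)
  moreover have "x ^ (d * (k + 1)) \<le> x ^ D"
  proof (rule power_decreasing)
    show "D \<le> d * (k + 1)" unfolding k_def
      using d by (metis add.commute add_mult_distrib2 dividend_less_times_div less_imp_le mult.right_neutral not_one_le_zero zero_less_iff_neq_zero)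
  qed (use x in auto)
  moreover have "x ^ d \<le> x" using power_decreasing[of 1 d x] x d by simp
  moreover have "x ^ (d * (k + 1)) \<ge> 0" using x by simp
  ultimately show ?thesis unfolding k_def using x xd by (auto intro!: frac_le)
qed

context
  fixes N :: nat and \<psi> :: "nat \<Rightarrow> real"
  assumes chi: "real_character N \<psi>"
begin

text \<open>Expanding each \<open>x\<^sup>d / (1 - x\<^sup>d)\<close> as a geometric series gives a power series whose coefficients are
  the divisor sums above; all but the square exponents are dropped. The last term bounds the error of
  cutting every geometric series at exponent \<open>D\<close>.\<close>

lemma lambert_partial:
  fixes x :: real
  assumes x: "0 < x" "x < 1" and M: "M ^ 2 \<le> D"
  shows "(\<Sum>d\<in>{1..D}. \<psi> d * (x ^ d / (1 - x ^ d))) \<ge> (\<Sum>m\<in>{1..M}. x ^ (m ^ 2)) - D * x ^ D / (1 - x)"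
proof -
  have "(\<Sum>d\<in>{1..D}. \<psi> d * (\<Sum>j\<in>{1..D div d}. x ^ (d * j)))
      = (\<Sum>(d, j)\<in>Sigma {1..D} (\<lambda>d. {1..D div d}). \<psi> d * x ^ (d * j))"
    by (simp add: sum_distrib_left sum.Sigma)
  also have "\<dots> = (\<Sum>(n, d)\<in>Sigma {1..D} (\<lambda>n. {d. d dvd n}). \<psi> d * x ^ n)"
  proof (rule sum.reindex_bij_witness[of _ "\<lambda>(n, d). (d, n div d)" "\<lambda>(d, j). (d * j, d)"], goal_cases)
    case (2 a)
    then show ?case by (auto simp: less_eq_div_iff_mult_less_eq mult.commute Suc_le_eq)
  next
    case (4 b)
    then obtain n d where nd: "b = (n, d)" "1 \<le> n" "n \<le> D" "d dvd n" by auto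
    then have "1 \<le> d" "d \<le> n" by (auto intro: dvd_imp_le simp: Suc_le_eq dvd_pos_nat)
    moreover have "1 \<le> n div d" using nd \<open>1 \<le> d\<close> \<open>d \<le> n\<close> by (simp add: Suc_le_eq div_greater_zero_iff)
    moreover have "n div d \<le> D div d" using nd by (simp add: div_le_mono)
    ultimately show ?case using nd by simp
  qed auto
  also have "\<dots> = (\<Sum>n\<in>{1..D}. (\<Sum>d | d dvd n. \<psi> d) * x ^ n)"
    by (subst sum.Sigma[symmetric]) (auto simp: sum_distrib_right)
  also have "\<dots> \<ge> (\<Sum>n\<in>(\<lambda>m. m ^ 2) ` {1..M}. (\<Sum>d | d dvd n. \<psi> d) * x ^ n)"
  proof (rule sum_mono2)
    show "(\<lambda>m. m ^ 2) ` {1..M} \<subseteq> {1..D}"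
    proof safe
      fix m assume "m \<in> {1..M}"
      then have "1 \<le> m ^ 2" by simp
      moreover have "m ^ 2 \<le> D" using \<open>m \<in> {1..M}\<close> by (intro order_trans[OF power_mono M]) auto
      ultimately show "m ^ 2 \<in> {1..D}" by simp
    qed
    fix n assume "n \<in> {1..D} - (\<lambda>m. m ^ 2) ` {1..M}"
    then show "0 \<le> (\<Sum>d | d dvd n. \<psi> d) * x ^ n"
      using divisor_sum_chi[OF chi, of n] x by (auto intro!: mult_nonneg_nonneg split: if_splits)
  qed auto
  also have "(\<Sum>n\<in>(\<lambda>m. m ^ 2) ` {1..M}. (\<Sum>d | d dvd n. \<psi> d) * x ^ n) = (\<Sum>m\<in>{1..M}. (\<Sum>d | d dvd m ^ 2. \<psi> d) * x ^ (m ^ 2))"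
    by (subst sum.reindex) (auto intro!: inj_onI)
  also have "\<dots> \<ge> (\<Sum>m\<in>{1..M}. 1 * x ^ (m ^ 2))"
  proof (intro sum_mono mult_right_mono)
    fix m assume "m \<in> {1..M}"
    then show "1 \<le> (\<Sum>d | d dvd m ^ 2. \<psi> d)" using divisor_sum_chi[OF chi, of "m ^ 2"]
      by (auto split: if_splits)
  qed (use x in auto)
  finally have *: "(\<Sum>m\<in>{1..M}. x ^ (m ^ 2)) \<le> (\<Sum>d\<in>{1..D}. \<psi> d * (\<Sum>j\<in>{1..D div d}. x ^ (d * j)))" by simp
  have "\<bar>(\<Sum>d\<in>{1..D}. \<psi> d * (x ^ d / (1 - x ^ d))) - (\<Sum>d\<in>{1..D}. \<psi> d * (\<Sum>j\<in>{1..D div d}. x ^ (d * j)))\<bar>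
     \<le> (\<Sum>d\<in>{1..D}. \<bar>\<psi> d * (x ^ d / (1 - x ^ d) - (\<Sum>j\<in>{1..D div d}. x ^ (d * j)))\<bar>)"
    unfolding sum_subtractf[symmetric] right_diff_distrib[symmetric] by (rule sum_abs)
  also have "\<dots> \<le> (\<Sum>d\<in>{1..D}. 1 * (x ^ D / (1 - x)))"
    unfolding abs_mult using x by (intro sum_mono mult_mono chi_abs_le[OF chi] lambert_term) auto
  also have "\<dots> = D * x ^ D / (1 - x)" by simp
  finally show ?thesis using * by linarith
qed

text \<open>If the sum were 0, the Lambert series would equal minus the series of the gaps, which is bounded
  uniformly in \<open>x < 1\<close> because the gaps decrease from 1 to 0. But the square exponents alone make
  the Lambert series unbounded as \<open>x\<close> tends to 1.\<close>

theorem L1_nonzero: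
  assumes a: "\<psi> a = - 1"
  shows "(\<Sum>n. \<psi> n * (1 / n)) \<noteq> 0"
proof
  assume L0: "(\<Sum>n. \<psi> n * (1 / n)) = 0"
  note dir = chi_dirichlet[OF chi a]
  have sm1: "summable (\<lambda>n. \<psi> n * (1 / n))"
    by (rule dir(1)[of 1]) (auto intro!: lim_1_over_n divide_left_mono)
  have main: "(\<Sum>m\<in>{1..M}. x ^ (m ^ 2)) \<le> 2 * real N" if x: "0 < x" "x < 1" for x :: real and M :: nat
  proof -
    note gap = lambert_gap_nonneg[OF x] lambert_gap_decreasing[OF x] lambert_gap_tendsto_0[OF x]
    have sm2: "summable (\<lambda>n. \<psi> n * lambert_gap x n)" by (rule dir(1)[of 1]) (use gap in auto)
    have "\<bar>(\<Sum>n. \<psi> n * lambert_gap x n) - (\<Sum>n<1. \<psi> n * lambert_gap x n)\<bar> \<le> 2 * real N * lambert_gap x 1"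
      by (rule dir(2)[of 1]) (use gap in auto)
    moreover have "lambert_gap x 1 = 1" using x by (simp add: lambert_gap_def diff_divide_distrib[symmetric])
    ultimately have bd: "\<bar>\<Sum>n. \<psi> n * lambert_gap x n\<bar> \<le> 2 * real N"
      by (simp add: chi_0[OF chi a])
    have "(\<lambda>n. (1 / (1 - x)) * (\<psi> n * (1 / n)) - \<psi> n * lambert_gap x n) sums
        ((1 / (1 - x)) * 0 - (\<Sum>n. \<psi> n * lambert_gap x n))"
      by (intro sums_diff sums_mult summable_sums sm2) (use sm1 L0 in \<open>simp add: sums_iff\<close>)
    moreover have "(1 / (1 - x)) * (\<psi> n * (1 / n)) - \<psi> n * lambert_gap x n = \<psi> n * (x ^ n / (1 - x ^ n))" for n
      by (simp add: lambert_gap_def right_diff_distrib[of "\<psi> n"] mult.commute)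
    ultimately have S: "(\<lambda>n. \<psi> n * (x ^ n / (1 - x ^ n))) sums (- (\<Sum>n. \<psi> n * lambert_gap x n))" by simp
    have lim1: "(\<lambda>D. (\<Sum>d\<in>{1..D}. \<psi> d * (x ^ d / (1 - x ^ d)))) \<longlonglongrightarrow> - (\<Sum>n. \<psi> n * lambert_gap x n)"
    proof -
      have "(\<lambda>D. (\<Sum>d<Suc D. \<psi> d * (x ^ d / (1 - x ^ d)))) \<longlonglongrightarrow> - (\<Sum>n. \<psi> n * lambert_gap x n)"
        using S unfolding sums_def by (rule LIMSEQ_Suc)
      moreover have "(\<Sum>d<Suc D. \<psi> d * (x ^ d / (1 - x ^ d))) = (\<Sum>d\<in>{1..D}. \<psi> d * (x ^ d / (1 - x ^ d)))" for D
        by (rule sum.mono_neutral_right) (auto simp: chi_0[OF chi a] not_less_eq_eq)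
      ultimately show ?thesis by simp
    qed
    have lim2: "(\<lambda>D. (\<Sum>m\<in>{1..M}. x ^ (m ^ 2)) - D * x ^ D / (1 - x)) \<longlonglongrightarrow> (\<Sum>m\<in>{1..M}. x ^ (m ^ 2)) - 0 / (1 - x)"
      using x by (intro tendsto_intros powser_times_n_limit_0) auto
    have "(\<Sum>m\<in>{1..M}. x ^ (m ^ 2)) - 0 / (1 - x) \<le> - (\<Sum>n. \<psi> n * lambert_gap x n)"
    proof (rule tendsto_le[OF _ lim1 lim2])
      show "\<forall>\<^sub>F D in sequentially. (\<Sum>m\<in>{1..M}. x ^ (m ^ 2)) - D * x ^ D / (1 - x)
          \<le> (\<Sum>d\<in>{1..D}. \<psi> d * (x ^ d / (1 - x ^ d)))"
        using eventually_ge_at_top[of "M ^ 2"] by eventually_elim (rule lambert_partial[OF x])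
    qed simp
    then show ?thesis using bd by simp
  qed
  define M where "M = 2 * N + 1"
  have "((\<lambda>x::real. \<Sum>m\<in>{1..M}. x ^ (m ^ 2)) \<longlongrightarrow> (\<Sum>m\<in>{1..M}. 1 ^ (m ^ 2))) (at_left 1)"
    by (intro tendsto_intros)
  moreover have "\<forall>\<^sub>F x in at_left 1. (\<Sum>m\<in>{1..M}. x ^ (m ^ 2)) \<le> 2 * real N"
    by (rule eventually_at_leftI[of 0]) (use main in auto)
  ultimately have "(\<Sum>m\<in>{1..M}. (1::real) ^ (m ^ 2)) \<le> 2 * real N"
    by (rule tendsto_upperbound) simp
  then show False by (simp add: M_def)
qed

end

section \<open>Dirichlet series near 1\<close>

lemma dirichlet_convolution_sums:
  fixes f g :: "nat \<Rightarrow> real"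
  assumes f: "summable (\<lambda>n. \<bar>f n\<bar>)" "f 0 = 0" and g: "summable (\<lambda>n. \<bar>g n\<bar>)" "g 0 = 0"
  shows "(\<lambda>n. \<Sum>d | d dvd n. f d * g (n div d)) sums (suminf f * suminf g)"
proof -
  have hs: "(h has_sum suminf h) {1..}" if "summable (\<lambda>n. \<bar>h n\<bar>)" "h 0 = 0" for h :: "nat \<Rightarrow> real"
  proof -
    have "(h has_sum suminf h) UNIV"
      using that by (intro norm_summable_imp_has_sum) (auto intro: summable_sums summable_rabs_cancel)
    then show ?thesis by (rule has_sum_cong_neutral[THEN iffD1, rotated -1]) (use that in \<open>auto simp: not_less_eq_eq\<close>)
  qed
  have pairs: "((\<lambda>(d, m). f d * g m) has_sum (suminf f * suminf g)) ({1..} \<times> {1..})"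
  proof (rule has_sum_SigmaI)
    show "((\<lambda>m. case (d, m) of (d, m) \<Rightarrow> f d * g m) has_sum (f d * suminf g)) {1..}" for d
      using has_sum_cmult_right[OF hs[OF g], of "f d"] by simp
    show "((\<lambda>d. f d * suminf g) has_sum (suminf f * suminf g)) {1..}"
      by (intro has_sum_cmult_left hs f)
    show "(\<lambda>(d, m). f d * g m) summable_on {1..} \<times> {1..}"
    proof (rule abs_summable_summable, rule summable_on_SigmaI)
      show "((\<lambda>m. norm (case (d, m) of (d, m) \<Rightarrow> f d * g m)) has_sum (\<bar>f d\<bar> * (\<Sum>n. \<bar>g n\<bar>))) {1..}" for d
        using has_sum_cmult_right[OF hs[of "\<lambda>n. \<bar>g n\<bar>"], of "\<bar>f d\<bar>"] g by (simp add: abs_mult)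
      have "((\<lambda>d. \<bar>f d\<bar> * (\<Sum>n. \<bar>g n\<bar>)) has_sum ((\<Sum>n. \<bar>f n\<bar>) * (\<Sum>n. \<bar>g n\<bar>))) {1..}"
        by (intro has_sum_cmult_left hs) (use f in auto)
      then show "(\<lambda>d. \<bar>f d\<bar> * (\<Sum>n. \<bar>g n\<bar>)) summable_on {1..}" by (rule has_sum_imp_summable)
    qed auto
  qed
  have "((\<lambda>(n, d). f d * g (n div d)) has_sum (suminf f * suminf g)) (Sigma {1..} (\<lambda>n. {d. d dvd n}))"
    by (rule has_sum_reindex_bij_witness[of _ "\<lambda>(d, m). (d * m, d)" "\<lambda>(n, d). (d, n div d)", THEN iffD2, OF _ _ _ _ _ _ pairs])
       (auto simp: Suc_le_eq dvd_pos_nat div_greater_zero_iff intro: dvd_imp_le)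
  then have "((\<lambda>n. \<Sum>d | d dvd n. f d * g (n div d)) has_sum (suminf f * suminf g)) {1..}"
    by (rule has_sum_SigmaD) (auto intro!: has_sum_finiteI)
  then have "((\<lambda>n. \<Sum>d | d dvd n. f d * g (n div d)) has_sum (suminf f * suminf g)) UNIV"
    by (rule has_sum_cong_neutral[THEN iffD1, rotated -1]) (auto simp: not_less_eq_eq)
  then show ?thesis by (rule has_sum_imp_sums)
qed

lemma summable_powr_minus: "s > 1 \<Longrightarrow> summable (\<lambda>n. real n powr - s)"
  using summable_real_powr_iff[of "- s"] by simp

lemma summable_ln_powr_minus:
  assumes "s > 1"
  shows "summable (\<lambda>n. ln (real n) * real n powr - s)"
proof (rule summable_comparison_test)
  define e where "e = (s - 1) / 2"
  have e: "e > 0" "e - s < - 1" using assms by (simp_all add: e_def field_simps)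
  show "summable (\<lambda>n. (1 / e) * real n powr (e - s))"
    using e summable_real_powr_iff[of "e - s"] by (intro summable_mult) auto
  show "\<exists>N. \<forall>n\<ge>N. norm (ln (real n) * real n powr - s) \<le> (1 / e) * real n powr (e - s)"
  proof (intro exI[of _ 1] allI impI)
    fix n :: nat assume n: "1 \<le> n"
    have "ln (real n) * real n powr - s \<le> (real n powr e / e) * real n powr - s"
      using n e by (intro mult_right_mono ln_powr_bound) auto
    also have "\<dots> = (1 / e) * real n powr (e - s)"
      using n by (simp add: powr_diff powr_minus divide_inverse)
    finally show "norm (ln (real n) * real n powr - s) \<le> (1 / e) * real n powr (e - s)"
      using n by (simp add: abs_mult)
  qed
qed

context
  fixes N :: nat and \<psi> :: "nat \<Rightarrow> real"
  assumes chi: "real_character N \<psi>"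
begin

lemma summable_character_series:
  assumes s: "s > 1"
  shows "summable (\<lambda>n. \<bar>\<psi> n * real n powr - s\<bar>)"
    and "summable (\<lambda>n. \<bar>\<psi> n * (ln n * real n powr - s)\<bar>)"
    and "summable (\<lambda>n. \<bar>mangoldt n * \<psi> n * real n powr - s\<bar>)"
proof -
  have psi: "\<bar>\<psi> n * b\<bar> \<le> \<bar>b\<bar>" for n b
    using chi_abs_le[OF chi, of n] by (simp add: abs_mult mult_left_le_one_le)
  have ln_nonneg: "ln (real n) \<ge> 0" for n by (cases n) auto
  show "summable (\<lambda>n. \<bar>\<psi> n * real n powr - s\<bar>)"
    by (rule summable_comparison_test'[OF summable_powr_minus[OF s], of 0])
      (use psi[of _ "real _ powr - s"] in auto)
  show "summable (\<lambda>n. \<bar>\<psi> n * (ln n * real n powr - s)\<bar>)"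
  proof (rule summable_comparison_test'[OF summable_ln_powr_minus[OF s], of 0])
    fix n :: nat
    show "norm \<bar>\<psi> n * (ln n * real n powr - s)\<bar> \<le> ln n * real n powr - s"
      using psi[of n "ln n * real n powr - s"] ln_nonneg[of n] by (simp add: abs_mult)
  qed
  show "summable (\<lambda>n. \<bar>mangoldt n * \<psi> n * real n powr - s\<bar>)"
  proof (rule summable_comparison_test'[OF summable_ln_powr_minus[OF s], of 0])
    fix n :: nat
    have "\<bar>mangoldt n * \<psi> n * real n powr - s\<bar> \<le> \<bar>mangoldt n * real n powr - s\<bar>"
      using psi[of n "mangoldt n * real n powr - s"] by (simp add: mult_ac)
    also have "\<dots> \<le> ln n * real n powr - s"
      by (cases "n = 0") (auto simp: abs_mult intro!: mult_right_mono mangoldt_le)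
    finally show "norm \<bar>mangoldt n * \<psi> n * real n powr - s\<bar> \<le> ln n * real n powr - s" by simp
  qed
qed

text \<open>The relation between the derivative of an L-series and its logarithmic derivative, read off from the convolution identity for the von Mangoldt function.\<close>

lemma character_log_derivative:
  assumes s: "s > 1"
  shows "(\<Sum>n. mangoldt n * \<psi> n * real n powr - s) * (\<Sum>n. \<psi> n * real n powr - s)
    = (\<Sum>n. \<psi> n * (ln n * real n powr - s))"
proof -
  have "(\<lambda>n. \<Sum>d | d dvd n. (mangoldt d * \<psi> d * real d powr - s) * (\<psi> (n div d) * real (n div d) powr - s))
     sums ((\<Sum>n. mangoldt n * \<psi> n * real n powr - s) * (\<Sum>n. \<psi> n * real n powr - s))"
    by (rule dirichlet_convolution_sums) (use summable_character_series[OF s] in auto)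
  moreover have "(\<Sum>d | d dvd n. (mangoldt d * \<psi> d * real d powr - s) * (\<psi> (n div d) * real (n div d) powr - s))
     = \<psi> n * (ln n * real n powr - s)" for n
  proof (cases "n = 0")
    case False
    have "(mangoldt d * \<psi> d * real d powr - s) * (\<psi> (n div d) * real (n div d) powr - s)
        = mangoldt d * (\<psi> n * real n powr - s)" if d: "d dvd n" for d
    proof -
      obtain m where m: "n = d * m" using d by blast
      then show ?thesis using False by (simp add: chi_mult[OF chi] powr_mult)
    qed
    then have "(\<Sum>d | d dvd n. (mangoldt d * \<psi> d * real d powr - s) * (\<psi> (n div d) * real (n div d) powr - s))
      = (\<Sum>d | d dvd n. mangoldt d) * (\<psi> n * real n powr - s)"
      unfolding sum_distrib_right by (intro sum.cong refl) blast
    also have "(\<Sum>d | d dvd n. mangoldt d :: real) = ln n" using False by (simp add: mangoldt_sum)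
    finally show ?thesis by simp
  qed simp
  ultimately show ?thesis by (simp add: sums_iff)
qed

text \<open>Near 1 the L-series stays away from 0, by its non-vanishing at 1, and its derivative stays bounded, by the Dirichlet test; hence the quotient is bounded.\<close>

lemma mangoldt_series_bounded:
  assumes a: "\<psi> a = - 1"
  shows "\<exists>C. \<forall>\<^sub>F s in at_right 1. \<bar>\<Sum>n. mangoldt n * \<psi> n * real n powr - s\<bar> \<le> C"
proof -
  define K where "K = 2 * real N"
  note dir = chi_dirichlet[OF chi a, folded K_def]
  have K: "K > 0" using N_pos[OF chi] by (simp add: K_def)
  define L1 where "L1 = (\<Sum>n. \<psi> n * (1 / n))"
  have L1: "L1 \<noteq> 0" unfolding L1_def by (rule L1_nonzero[OF chi a])
  have dec: "real (Suc i) powr - s \<le> real i powr - s" if "s > 1" "i \<ge> 1" for s i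
    using that by (intro powr_mono2') auto
  have to0: "(\<lambda>n. real n powr - s) \<longlonglongrightarrow> 0" if "s > 1" for s
    using summable_LIMSEQ_zero[OF summable_powr_minus[OF that]] .
  \<comment> \<open>\<open>K / m\<close> bounds the tail after \<open>m\<close> terms uniformly in \<open>s \<ge> 1\<close>, so \<open>m\<close> terms decide about vanishing near 1\<close>
  obtain m :: nat where m: "m \<ge> 1" "K / m < \<bar>L1\<bar> / 8"
  proof -
    obtain m :: nat where "m > 8 * K / \<bar>L1\<bar>" using reals_Archimedean2 by blast
    moreover from this have "m \<ge> 1" using K L1 by (cases m) (auto simp: divide_less_0_iff)
    ultimately show ?thesis using that[of m] L1 by (simp add: field_simps)
  qed
  have "((\<lambda>s. \<Sum>n<m. \<psi> n * real n powr - s) \<longlongrightarrow> (\<Sum>n<m. \<psi> n * real n powr - 1)) (at_right 1)"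
  proof (rule tendsto_sum)
    fix n assume "n \<in> {..<m}"
    show "((\<lambda>s. \<psi> n * real n powr - s) \<longlongrightarrow> \<psi> n * real n powr - 1) (at_right 1)"
    proof (cases "n = 0")
      case False
      then show ?thesis by (intro tendsto_intros) auto
    qed simp
  qed
  moreover have "(\<Sum>n<m. \<psi> n * real n powr - 1) = (\<Sum>n<m. \<psi> n * (1 / n))"
    by (intro sum.cong refl) (simp add: powr_minus divide_inverse)
  ultimately have "((\<lambda>s. \<Sum>n<m. \<psi> n * real n powr - s) \<longlongrightarrow> (\<Sum>n<m. \<psi> n * (1 / n))) (at_right 1)"
    by (simp only:)
  then have "\<forall>\<^sub>F s in at_right 1. dist (\<Sum>n<m. \<psi> n * real n powr - s) (\<Sum>n<m. \<psi> n * (1 / n)) < \<bar>L1\<bar> / 8"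
    by (rule tendstoD) (use L1 in simp)
  moreover have "\<forall>\<^sub>F s in at_right 1. s > (1::real)" by (simp add: eventually_at_right_less)
  ultimately have "\<forall>\<^sub>F s in at_right 1. \<bar>\<Sum>n. mangoldt n * \<psi> n * real n powr - s\<bar> \<le> (ln 2 + K * (ln 3 / 3)) / (\<bar>L1\<bar> / 2)"
  proof eventually_elim
    case (elim s)
    note s = elim(2)
    have "\<bar>(\<Sum>n. \<psi> n * real n powr - s) - (\<Sum>n<m. \<psi> n * real n powr - s)\<bar> \<le> K * real m powr - s"
      by (rule dir(2)[of 1]) (use dec to0 s m in auto)
    also have "\<dots> \<le> K * real m powr - 1" using K m s by (intro mult_left_mono powr_mono) auto
    finally have 1: "\<bar>(\<Sum>n. \<psi> n * real n powr - s) - (\<Sum>n<m. \<psi> n * real n powr - s)\<bar> \<le> K / m"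
      by (simp add: powr_minus divide_inverse)
    have 2: "\<bar>L1 - (\<Sum>n<m. \<psi> n * (1 / n))\<bar> \<le> K * (1 / m)"
      unfolding L1_def by (rule dir(2)[of 1]) (use m in \<open>auto intro!: lim_1_over_n divide_left_mono\<close>)
    have "K * (1 / m) = K / m" by simp
    then have Ls: "\<bar>\<Sum>n. \<psi> n * real n powr - s\<bar> \<ge> \<bar>L1\<bar> / 2"
      using 1 2 m(2) elim(1) unfolding dist_real_def by linarith
    have declog: "ln (real (Suc i)) * real (Suc i) powr - s \<le> ln (real i) * real i powr - s" if i: "i \<ge> 3" for i
    proof -
      have eq: "ln (real i) * real i powr - s = (ln (real i) / real i) * real i powr (1 - s)" if "i \<ge> 1" for i
        using that by (simp add: powr_diff powr_minus field_simps)
      have "(ln (real (Suc i)) / real (Suc i)) * real (Suc i) powr (1 - s) \<le> (ln (real i) / real i) * real i powr (1 - s)"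
        using i s exp_le by (intro mult_mono ln_x_over_x_mono powr_mono2') auto
      then show ?thesis using eq[of i] eq[of "Suc i"] i by simp
    qed
    have "\<bar>(\<Sum>n. \<psi> n * (ln n * real n powr - s)) - (\<Sum>n<3. \<psi> n * (ln n * real n powr - s))\<bar> \<le> K * (ln (real 3) * real 3 powr - s)"
    proof (rule dir(2)[of 3])
      show "(\<lambda>n. ln (real n) * real n powr - s) \<longlonglongrightarrow> 0"
        using summable_LIMSEQ_zero[OF summable_ln_powr_minus[OF s]] .
    qed (use declog in auto)
    also have "\<dots> \<le> K * (ln 3 / 3)"
    proof -
      have "(3::real) powr - s \<le> 3 powr - 1" using s by (intro powr_mono) auto
      then have "ln 3 * (3::real) powr - s \<le> ln 3 * (1 / 3)" by (intro mult_left_mono) (auto simp: powr_minus)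
      then show ?thesis using K by simp
    qed
    finally have 2: "\<bar>(\<Sum>n. \<psi> n * (ln n * real n powr - s)) - (\<Sum>n<3. \<psi> n * (ln n * real n powr - s))\<bar> \<le> K * (ln 3 / 3)" .
    have "\<bar>\<Sum>n<3. \<psi> n * (ln n * real n powr - s)\<bar> \<le> ln 2"
    proof -
      have "\<bar>\<psi> 2 * (ln 2 * 2 powr - s)\<bar> \<le> 1 * (ln 2 * 2 powr 0)"
      proof -
        have "(2::real) powr - s \<le> 2 powr 0" using s by (intro powr_mono) auto
        then show ?thesis
          unfolding abs_mult using chi_abs_le[OF chi, of 2] by (intro mult_mono) auto
      qed
      then show ?thesis by (simp add: numeral_3_eq_3 numeral_2_eq_2)
    qed
    then have A: "\<bar>\<Sum>n. \<psi> n * (ln n * real n powr - s)\<bar> \<le> ln 2 + K * (ln 3 / 3)" using 2 by linarith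
    have "\<bar>\<Sum>n. mangoldt n * \<psi> n * real n powr - s\<bar> * (\<bar>L1\<bar> / 2)
       \<le> \<bar>\<Sum>n. mangoldt n * \<psi> n * real n powr - s\<bar> * \<bar>\<Sum>n. \<psi> n * real n powr - s\<bar>"
      using Ls by (intro mult_left_mono) auto
    also have "\<dots> = \<bar>\<Sum>n. \<psi> n * (ln n * real n powr - s)\<bar>"
      by (simp only: abs_mult[symmetric] character_log_derivative[OF s])
    finally show ?case using A L1 by (simp add: pos_le_divide_eq)
  qed
  then show ?thesis by blast
qed

end

section \<open>Primes with prescribed values of real characters\<close>

lemma real_character_principal:
  "N > 0 \<Longrightarrow> real_character N (\<lambda>n. if coprime n N then 1 else 0)"
  unfolding real_character_def by (auto simp: coprime_mod_left_iff)

lemma principal_series_unbounded: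
  assumes N: "N > 0"
  shows "\<forall>\<^sub>F s in at_right 1. (\<Sum>n. (if coprime n N then 1 else 0) * real n powr - s) \<ge> B"
proof -
  define \<psi> :: "nat \<Rightarrow> real" where "\<psi> = (\<lambda>n. if coprime n N then 1 else 0)"
  have chi: "real_character N \<psi>" unfolding \<psi>_def by (rule real_character_principal[OF N])
  have "\<not> summable (\<lambda>n. inverse (real (Suc n)))"
    using not_summable_harmonic[where 'a = real] summable_Suc_iff[of "\<lambda>n. inverse (real n)"] by simp
  then have "\<not> (\<forall>n. (\<Sum>i<n. inverse (real (Suc i))) \<le> 2 * real N * \<bar>B\<bar> + 2)"
  proof (rule contrapos_nn)
    assume all: "\<forall>n. (\<Sum>i<n. inverse (real (Suc i))) \<le> 2 * real N * \<bar>B\<bar> + 2"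
    have "(\<Sum>i\<le>n. inverse (real (Suc i))) \<le> 2 * real N * \<bar>B\<bar> + 2" for n
      using all[rule_format, of "Suc n"] by (simp only: lessThan_Suc_atMost)
    then show "summable (\<lambda>n. inverse (real (Suc n)))"
      by (intro bounded_imp_summable[where B = "2 * real N * \<bar>B\<bar> + 2"]) auto
  qed
  then obtain J where J: "(\<Sum>i<J. inverse (real (Suc i))) > 2 * real N * \<bar>B\<bar> + 2" by (auto simp: not_le)
  define S where "S = (\<lambda>i. Suc (i * N)) ` {..<J}"
  have cop: "\<psi> n = 1" if nS: "n \<in> S" for n
  proof -
    obtain i where i: "n = Suc (i * N)" using nS by (auto simp: S_def)
    have "n mod N = 1 mod N" unfolding i by (metis mod_mult_self1 plus_1_eq_Suc)
    then have "coprime n N" using N by (metis coprime_1_left coprime_mod_left_iff gr_implies_not0)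
    then show ?thesis by (simp add: \<psi>_def)
  qed
  have "((\<lambda>s. \<Sum>n\<in>S. real n powr - s) \<longlongrightarrow> (\<Sum>n\<in>S. real n powr - 1)) (at_right 1)"
    by (intro tendsto_intros) (auto simp: S_def)
  moreover have "(\<Sum>n\<in>S. real n powr - 1) > B"
  proof -
    have "(\<Sum>n\<in>S. real n powr - 1) = (\<Sum>i<J. inverse (real (Suc (i * N))))"
      unfolding S_def using N by (subst sum.reindex) (auto simp: inj_on_def powr_minus)
    moreover have "(\<Sum>i<J. inverse (real (Suc i)) / real N) \<le> (\<Sum>i<J. inverse (real (Suc (i * N))))"
    proof (rule sum_mono)
      fix i
      have "real (Suc (i * N)) \<le> real (Suc i) * real N" using N by (simp add: algebra_simps)
      then have "inverse (real (Suc i) * real N) \<le> inverse (real (Suc (i * N)))"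
        by (intro le_imp_inverse_le) (auto intro!: add_pos_nonneg)
      then show "inverse (real (Suc i)) / real N \<le> inverse (real (Suc (i * N)))"
        by (simp add: field_simps)
    qed
    moreover have "(\<Sum>i<J. inverse (real (Suc i)) / real N) = (\<Sum>i<J. inverse (real (Suc i))) / real N"
      by (rule sum_divide_distrib[symmetric])
    moreover have "(\<Sum>i<J. inverse (real (Suc i))) / real N > B"
    proof -
      have "B * real N \<le> \<bar>B\<bar> * real N" by (intro mult_right_mono) auto
      then have "B * real N < (\<Sum>i<J. inverse (real (Suc i)))" 
      proof -
        have "2 * real N * \<bar>B\<bar> = \<bar>B\<bar> * real N + \<bar>B\<bar> * real N" "0 \<le> \<bar>B\<bar> * real N" by simp_all
        then show ?thesis using J \<open>B * real N \<le> \<bar>B\<bar> * real N\<close> by linarith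
      qed
      then show ?thesis using N by (simp add: pos_less_divide_eq)
    qed
    ultimately show ?thesis by linarith
  qed
  ultimately have "\<forall>\<^sub>F s in at_right 1. (\<Sum>n\<in>S. real n powr - s) > B" by (rule order_tendstoD)
  moreover have "\<forall>\<^sub>F s in at_right 1. s > (1::real)" by (simp add: eventually_at_right_less)
  ultimately show ?thesis
  proof eventually_elim
    case (elim s)
    have "(\<Sum>n\<in>S. real n powr - s) = (\<Sum>n\<in>S. \<psi> n * real n powr - s)" by (simp add: cop)
    also have "\<dots> \<le> (\<Sum>n. \<psi> n * real n powr - s)"
      using summable_character_series(1)[OF chi elim(2)]
      by (intro sum_le_suminf summable_rabs_cancel[of "\<lambda>n. \<psi> n * real n powr - s"]) (auto simp: S_def \<psi>_def)
    finally show ?case using elim(1) by (simp add: \<psi>_def)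
  qed
qed

text \<open>In the derivative of the L-series of the principal character, the terms with \<open>n \<ge> M\<close> carry a factor
  at least \<open>ln M\<close>, and the terms with \<open>n < M\<close> are negligible against the divergent series itself. So
  the quotient eventually exceeds \<open>ln M / 2\<close>, for every \<open>M\<close>.\<close>

lemma principal_mangoldt_unbounded:
  assumes N: "N > 0"
  shows "\<forall>\<^sub>F s in at_right 1. (\<Sum>n. mangoldt n * (if coprime n N then 1 else 0) * real n powr - s) \<ge> B"
proof -
  define \<psi> :: "nat \<Rightarrow> real" where "\<psi> = (\<lambda>n. if coprime n N then 1 else 0)"
  have chi: "real_character N \<psi>" unfolding \<psi>_def by (rule real_character_principal[OF N])
  obtain M :: nat where M: "real M \<ge> exp (2 * \<bar>B\<bar>)" using real_arch_simple by blast
  have M1: "M > 0" using M by (cases M) auto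
  have "ln (exp (2 * \<bar>B\<bar>)) \<le> ln (real M)" using M M1 by (subst ln_le_cancel_iff) auto
  then have lnM: "ln M \<ge> 2 * \<bar>B\<bar>" by simp
  have "\<forall>\<^sub>F s in at_right 1. (\<Sum>n. \<psi> n * real n powr - s) \<ge> 2 * M"
    using principal_series_unbounded[OF N] unfolding \<psi>_def .
  moreover have "\<forall>\<^sub>F s in at_right 1. s > (1::real)" by (simp add: eventually_at_right_less)
  ultimately show ?thesis
  proof eventually_elim
    case (elim s)
    define L where "L = (\<Sum>n. \<psi> n * real n powr - s)"
    define P where "P = (\<Sum>n. mangoldt n * \<psi> n * real n powr - s)"
    note sm = summable_character_series[OF chi elim(2), THEN summable_rabs_cancel]
    have psi: "\<psi> n \<ge> 0" "\<psi> n \<le> 1" for n by (auto simp: \<psi>_def)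
    have lnn: "ln (real n) \<ge> 0" for n by (cases n) auto
    have le: "ln M * (\<psi> n * real n powr - s) - (if n < M then ln M else 0) \<le> \<psi> n * (ln n * real n powr - s)" for n
    proof (cases "n < M")
      case True
      have "real n powr - s \<le> 1"
      proof (cases "n = 0")
        case False
        then have "real n powr - s \<le> real n powr 0" using elim by (intro powr_mono) auto
        then show ?thesis using False by simp
      qed simp
      then have "\<psi> n * real n powr - s \<le> 1 * 1" using psi by (intro mult_mono) auto
      then have "ln M * (\<psi> n * real n powr - s) \<le> ln M" using lnn[of M] by (simp add: mult_left_le)
      moreover have "0 \<le> \<psi> n * (ln n * real n powr - s)" using psi lnn by simp
      ultimately show ?thesis using True by simp
    next
      case False
      have "ln M \<le> ln n" using False M1 by simp
      then have "ln M * (\<psi> n * real n powr - s) \<le> ln n * (\<psi> n * real n powr - s)"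
        using psi by (intro mult_right_mono) auto
      then show ?thesis using False by (simp add: mult_ac)
    qed
    have fin: "(\<lambda>n. if n < M then ln M else 0 :: real) sums (\<Sum>n<M. ln M)"
      using sums_If_finite_set[of "{..<M}" "\<lambda>_. ln M :: real"] by simp
    have "ln M * L - M * ln M \<le> P * L"
    proof -
      have "ln M * L - (\<Sum>n<M. ln M) = (\<Sum>n. ln M * (\<psi> n * real n powr - s) - (if n < M then ln M else 0))"
        unfolding L_def by (rule sums_unique, intro sums_diff fin sums_mult summable_sums sm(1))
      also have "\<dots> \<le> (\<Sum>n. \<psi> n * (ln n * real n powr - s))"
        by (intro suminf_le le sm(2) summable_diff summable_mult sm(1)) (use fin in \<open>auto simp: sums_iff\<close>)
      also have "\<dots> = P * L" unfolding P_def L_def by (rule character_log_derivative[OF chi elim(2), symmetric])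
      finally show ?thesis by simp
    qed
    moreover have "L \<ge> 2 * M" using elim(1) by (simp add: L_def)
    moreover from this have "M * ln M \<le> (L / 2) * ln M" using lnn[of M] by (intro mult_right_mono) auto
    ultimately have "(ln M / 2) * L \<le> P * L" by (simp add: algebra_simps)
    moreover have "L > 0" using \<open>L \<ge> 2 * M\<close> M1 by simp
    ultimately have "ln M / 2 \<le> P" by (rule mult_right_le_imp_le)
    then have "B \<le> P" using lnM by linarith
    then show ?case by (simp add: P_def \<psi>_def)
  qed
qed

lemma summable_ln_over_squares:
  "summable (\<lambda>n. if \<exists>m. n = m ^ 2 then ln (real n) * real n powr - 1 else 0)"
proof -
  define f :: "nat \<Rightarrow> real" where "f = (\<lambda>n. if \<exists>m. n = m ^ 2 then ln (real n) * real n powr - 1 else 0)"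
  have "f (m ^ 2) = 2 * (ln (real m) * real m powr - 2)" for m
  proof (cases "m = 0")
    case False
    then show ?thesis by (auto simp: f_def powr_minus ln_realpow power2_eq_square ln_mult)
  qed (auto simp: f_def)
  then have "summable (\<lambda>m. f (m ^ 2))"
    using summable_ln_powr_minus[of 2] by (simp add: summable_mult)
  moreover have "strict_mono (\<lambda>m::nat. m ^ 2)" by (intro strict_monoI power_strict_mono) auto
  ultimately have "summable f"
    by (subst (asm) summable_mono_reindex) (auto simp: f_def)
  then show ?thesis by (simp add: f_def)
qed

text \<open>Among the prime powers, those with even exponent are squares and contribute a convergent series,
  while a real character takes the same value at \<open>p\<^sup>k\<close> and \<open>p\<close> when \<open>k\<close> is odd.\<close>

lemma prime_or_square_mangoldt:
  assumes "mangoldt n \<noteq> (0::real)" "\<not> (\<exists>m. n = m ^ 2)"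
  obtains p k where "prime p" "odd k" "n = p ^ k"
proof -
  have "primepow n" using assms(1) by (auto simp: mangoldt_def split: if_splits)
  then obtain p k where pk: "prime p" "n = p ^ k" by (auto simp: primepow_def)
  have "odd k"
  proof
    assume "even k"
    then obtain j where "k = 2 * j" by blast
    then have "n = (p ^ j) ^ 2" using pk by (simp add: power_mult[symmetric] mult.commute)
    then show False using assms(2) by blast
  qed
  then show ?thesis using pk that by blast
qed

text \<open>Summing \<open>\<Lambda> n * (\<Prod>i\<in>I. 1 + \<epsilon> i * \<psi> i n) * n powr - s\<close> over \<open>n\<close> coprime to \<open>N\<close> and expanding the product gives one
  series for each subset \<open>J\<close> of \<open>I\<close>. By the independence assumption only the one for the empty set is
  unbounded as \<open>s\<close> tends to 1. If no prime had the prescribed values, the product would vanish at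
  every odd power of a prime, and the sum would be bounded by a series over squares.\<close>

theorem prime_with_character_values:
  fixes \<psi> :: "'i \<Rightarrow> nat \<Rightarrow> real"
  assumes I: "finite I" and N: "N > 0" and chi: "\<And>i. i \<in> I \<Longrightarrow> real_character N (\<psi> i)"
    and eps: "\<And>i. i \<in> I \<Longrightarrow> \<epsilon> i = 1 \<or> \<epsilon> i = - 1"
    and indep: "\<And>J. J \<subseteq> I \<Longrightarrow> J \<noteq> {} \<Longrightarrow> \<exists>a. coprime a N \<and> (\<Prod>j\<in>J. \<psi> j a) = - 1"
  obtains q where "prime q" "coprime q N" "\<And>i. i \<in> I \<Longrightarrow> \<psi> i q = \<epsilon> i"
proof (rule ccontr)
  note found = that
  assume "\<not> thesis"
  then have no: "\<exists>i\<in>I. \<psi> i q \<noteq> \<epsilon> i" if "prime q" "coprime q N" for q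
    using that found[of q] by blast
  define X where "X J n = (if coprime n N then 1 else 0) * (\<Prod>j\<in>J. \<psi> j n)" for J n
  define E where "E J = (\<Prod>j\<in>J. \<epsilon> j)" for J
  define P where "P J s = (\<Sum>n. mangoldt n * X J n * real n powr - s)" for J s
  define F where "F n = (\<Sum>J\<in>Pow I. E J * X J n)" for n
  have X: "real_character N (X J)" if "J \<subseteq> I" for J
  proof -
    have "finite J" using I that finite_subset by blast
    then show ?thesis using that
    proof (induction J)
      case empty
      then show ?case using real_character_principal[OF N] by (simp add: X_def[abs_def])
    next
      case (insert j J)
      then have j: "real_character N (\<psi> j)" and J: "real_character N (X J)" using chi by auto
      have eq: "X (insert j J) n = \<psi> j n * X J n" for n using insert by (simp add: X_def)
      show ?case unfolding real_character_def eq
      proof (intro conjI allI)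
        fix n show "\<psi> j n * X J n = (if coprime n N then 1 else 0) \<or> \<psi> j n * X J n = (if coprime n N then - 1 else 0)"
          using chi_coprime[OF j, of n] chi_coprime[OF J, of n] chi_noncoprime[OF j, of n] by auto
      qed (simp_all add: N chi_mult[OF j] chi_mult[OF J] chi_mod[OF j] chi_mod[OF J])
    qed
  qed
  have absE: "\<bar>E J\<bar> = 1" if "J \<subseteq> I" for J
  proof -
    have "\<bar>E J\<bar> = (\<Prod>j\<in>J. \<bar>\<epsilon> j\<bar>)" by (simp add: E_def abs_prod)
    also have "\<dots> = 1" using eps that by (intro prod.neutral) fastforce
    finally show ?thesis .
  qed
  have F: "F n = (if coprime n N then 1 else 0) * (\<Prod>i\<in>I. \<epsilon> i * \<psi> i n + 1)" for n
    unfolding F_def E_def X_def using I by (subst prod_add) (simp_all add: prod.distrib sum_distrib_left mult_ac)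
  have Fle: "\<bar>F n\<bar> \<le> 2 ^ card I" for n
  proof -
    have "\<bar>F n\<bar> \<le> (\<Sum>J\<in>Pow I. \<bar>E J * X J n\<bar>)" unfolding F_def by (rule sum_abs)
    also have "\<dots> \<le> (\<Sum>J\<in>Pow I. 1)" 
      by (intro sum_mono) (use absE chi_abs_le[OF X] in \<open>auto simp: abs_mult\<close>)
    also have "\<dots> = 2 ^ card I" using I by (simp add: card_Pow)
    finally show ?thesis .
  qed
  have F0: "F n = 0" if n: "mangoldt n \<noteq> (0::real)" "\<not> (\<exists>m. n = m ^ 2)" for n
  proof (cases "coprime n N")
    case True
    obtain p k where pk: "prime p" "odd k" "n = p ^ k" by (rule prime_or_square_mangoldt[OF n])
    then have cop: "coprime p N" using True by (metis coprime_power_left_iff even_zero)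
    obtain i where i: "i \<in> I" "\<psi> i p \<noteq> \<epsilon> i" using no[OF pk(1) cop] by blast
    have "\<psi> i n = \<psi> i p"
      using chi_coprime[OF chi[OF i(1)] cop] pk(2) unfolding pk(3) chi_power[OF chi[OF i(1)]] by auto
    then have "\<epsilon> i * \<psi> i n + 1 = 0" using i eps[OF i(1)] chi_coprime[OF chi[OF i(1)] cop] by auto
    then show ?thesis using i(1) I unfolding F by (auto intro!: prod_zero)
  qed (simp add: F)
  define C0 where "C0 = 2 ^ card I * (\<Sum>n. if \<exists>m. n = m ^ 2 then ln (real n) * real n powr - 1 else 0)"
  have upper: "(\<Sum>J\<in>Pow I. E J * P J s) \<le> C0" if s: "s > 1" for s
  proof -
    have "(\<lambda>n. \<Sum>J\<in>Pow I. E J * (mangoldt n * X J n * real n powr - s)) sums (\<Sum>J\<in>Pow I. E J * P J s)"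
      unfolding P_def using summable_character_series(3)[OF X s, THEN summable_rabs_cancel]
      by (intro sums_sum sums_mult summable_sums) auto
    also have "(\<lambda>n. \<Sum>J\<in>Pow I. E J * (mangoldt n * X J n * real n powr - s)) = (\<lambda>n. mangoldt n * F n * real n powr - s)"
      by (simp add: F_def sum_distrib_left sum_distrib_right mult_ac)
    finally have sums: "(\<lambda>n. mangoldt n * F n * real n powr - s) sums (\<Sum>J\<in>Pow I. E J * P J s)" .
    have "mangoldt n * F n * real n powr - s \<le> 2 ^ card I * (if \<exists>m. n = m ^ 2 then ln (real n) * real n powr - 1 else 0)" for n
    proof (cases "mangoldt n = (0::real) \<or> \<not> (\<exists>m. n = m ^ 2)")
      case True
      moreover have "ln (real n) \<ge> 0" by (cases n) auto
      ultimately show ?thesis using F0[of n] by (cases "mangoldt n = (0::real)") auto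
    next
      case False
      then have n: "n > 1" by (metis mangoldt_0 mangoldt_Suc_0 One_nat_def less_one linorder_neqE_nat)
      have "mangoldt n * F n \<le> mangoldt n * 2 ^ card I"
        using Fle[of n] by (intro mult_left_mono mangoldt_nonneg) auto
      also have "\<dots> \<le> ln n * 2 ^ card I" using n by (intro mult_right_mono mangoldt_le) auto
      finally have le: "mangoldt n * F n \<le> ln n * 2 ^ card I" .
      have "real n powr - s \<le> real n powr - 1" using n s by (intro powr_mono) auto
      then have "mangoldt n * F n * real n powr - s \<le> ln n * 2 ^ card I * real n powr - 1"
        by (rule mult_mono[OF le]) (use n in auto)
      then show ?thesis using False by (simp add: mult_ac)
    qed
    then have "(\<Sum>n. mangoldt n * F n * real n powr - s) \<le> C0"
      unfolding C0_def suminf_mult[OF summable_ln_over_squares, symmetric]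
      by (intro suminf_le summable_mult summable_ln_over_squares) (use sums in \<open>auto simp: sums_iff\<close>)
    then show ?thesis using sums by (simp add: sums_iff)
  qed
  have "\<exists>C. \<forall>J\<in>Pow I - {{}}. \<forall>\<^sub>F s in at_right 1. \<bar>P J s\<bar> \<le> C J"
  proof (intro bchoice ballI)
    fix J assume J: "J \<in> Pow I - {{}}"
    then obtain a where a: "coprime a N" "(\<Prod>j\<in>J. \<psi> j a) = - 1" using indep by blast
    then have "X J a = - 1" by (simp add: X_def)
    then show "\<exists>C. \<forall>\<^sub>F s in at_right 1. \<bar>P J s\<bar> \<le> C"
      using mangoldt_series_bounded[OF X, of J a] J unfolding P_def by auto
  qed
  then obtain C where C: "\<And>J. J \<in> Pow I - {{}} \<Longrightarrow> \<forall>\<^sub>F s in at_right 1. \<bar>P J s\<bar> \<le> C J" by blast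
  have "\<forall>\<^sub>F s in at_right 1. \<forall>J\<in>Pow I - {{}}. \<bar>P J s\<bar> \<le> C J"
    using I C by (intro eventually_ball_finite) auto
  moreover have "\<forall>\<^sub>F s in at_right 1. P {} s \<ge> C0 + (\<Sum>J\<in>Pow I - {{}}. C J) + 1"
    using principal_mangoldt_unbounded[OF N] unfolding P_def X_def by simp
  moreover have "\<forall>\<^sub>F s in at_right 1. s > (1::real)" by (simp add: eventually_at_right_less)
  ultimately have "\<forall>\<^sub>F s in at_right (1::real). False"
  proof eventually_elim
    case (elim s)
    have "(\<Sum>J\<in>Pow I. E J * P J s) = P {} s + (\<Sum>J\<in>Pow I - {{}}. E J * P J s)"
      using I by (subst sum.remove[of _ "{}"]) (auto simp: E_def)
    moreover have "\<bar>\<Sum>J\<in>Pow I - {{}}. E J * P J s\<bar> \<le> (\<Sum>J\<in>Pow I - {{}}. C J)"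
      by (rule order_trans[OF sum_abs], rule sum_mono) (use elim(1) absE in \<open>auto simp: abs_mult\<close>)
    ultimately show ?case using upper[OF elim(3)] elim(2) by linarith
  qed
  then show False by simp
qed

section \<open>Quadratic residue symbols\<close>

text \<open>The symbols \<open>(-1/n)\<close> and \<open>(2/n)\<close> for odd \<open>n\<close>, as Dirichlet characters modulo 8.\<close>

definition chi4 :: "nat \<Rightarrow> int" where
  "chi4 n = (if even n then 0 else if n mod 4 = 1 then 1 else - 1)"

definition chi8 :: "nat \<Rightarrow> int" where
  "chi8 n = (if even n then 0 else if n mod 8 \<in> {1, 7} then 1 else - 1)"

lemma chi48_mod: "chi4 (n mod 8) = chi4 n" "chi8 (n mod 8) = chi8 n"
proof -
  have "n mod 8 mod 4 = n mod 4" by (rule mod_mod_cancel) simp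
  moreover have "even (n mod 8) \<longleftrightarrow> even n" by presburger
  ultimately show "chi4 (n mod 8) = chi4 n" "chi8 (n mod 8) = chi8 n" by (simp_all add: chi4_def chi8_def)
qed

lemma chi48_mult: "chi4 (m * n) = chi4 m * chi4 n" "chi8 (m * n) = chi8 m * chi8 n"
proof -
  have *: "\<forall>a\<in>{1, 3, 5, 7}. \<forall>b\<in>{1, 3, 5, 7}. chi4 (a * b mod 8) = chi4 a * chi4 b \<and> chi8 (a * b mod 8) = chi8 a * chi8 b"
    by (simp add: chi4_def chi8_def)
  have range: "k mod 8 \<in> {1, 3, 5, 7}" if "odd k" for k :: nat
    using that by simp presburger
  have "chi4 (m * n) = chi4 m * chi4 n \<and> chi8 (m * n) = chi8 m * chi8 n"
  proof (cases "odd m \<and> odd n")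
    case True
    then have "chi4 (m mod 8 * (n mod 8) mod 8) = chi4 (m mod 8) * chi4 (n mod 8) \<and>
         chi8 (m mod 8 * (n mod 8) mod 8) = chi8 (m mod 8) * chi8 (n mod 8)"
      by (intro *[rule_format] range) auto
    then show ?thesis by (simp only: chi48_mod mod_mult_eq)
  qed (auto simp: chi4_def chi8_def)
  then show "chi4 (m * n) = chi4 m * chi4 n" "chi8 (m * n) = chi8 m * chi8 n" by blast+
qed

lemma Legendre_cases: "Legendre a p = 0 \<or> Legendre a p = 1 \<or> Legendre a p = - 1"
  by (simp add: Legendre_def)

lemma Legendre_cong: "[a = b] (mod p) \<Longrightarrow> Legendre a p = Legendre b p"
  by (simp add: Legendre_def QuadRes_def cong_def)

lemma Legendre_eqI:
  assumes "p > 2" "[Legendre a p = c] (mod p)" "c = 0 \<or> c = 1 \<or> c = - 1"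
  shows "Legendre a p = c"
proof -
  have "p dvd Legendre a p - c" using assms(2) by (simp add: cong_iff_dvd_diff)
  moreover have "\<bar>Legendre a p - c\<bar> \<le> 2" using Legendre_cases[of a p] assms(3) by auto
  ultimately show ?thesis using assms(1) by (metis abs_of_pos dvd_imp_le_int eq_iff_diff_eq_0 linorder_not_less order_less_le_trans zero_less_numeral order_less_trans)
qed

lemma Legendre_mult:
  assumes p: "prime p" "p > (2::nat)"
  shows "Legendre (a * b) p = Legendre a p * Legendre b p"
proof (rule Legendre_eqI)
  have "[Legendre (a * b) p = (a * b) ^ ((p - 1) div 2)] (mod p)" by (rule euler_criterion[OF p])
  moreover have "[Legendre a p * Legendre b p = a ^ ((p - 1) div 2) * b ^ ((p - 1) div 2)] (mod p)"
    by (intro cong_mult euler_criterion p)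
  ultimately show "[Legendre (a * b) p = Legendre a p * Legendre b p] (mod p)"
    by (metis cong_sym cong_trans power_mult_distrib)
qed (use p Legendre_cases[of a p] Legendre_cases[of b p] in auto)

lemma Legendre_nonzero: "prime p \<Longrightarrow> coprime a (int p) \<Longrightarrow> Legendre a p = 1 \<or> Legendre a p = - 1"
  unfolding Legendre_def cong_0_iff by (auto dest: coprime_common_divisor[of a "int p" "int p"])

lemma Legendre_1: "prime p \<Longrightarrow> Legendre 1 (int p) = 1"
  unfolding Legendre_def QuadRes_def cong_0_iff by (auto intro!: exI[of _ 1])

lemma Legendre_minus_1:
  assumes p: "prime p" "p > (2::nat)"
  shows "Legendre (- 1) p = chi4 p"
proof (rule Legendre_eqI)
  have odd: "odd p" using p prime_odd_nat by blast
  have "even ((p - 1) div 2) \<longleftrightarrow> p mod 4 = 1" using odd by presburger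
  then have "(- 1 :: int) ^ ((p - 1) div 2) = chi4 p" using odd by (auto simp: chi4_def uminus_power_if)
  then show "[Legendre (- 1) p = chi4 p] (mod int p)" using euler_criterion[OF p, of "- 1"] by simp
qed (use p in \<open>auto simp: chi4_def\<close>)

text \<open>By the lemma of Gauss: the multiples \<open>2 x\<close> with \<open>1 \<le> x \<le> h = (p - 1) / 2\<close> that exceed \<open>h\<close> are those with \<open>x > h div 2\<close>.\<close>

lemma Legendre_2:
  assumes p: "prime p" "p > (2::nat)"
  shows "Legendre 2 p = chi8 p"
proof -
  have odd: "odd p" using p prime_odd_nat by blast
  interpret GAUSS p 2
  proof unfold_locales
    show "[2 \<noteq> 0] (mod int p)" using p zdvd_imp_le[of "int p" 2] by (auto simp: cong_0_iff)
  qed (use p in auto)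
  define h where "h = (int p - 1) div 2"
  have "C = (\<lambda>x. 2 * x) ` {0<..h}"
    unfolding C_def B_def A_def h_def[symmetric] image_image
  proof (intro image_cong refl)
    fix x assume "x \<in> {0<..h}"
    then have "0 \<le> x * 2" "x * 2 < int p" using odd by (auto simp: h_def)
    then show "x * 2 mod int p = 2 * x" by simp
  qed
  then have "E = (\<lambda>x. 2 * x) ` {h div 2<..h}"
    unfolding E_def h_def[symmetric] using p by (auto simp: h_def)
  then have "card E = nat (h - h div 2)" by (simp add: card_image inj_on_def)
  moreover have "even (nat (h - h div 2)) \<longleftrightarrow> p mod 8 \<in> {1, 7}"
  proof -
    define k where "k = p div 8"
    have "p mod 8 = 1 \<or> p mod 8 = 3 \<or> p mod 8 = 5 \<or> p mod 8 = 7" using odd by presburger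
    moreover have "p = 8 * k + p mod 8" by (simp add: k_def)
    then have "2 * h = 8 * int k + int (p mod 8) - 1" using odd unfolding h_def by presburger
    ultimately consider "p mod 8 = 1" "h = 4 * k" | "p mod 8 = 3" "h = 4 * k + 1"
      | "p mod 8 = 5" "h = 4 * k + 2" | "p mod 8 = 7" "h = 4 * k + 3"
      by (elim disjE) auto
    then show ?thesis
    proof cases
      case 1
      then have "h - h div 2 = int (2 * k)" by linarith
      then show ?thesis using 1 by (simp only: nat_int) simp
    next
      case 2
      then have "h - h div 2 = int (2 * k + 1)" by linarith
      then show ?thesis using 2 by (simp only: nat_int) simp
    next
      case 3
      then have "h - h div 2 = int (2 * k + 1)" by linarith
      then show ?thesis using 3 by (simp only: nat_int) simp
    next
      case 4
      then have "h - h div 2 = int (2 * k + 2)" by linarith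
      then show ?thesis using 4 by (simp only: nat_int) simp
    qed
  qed
  ultimately show ?thesis using gauss_lemma odd by (auto simp: chi8_def uminus_power_if)
qed

lemma Legendre_prod:
  assumes p: "prime p" "p > (2::nat)" and "finite A"
  shows "Legendre (\<Prod>i\<in>A. f i) p = (\<Prod>i\<in>A. Legendre (f i) p)"
  using assms(3) by induction (simp_all add: Legendre_1 p Legendre_mult)

lemma prod_multiplicative:
  fixes c :: "nat \<Rightarrow> int"
  assumes "finite P" "c 1 = 1" "\<And>m n. c (m * n) = c m * c n"
  shows "(\<Prod>p\<in>P. c p) = c (\<Prod>P)"
  using assms(1)
proof induction
  case (insert p P)
  then show ?case using assms(3)[of p "\<Prod>P"] by simp
qed (use assms(2) in simp)

lemma QuadRes_mult_coprime:
  assumes "coprime m n" "QuadRes m a" "QuadRes n a"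
  shows "QuadRes (m * n) a"
proof -
  obtain x y where xy: "[x ^ 2 = a] (mod m)" "[y ^ 2 = a] (mod n)" using assms by (auto simp: QuadRes_def)
  obtain z where "[z = x] (mod m)" "[z = y] (mod n)" using binary_chinese_remainder_int[OF assms(1)] by blast
  then have "[z ^ 2 = a] (mod m)" "[z ^ 2 = a] (mod n)" using xy by (meson cong_pow cong_trans)+
  then have "[z ^ 2 = a] (mod m * n)" using assms(1) by (rule coprime_cong_mult)
  then show ?thesis by (auto simp: QuadRes_def)
qed

lemma QuadRes_prod_primes:
  assumes "finite P" "\<And>p. p \<in> P \<Longrightarrow> prime p" "\<And>p. p \<in> P \<Longrightarrow> QuadRes (int p) a"
  shows "QuadRes (int (\<Prod>P)) a"
  using assms
proof (induction P)
  case empty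
  then show ?case by (auto simp: QuadRes_def)
next
  case (insert p P)
  have "coprime p (\<Prod>P)"
  proof (rule prod_coprime_right)
    fix q assume "q \<in> P"
    then show "coprime p q" using insert.hyps insert.prems(1)[of p] insert.prems(1)[of q]
      by (intro primes_coprime) auto
  qed
  then have "coprime (int p) (int (\<Prod>P))" by (simp only: coprime_int_iff)
  then have "QuadRes (int p * int (\<Prod>P)) a"
  proof (rule QuadRes_mult_coprime)
    show "QuadRes (int p) a" by (rule insert.prems) simp
    show "QuadRes (int (\<Prod>P)) a" by (rule insert.IH) (rule insert.prems; simp)+
  qed
  then show ?case using insert.hyps by simp
qed

lemma QuadRes_2: "QuadRes 2 a"
  unfolding QuadRes_def by (rule exI[of _ a]) (auto simp: cong_iff_dvd_diff)

lemma QuadRes_of_Legendre: "Legendre a p = 1 \<Longrightarrow> QuadRes p a"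
  by (auto simp: Legendre_def split: if_splits)

lemma exists_nonresidue:
  assumes p: "prime p" "p > (2::nat)"
  shows "\<exists>g::nat. Legendre g p = - 1"
proof (rule ccontr)
  assume "\<not> ?thesis"
  then have none: "Legendre (int g) p \<noteq> - 1" for g :: nat by blast
  define f where "f x = nat (int x ^ 2 mod int p)" for x :: nat
  have "{..<p} \<subseteq> f ` {..<p}"
  proof
    fix g assume g: "g \<in> {..<p}"
    have "QuadRes p g"
    proof (cases "[int g = 0] (mod p)")
      case True
      then have "[0 ^ 2 = int g] (mod p)" by (simp add: cong_sym)
      then show ?thesis unfolding QuadRes_def by blast
    next
      case False
      then show ?thesis using none[of g] by (auto simp: Legendre_def split: if_splits)
    qed
    then obtain y where "[y ^ 2 = int g] (mod p)" by (auto simp: QuadRes_def)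
    then have "[int (nat (y mod p)) ^ 2 = int g] (mod p)"
      using p by (simp add: cong_def power_mod)
    then have "f (nat (y mod p)) = g" using g by (simp add: f_def cong_def)
    moreover have "nat (y mod p) \<in> {..<p}" using p by (simp add: nat_less_iff)
    ultimately show "g \<in> f ` {..<p}" by blast
  qed
  moreover have "f ` {..<p} \<subseteq> {..<p}" using p by (auto simp: f_def nat_less_iff)
  ultimately have "f ` {..<p} = {..<p}" by blast
  then have inj: "inj_on f {..<p}" by (intro eq_card_imp_inj_on) auto
  have "int (p - 1) = int p - 1" using p by simp
  then have "int (p - 1) ^ 2 = 1 + int p * (int p - 2)" by (simp add: power2_eq_square algebra_simps)
  then have "f (p - 1) = f 1" using p by (simp add: f_def)
  then show False using inj_onD[OF inj, of "p - 1" 1] p by simp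
qed

section \<open>Legendre equation and the Davenport-Cassels descent\<close>

text \<open>The characters are \<open>(-1/n)\<close>, \<open>(2/n)\<close> and \<open>(n/p)\<close> for \<open>p\<close> in \<open>P\<close>, indexed by 1, 2 and the elements of \<open>P\<close>. They are
  independent by Chinese remaindering: if a set of them involves some \<open>p\<close>, take a nonresidue modulo \<open>p\<close> that
  is 1 modulo 8 and modulo the other primes; otherwise take a suitable class modulo 8.\<close>

lemma exists_prime_with_symbols:
  fixes P :: "nat set" and e :: "nat \<Rightarrow> int"
  assumes P: "finite P" "\<And>p. p \<in> P \<Longrightarrow> prime p" "\<And>p. p \<in> P \<Longrightarrow> p > 2"
    and e: "\<And>p. p \<in> P \<Longrightarrow> e p = 1 \<or> e p = - 1" and e2: "e2 = 1 \<or> e2 = (- 1 :: int)"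
  obtains q where "prime q" "q > 2" "q \<notin> P" "chi4 q = 1" "chi8 q = e2" "\<And>p. p \<in> P \<Longrightarrow> Legendre q p = e p"
proof -
  define N where "N = 8 * \<Prod>P"
  define sym where "sym i n = (if i = 1 then chi4 n else if i = 2 then chi8 n else Legendre n i)" for i n :: nat
  define \<psi> where "\<psi> i n = (if coprime n N then real_of_int (sym i n) else 0)" for i n
  define I where "I = insert 1 (insert 2 P)"
  have Ppos: "\<Prod>P > 0" using P by (intro prod_pos) (auto dest: prime_gt_0_nat)
  then have N: "N > 0" by (simp add: N_def)
  have odd: "odd n" if "coprime n N" for n
  proof
    assume "even n"
    then have "2 dvd gcd n N" by (simp add: N_def)
    then show False using that by simp
  qed
  have pN: "p dvd N" if "p \<in> P" for p using that P(1) by (auto simp: N_def intro: dvd_prodI dvd_mult)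
  have copP: "coprime n p" if "coprime n N" "p \<in> P" for n p
    using pN[OF that(2)] that(1) by (meson coprime_imp_coprime dvd_trans)
  have symmult: "sym i (m * n) = sym i m * sym i n" if "i \<in> I" for i m n
    using that P by (auto simp: sym_def chi48_mult I_def Legendre_mult)
  have symmod: "sym i (n mod N) = sym i n" if "i \<in> I" for i n
  proof -
    have "n mod N mod 8 = n mod 8" by (rule mod_mod_cancel) (simp add: N_def)
    then have "chi4 (n mod N) = chi4 n" "chi8 (n mod N) = chi8 n" by (metis chi48_mod)+
    moreover have "Legendre (int (n mod N)) (int i) = Legendre (int n) (int i)" if "i \<in> P"
      using pN[OF that] by (intro Legendre_cong, simp only: cong_int_iff) (simp add: cong_def mod_mod_cancel)
    ultimately show ?thesis using that P(3) by (auto simp: sym_def I_def)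
  qed
  have symval: "sym i n = 1 \<or> sym i n = - 1" if "i \<in> I" "coprime n N" for i n
  proof -
    have "Legendre n i = 1 \<or> Legendre n i = - 1" if "i \<in> P"
      using copP[OF \<open>coprime n N\<close> that] P(2)[OF that] by (intro Legendre_nonzero) (simp_all only: coprime_int_iff)
    moreover have "chi4 n = 1 \<or> chi4 n = - 1" "chi8 n = 1 \<or> chi8 n = - 1"
      using odd[OF that(2)] by (simp_all add: chi4_def chi8_def)
    ultimately show ?thesis using that(1) by (auto simp: sym_def I_def)
  qed
  have chi: "real_character N (\<psi> i)" if i: "i \<in> I" for i
    unfolding real_character_def
  proof (intro conjI allI N)
    show "\<psi> i (m * n) = \<psi> i m * \<psi> i n" for m n by (simp add: \<psi>_def symmult[OF i])
    show "\<psi> i (n mod N) = \<psi> i n" for n using N by (simp add: \<psi>_def symmod[OF i] coprime_mod_left_iff)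
    show "\<psi> i n = (if coprime n N then 1 else 0) \<or> \<psi> i n = (if coprime n N then - 1 else 0)" for n
      using symval[OF i, of n] by (auto simp: \<psi>_def)
  qed
  have indep: "\<exists>a. coprime a N \<and> (\<Prod>j\<in>J. \<psi> j a) = - 1" if J: "J \<subseteq> I" "J \<noteq> {}" for J
  proof (cases "\<exists>p. p \<in> J \<and> p \<in> P")
    case True
    then obtain p where p: "p \<in> J" "p \<in> P" by blast
    define M where "M = 8 * \<Prod>(P - {p})"
    have NM: "N = p * M" unfolding N_def M_def using P(1) p by (simp add: prod.remove)
    obtain g :: nat where g: "Legendre g p = - 1" using exists_nonresidue P p by blast
    have "coprime p (\<Prod>(P - {p}))" 
      using P p by (intro prod_coprime_right primes_coprime) auto
    moreover have "coprime p (2 ^ 3)"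
      using P p by (metis coprime_power_right_iff primes_coprime two_is_prime_nat less_irrefl_nat)
    ultimately have cop: "coprime p M" by (simp add: M_def)
    obtain a where a: "[a = g] (mod p)" "[a = 1] (mod M)" using binary_chinese_remainder_nat[OF cop] by blast
    have ap: "Legendre a p = - 1" using g Legendre_cong[of a g p] a(1) by (simp add: cong_int_iff)
    have "\<not> p dvd a"
    proof
      assume "p dvd a"
      then have "[int a = 0] (mod int p)" by (simp add: cong_0_iff)
      then show False using ap by (simp add: Legendre_def)
    qed
    then have "coprime a p" using P p prime_imp_coprime coprime_commute by metis
    moreover have "coprime a M" using a(2) cong_imp_coprime[of 1 a M] by (simp add: cong_sym)
    ultimately have aN: "coprime a N" by (simp add: NM)
    have one: "\<psi> j a = 1" if j: "j \<in> J - {p}" for j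
    proof -
      have "a mod 8 = 1"
      proof -
        have "[a = 1] (mod 8)" using a(2) by (rule cong_dvd_modulus_nat) (simp add: M_def)
        then show ?thesis by (simp add: cong_def)
      qed
      moreover have "Legendre a j = 1" if "j \<in> P"
      proof -
        have "j dvd M" using that j P(1) unfolding M_def by (intro dvd_mult dvd_prodI) auto
        then have "[a = 1] (mod j)" using a(2) cong_dvd_modulus_nat by blast
        then have "Legendre (int a) (int j) = Legendre (int 1) (int j)" by (intro Legendre_cong) (simp only: cong_int_iff)
        then show ?thesis using P that by (simp add: Legendre_1)
      qed
      ultimately have "sym j a = 1" using j J P(3) chi48_mod[of a]
        by (auto simp: sym_def I_def) (simp_all add: chi4_def chi8_def)
      then show ?thesis using aN by (simp add: \<psi>_def)
    qed
    have "finite J" using J(1) P(1) by (auto simp: I_def intro: finite_subset)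
    then have "(\<Prod>j\<in>J. \<psi> j a) = \<psi> p a * (\<Prod>j\<in>J - {p}. \<psi> j a)" using p by (simp add: prod.remove)
    also have "(\<Prod>j\<in>J - {p}. \<psi> j a) = 1" using one by (intro prod.neutral) auto
    also have "\<psi> p a = - 1" using aN ap P(3)[OF p(2)] by (simp add: \<psi>_def sym_def)
    finally show ?thesis using aN by auto
  next
    case False
    then have J12: "J \<subseteq> {1, 2}" using J by (auto simp: I_def)
    then have J123: "J = {1} \<or> J = {2} \<or> J = {1, 2}" using J(2) by blast
    \<comment> \<open>3 has both symbols \<open>-1\<close>, and 5 has the symbols 1 and \<open>-1\<close>\<close>
    define c :: nat where "c = (if J = {1, 2} then 5 else 3)"
    have "coprime (2 ^ 3) (\<Prod>P)"
      unfolding coprime_power_left_iff using P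
      by (intro disjI1 prod_coprime_right primes_coprime) auto
    then have cop: "coprime 8 (\<Prod>P)" by simp
    obtain a where a: "[a = c] (mod 8)" "[a = 1] (mod (\<Prod>P))" using binary_chinese_remainder_nat[OF cop] by blast
    have a8: "a mod 8 = c" using a(1) by (auto simp: cong_def c_def)
    have "odd a" using a8 by (auto simp: c_def split: if_splits) presburger+
    then have "coprime a (2 ^ 3)" unfolding coprime_power_right_iff by simp
    moreover have "coprime a (\<Prod>P)" using a(2) cong_imp_coprime[of 1 a "\<Prod>P"] by (simp add: cong_sym)
    ultimately have aN: "coprime a N" by (simp add: N_def)
    have "\<psi> 1 a = chi4 c" "\<psi> 2 a = chi8 c" using aN a8 chi48_mod[of a] by (simp_all add: \<psi>_def sym_def)
    then have "(\<Prod>j\<in>J. \<psi> j a) = - 1" using J123 by (elim disjE) (simp_all add: c_def chi4_def chi8_def)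
    then show ?thesis using aN by blast
  qed
  define \<epsilon> where "\<epsilon> i = real_of_int (if i = 1 then 1 else if i = 2 then e2 else e i)" for i :: nat
  have eps: "\<epsilon> i = 1 \<or> \<epsilon> i = - 1" if "i \<in> I" for i
    using that e[of i] e2 by (auto simp: \<epsilon>_def I_def)
  have "finite I" using P(1) by (simp add: I_def)
  then obtain q where q: "prime q" "coprime q N" "\<And>i. i \<in> I \<Longrightarrow> \<psi> i q = \<epsilon> i"
    by (rule prime_with_character_values[OF _ N, of I \<psi> \<epsilon>]) (use chi eps indep in auto)
  have s: "real_of_int (sym i q) = \<epsilon> i" if "i \<in> I" for i using q(2) q(3)[OF that] by (simp add: \<psi>_def)
  show ?thesis
  proof (rule that[OF q(1)])
    show "q > 2" using odd[OF q(2)] q(1) prime_ge_2_nat[of q] by (cases "q = 2") auto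
    show "q \<notin> P" using copP[OF q(2), of q] q(1) by (auto dest: prime_gt_1_nat)
    show "chi4 q = 1" "chi8 q = e2" using s[of 1] s[of 2] by (auto simp: sym_def \<epsilon>_def I_def)
    show "Legendre q p = e p" if "p \<in> P" for p
      using s[of p] that P(3)[OF that] by (auto simp: sym_def \<epsilon>_def I_def)
  qed
qed

text \<open>The square roots of \<open>-t\<close> modulo \<open>n\<close> and of \<open>n\<close> modulo \<open>t\<close> define a linear congruence modulo \<open>n t\<close> between
  \<open>x\<close>, \<open>y\<close>, \<open>z\<close> under which \<open>w = x\<^sup>2 + t y\<^sup>2 - n z\<^sup>2\<close> is divisible by \<open>n t\<close>. The pigeonhole principle yields a nonzero
  solution so small that \<open>w\<close> is 0 or \<open>n t\<close>, and the second case reduces to the first by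
  composition of the forms \<open>x\<^sup>2 + t y\<^sup>2\<close> and \<open>z\<^sup>2 + t\<close>.\<close>

lemma legendre_equation:
  fixes n t :: nat
  assumes n: "n > 0" and t: "t > 0" and cop: "coprime n t"
    and r: "QuadRes n (- t)" and s: "QuadRes t n"
    and tsq: "\<And>k. k ^ 2 \<noteq> t" and ntsq: "\<And>k. k ^ 2 \<noteq> n * t"
  obtains x y z :: int where "z \<noteq> 0" "x ^ 2 + t * y ^ 2 = n * z ^ 2"
proof -
  obtain r s :: int where rs: "[r ^ 2 = - int t] (mod n)" "[s ^ 2 = n] (mod t)"
    using r s by (auto simp: QuadRes_def)
  have copi: "coprime (int n) (int t)" using cop by simp
  obtain U :: int where U: "[U = r] (mod int n)" "[U = 0] (mod int t)" using binary_chinese_remainder_int[OF copi] by blast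
  obtain V :: int where V: "[V = 0] (mod int n)" "[V = s] (mod int t)" using binary_chinese_remainder_int[OF copi] by blast
  define A where "A = {0..floor_sqrt (n * t)} \<times> {0..floor_sqrt n} \<times> {0..floor_sqrt t}"
  \<comment> \<open>the box has more than \<open>n * t\<close> points, hence two of them have the same residue\<close>
  define f where "f = (\<lambda>(x::nat, y::nat, z::nat). (int x - U * int y - V * int z) mod int (n * t))"
  have nt: "n * t > 0" using n t by simp
  have "card (f ` A) \<le> card {0..<int (n * t)}"
    using nt by (intro card_mono) (auto simp: f_def)
  also have "\<dots> = n * t" by (simp del: of_nat_mult)
  also have "\<dots> < card A"
  proof -
    have cA: "card A = Suc (floor_sqrt (n * t)) * (Suc (floor_sqrt n) * Suc (floor_sqrt t))"
      unfolding A_def card_cartesian_product by simp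
    have "(n * t) ^ 2 = (n * t) * (n * t)" by (simp add: power2_eq_square)
    also have "\<dots> < (Suc (floor_sqrt (n * t))) ^ 2 * ((Suc (floor_sqrt n)) ^ 2 * (Suc (floor_sqrt t)) ^ 2)"
      by (intro mult_strict_mono Suc_floor_sqrt_power2_gt) (use nt in auto)
    also have "\<dots> = (card A) ^ 2" unfolding cA power_mult_distrib ..
    finally show ?thesis by (rule power_less_imp_less_base) simp
  qed
  finally have "\<not> inj_on f A" by (rule pigeonhole)
  then obtain u v where uv: "u \<in> A" "v \<in> A" "f u = f v" "u \<noteq> v" unfolding inj_on_def by blast
  obtain x1 y1 z1 x2 y2 z2 where uv': "u = (x1, y1, z1)" "v = (x2, y2, z2)" by (metis surj_pair)
  define x y z where "x = int x1 - int x2" and "y = int y1 - int y2" and "z = int z1 - int z2"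
  have ne: "\<not> (x = 0 \<and> y = 0 \<and> z = 0)" using uv(4) by (auto simp: uv' x_def y_def z_def)
  have sq: "(int i - int j) ^ 2 \<le> int k" if "i \<le> floor_sqrt k" "j \<le> floor_sqrt k" for i j k
  proof -
    have "\<bar>int i - int j\<bar> \<le> \<bar>int (floor_sqrt k)\<bar>" using that by linarith
    then have "(int i - int j) ^ 2 \<le> int (floor_sqrt k) ^ 2" by (simp only: abs_le_square_iff)
    also have "\<dots> \<le> int k" using floor_sqrt_power2_le[of k] by (simp flip: of_nat_power)
    finally show ?thesis .
  qed
  have bx: "x ^ 2 \<le> int (n * t)" and "by": "y ^ 2 \<le> int n" and bz: "z ^ 2 \<le> int t"
    using uv(1,2) sq[of x1 "n * t" x2] sq[of y1 n y2] sq[of z1 t z2]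
    unfolding uv' A_def x_def y_def z_def by simp_all
  have sqrt_int: "\<exists>k. k ^ 2 = m" if "w ^ 2 = int m" for w :: int and m
  proof -
    have "int (nat \<bar>w\<bar> ^ 2) = int m" using that by simp
    then show ?thesis by (metis of_nat_eq_iff)
  qed
  have bx': "x ^ 2 < int (n * t)" using bx sqrt_int[of x "n * t"] ntsq order_le_less by blast
  have bz': "z ^ 2 < int t" using bz sqrt_int[of z t] tsq order_le_less by blast
  have cong: "[x = U * y + V * z] (mod (int n * int t))"
  proof -
    have "[int x1 - U * int y1 - V * int z1 = int x2 - U * int y2 - V * int z2] (mod (int n * int t))"
      using uv(3) by (simp add: f_def uv' cong_def)
    then show ?thesis by (simp add: cong_iff_dvd_diff x_def y_def z_def algebra_simps)
  qed
  define w where "w = x ^ 2 + int t * y ^ 2 - int n * z ^ 2"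
  have "int n dvd w"
  proof -
    have "[x = U * y + V * z] (mod int n)" using cong by (rule cong_dvd_modulus) simp
    also have "[U * y + V * z = r * y + 0 * z] (mod int n)" by (intro cong_add cong_mult U V cong_refl)
    finally have "[x ^ 2 = (r * y) ^ 2] (mod int n)" by (simp add: cong_pow)
    also have "[(r * y) ^ 2 = - int t * y ^ 2] (mod int n)"
      unfolding power_mult_distrib by (intro cong_mult rs cong_refl)
    finally have "int n dvd x ^ 2 + int t * y ^ 2" by (simp add: cong_iff_dvd_diff)
    then show ?thesis by (simp add: w_def)
  qed
  moreover have "int t dvd w"
  proof -
    have "[x = U * y + V * z] (mod int t)" using cong by (rule cong_dvd_modulus) simp
    also have "[U * y + V * z = 0 * y + s * z] (mod int t)" by (intro cong_add cong_mult U V cong_refl)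
    finally have "[x ^ 2 = (s * z) ^ 2] (mod int t)" by (simp add: cong_pow)
    also have "[(s * z) ^ 2 = int n * z ^ 2] (mod int t)"
      unfolding power_mult_distrib by (intro cong_mult rs cong_refl)
    finally have "int t dvd x ^ 2 - int n * z ^ 2" by (simp add: cong_iff_dvd_diff)
    then have "int t dvd (x ^ 2 - int n * z ^ 2) + int t * y ^ 2" by (intro dvd_add) auto
    then show ?thesis by (simp add: w_def algebra_simps)
  qed
  ultimately have "int n * int t dvd w" using copi by (rule divides_mult)
  then obtain k where k: "w = int n * int t * k" by blast
  have ub: "int t * y ^ 2 \<le> int n * int t" using "by" t by (simp add: mult.commute mult_left_mono)
  have lb: "int n * z ^ 2 < int n * int t" using bz' n by (intro mult_strict_left_mono) auto
  have nonneg: "0 \<le> int n * z ^ 2" "0 \<le> int t * y ^ 2" "0 \<le> x ^ 2" by simp_all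
  have "w < int n * int t * 2" using bx' ub nonneg unfolding w_def of_nat_mult by linarith
  moreover have "w > int n * int t * (- 1)" using lb nonneg unfolding w_def by linarith
  moreover have "int n * int t > 0" using n t by simp
  ultimately have "k < 2" "k > - 1" unfolding k by (metis mult_less_cancel_left_pos)+
  \<comment> \<open>the bounds on \<open>x\<close> and \<open>z\<close> are strict since neither \<open>n * t\<close> nor \<open>t\<close> is a square\<close>
  then consider "k = 0" | "k = 1" by linarith
  then show ?thesis
  proof cases
    case 1
    then have eq: "x ^ 2 + t * y ^ 2 = n * z ^ 2" using k by (simp add: w_def)
    have "z \<noteq> 0"
    proof
      assume "z = 0"
      then have "x ^ 2 + int t * y ^ 2 = 0" using eq by simp
      then have "x ^ 2 = 0 \<and> int t * y ^ 2 = 0" by (subst (asm) add_nonneg_eq_0_iff) auto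
      then show False using ne \<open>z = 0\<close> t by simp
    qed
    then show ?thesis using that eq by blast
  next
    case 2
    then have eq: "x ^ 2 + t * y ^ 2 = n * (z ^ 2 + t)" using k by (simp add: w_def algebra_simps)
    \<comment> \<open>composition: multiply \<open>x + y * sqrt (- t)\<close> by \<open>z + sqrt (- t)\<close>\<close>
    have "(x * z - t * y) ^ 2 + t * (x + y * z) ^ 2 = (x ^ 2 + t * y ^ 2) * (z ^ 2 + t)"
      by (simp add: power2_eq_square algebra_simps)
    also have "\<dots> = n * (z ^ 2 + t) ^ 2" 
      unfolding eq power2_eq_square[of "z ^ 2 + int t"] by (rule mult.assoc)
    finally have "(x * z - t * y) ^ 2 + t * (x + y * z) ^ 2 = n * (z ^ 2 + t) ^ 2" .
    moreover have "z ^ 2 + int t \<noteq> 0" using t by (smt (verit) of_nat_0_less_iff zero_le_power2)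
    ultimately show ?thesis using that by blast
  qed
qed

text \<open>The two-variable version of the preceding pigeonhole argument.\<close>

lemma prime_1_mod_4_two_squares:
  assumes q: "prime q" "q > (2::nat)" "chi4 q = 1"
  obtains a b :: int where "int q = a ^ 2 + b ^ 2"
proof -
  have "Legendre (- 1) q = 1" using Legendre_minus_1[of q] q by simp
  then obtain r :: int where r: "[r ^ 2 = - 1] (mod q)" using QuadRes_of_Legendre by (auto simp: QuadRes_def)
  define A where "A = {0..floor_sqrt q} \<times> {0..floor_sqrt q}"
  define f where "f = (\<lambda>(x::nat, y::nat). (int x - r * int y) mod int q)"
  have "card (f ` A) \<le> card {0..<int q}"
    using q by (intro card_mono) (auto simp: f_def)
  also have "\<dots> = q" by simp
  also have "\<dots> < card A"
    using Suc_floor_sqrt_power2_gt[of q] by (simp add: A_def card_cartesian_product power2_eq_square)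
  finally have "\<not> inj_on f A" by (rule pigeonhole)
  then obtain u v where uv: "u \<in> A" "v \<in> A" "f u = f v" "u \<noteq> v" unfolding inj_on_def by blast
  obtain x1 y1 x2 y2 where uv': "u = (x1, y1)" "v = (x2, y2)" by (metis surj_pair)
  define x y where "x = int x1 - int x2" and "y = int y1 - int y2"
  have ne: "\<not> (x = 0 \<and> y = 0)" using uv(4) by (auto simp: uv' x_def y_def)
  have sqlt: "(int i - int j) ^ 2 < int q" if "i \<le> floor_sqrt q" "j \<le> floor_sqrt q" for i j
  proof -
    have "\<bar>int i - int j\<bar> \<le> \<bar>int (floor_sqrt q)\<bar>" using that by linarith
    then have "(int i - int j) ^ 2 \<le> int (floor_sqrt q) ^ 2" by (simp only: abs_le_square_iff)
    also have "\<dots> < int q"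
    proof -
      have "floor_sqrt q ^ 2 \<noteq> q"
      proof
        assume h: "floor_sqrt q ^ 2 = q"
        then have "floor_sqrt q dvd q" by (metis dvd_triv_left power2_eq_square)
        then have "floor_sqrt q = 1 \<or> floor_sqrt q = q" using q(1) by (simp add: prime_nat_iff)
        then show False using h q(2) by (auto simp: power2_eq_square)
      qed
      then show ?thesis using floor_sqrt_power2_le[of q] by (simp add: order_less_le flip: of_nat_power)
    qed
    finally show ?thesis .
  qed
  have bx: "x ^ 2 < int q" and "by": "y ^ 2 < int q"
    using uv(1,2) unfolding uv' A_def x_def y_def by (auto intro!: sqlt)
  have "[x = r * y] (mod q)"
  proof -
    have "[int x1 - r * int y1 = int x2 - r * int y2] (mod int q)"
      using uv(3) by (simp add: f_def uv' cong_def)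
    then show ?thesis by (simp add: cong_iff_dvd_diff x_def y_def algebra_simps)
  qed
  then have "[x ^ 2 = (r * y) ^ 2] (mod q)" by (rule cong_pow)
  also have "[(r * y) ^ 2 = - 1 * y ^ 2] (mod q)"
    unfolding power_mult_distrib by (intro cong_mult r cong_refl)
  finally have "int q dvd x ^ 2 + y ^ 2" by (simp add: cong_iff_dvd_diff)
  then obtain k where k: "x ^ 2 + y ^ 2 = int q * k" by blast
  have "x ^ 2 + y ^ 2 > 0" using ne by (simp add: sum_power2_gt_zero_iff)
  then have "int q * 0 < int q * k" "int q * k < int q * 2" using bx "by" unfolding k[symmetric] by auto
  moreover have "int q > 0" using q by simp
  ultimately have "0 < k" "k < 2" by (metis mult_less_cancel_left_pos)+
  then have "int q = x ^ 2 + y ^ 2" using k by simp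
  then show ?thesis by (rule that)
qed

lemma nearest_multiple:
  fixes x w :: int
  assumes "w > 0"
  obtains X where "2 * \<bar>x - w * X\<bar> \<le> w"
proof (rule that)
  define m X where "m = (2 * x + w) mod (2 * w)" and "X = (2 * x + w) div (2 * w)"
  have "2 * x + w = 2 * w * X + m" unfolding m_def X_def by (rule mult_div_mod_eq[symmetric])
  then have "2 * (x - w * X) = m - w" by (simp add: algebra_simps)
  moreover have "0 \<le> m" "m < 2 * w" using assms by (simp_all add: m_def)
  ultimately have "2 * \<bar>x - w * X\<bar> \<le> w" by linarith
  then show "2 * \<bar>x - w * ((2 * x + w) div (2 * w))\<bar> \<le> w" by (simp add: X_def)
qed

text \<open>Given the rational point \<open>(x, y, z) / w\<close> of the sphere of squared radius \<open>n\<close>, the line through it and the nearest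
  integral point meets the sphere again in a rational point with the smaller
  denominator \<open>w'\<close>, because the squared distance to the nearest integral point is at most \<open>3/4\<close>.\<close>

lemma davenport_cassels:
  fixes n x y z :: int
  assumes "w > 0" "x ^ 2 + y ^ 2 + z ^ 2 = n * int w ^ 2"
  shows "\<exists>a b c :: int. n = a ^ 2 + b ^ 2 + c ^ 2"
  using assms
proof (induction w arbitrary: x y z rule: less_induct)
  case (less w)
  have w: "int w > 0" using less.prems by simp
  obtain X where X: "2 * \<bar>x - int w * X\<bar> \<le> int w" by (rule nearest_multiple[OF w, of x])
  obtain Y where Y: "2 * \<bar>y - int w * Y\<bar> \<le> int w" by (rule nearest_multiple[OF w, of y])
  obtain Z where Z: "2 * \<bar>z - int w * Z\<bar> \<le> int w" by (rule nearest_multiple[OF w, of z])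
  define D where "D = (x - w * X) ^ 2 + (y - w * Y) ^ 2 + (z - w * Z) ^ 2"
  define a where "a = X ^ 2 + Y ^ 2 + Z ^ 2 - n"
  define b where "b = 2 * (n * w - (x * X + y * Y + z * Z))"
  \<comment> \<open>\<open>(a * x + b * X) / w'\<close> and its analogues are the coordinates of the second intersection point\<close>
  define w' where "w' = a * w + b"
  have D: "w * w' = D"
  proof -
    have "D = (x ^ 2 + y ^ 2 + z ^ 2) - 2 * w * (x * X + y * Y + z * Z) + int w ^ 2 * (X ^ 2 + Y ^ 2 + Z ^ 2)"
      unfolding D_def by (simp add: power2_eq_square algebra_simps)
    then show ?thesis unfolding less.prems(2) w'_def a_def b_def
      by (simp add: power2_eq_square algebra_simps)
  qed
  show ?case
  proof (cases "D = 0")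
    case True
    then have "x = w * X" "y = w * Y" "z = w * Z" unfolding D_def
      by (smt (verit) zero_le_power2 zero_eq_power2)+
    then have "int w ^ 2 * n = int w ^ 2 * (X ^ 2 + Y ^ 2 + Z ^ 2)"
      using less.prems(2) by (simp add: power_mult_distrib algebra_simps)
    then show ?thesis using w by auto
  next
    case False
    have "D \<ge> 0" by (simp add: D_def)
    then have "w * w' > 0" using False D by simp
    then have w'pos: "w' > 0" using w by (simp add: zero_less_mult_iff)
    have sq: "4 * c ^ 2 \<le> int w ^ 2" if "2 * \<bar>c\<bar> \<le> int w" for c
    proof -
      have "(2 * \<bar>c\<bar>) ^ 2 \<le> int w ^ 2" using that by (intro power_mono) auto
      then show ?thesis by (simp add: power_mult_distrib)
    qed
    have "4 * D \<le> 3 * int w ^ 2" using sq[OF X] sq[OF Y] sq[OF Z] unfolding D_def distrib_left by linarith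
    then have "4 * (int w * w') \<le> 3 * (int w * int w)" unfolding D power2_eq_square .
    moreover have "int w * int w > 0" using w by simp
    ultimately have "int w * w' < int w * int w" by linarith
    then have "w' < int w" using w by simp
    moreover have "(a * x + b * X) ^ 2 + (a * y + b * Y) ^ 2 + (a * z + b * Z) ^ 2 = n * w' ^ 2"
    proof -
      have "(a * x + b * X) ^ 2 + (a * y + b * Y) ^ 2 + (a * z + b * Z) ^ 2
         = a ^ 2 * (x ^ 2 + y ^ 2 + z ^ 2) + a * b * (2 * (x * X + y * Y + z * Z)) + b ^ 2 * (X ^ 2 + Y ^ 2 + Z ^ 2)"
        by (simp add: power2_eq_square algebra_simps)
      also have "X ^ 2 + Y ^ 2 + Z ^ 2 = a + n" by (simp add: a_def)
      also have "2 * (x * X + y * Y + z * Z) = 2 * n * w - b" by (simp add: b_def)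
      finally show ?thesis unfolding less.prems(2) w'_def
        by (simp add: power2_eq_square algebra_simps)
    qed
    ultimately show ?thesis
      using less.IH[of "nat w'" "a * x + b * X" "a * y + b * Y" "a * z + b * Z"] w'pos by simp
  qed
qed

section \<open>Sums of three squares\<close>

lemma three_squares_of_form:
  fixes n t :: nat and a b :: int
  assumes n: "n > 0" and t: "t > 0" and cop: "coprime n t"
    and r: "QuadRes n (- t)" and s: "QuadRes t n"
    and tsq: "\<And>k. k ^ 2 \<noteq> t" and ntsq: "\<And>k. k ^ 2 \<noteq> n * t"
    and ab: "int t = a ^ 2 + b ^ 2"
  shows "\<exists>a b c :: int. int n = a ^ 2 + b ^ 2 + c ^ 2"
proof -
  obtain x y z :: int where xyz: "z \<noteq> 0" "x ^ 2 + t * y ^ 2 = n * z ^ 2"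
    by (rule legendre_equation[OF n t cop r s tsq ntsq])
  have "x ^ 2 + (a * y) ^ 2 + (b * y) ^ 2 = int n * int (nat \<bar>z\<bar>) ^ 2"
    using xyz(2) unfolding ab by (simp add: power_mult_distrib algebra_simps)
  then show ?thesis using davenport_cassels[of "nat \<bar>z\<bar>" x "a * y" "b * y" "int n"] xyz(1) by simp
qed

lemma not_square_if_simple_prime:
  fixes q m :: nat
  assumes "prime q" "\<not> q dvd m"
  shows "k ^ 2 \<noteq> q * m"
proof
  assume k: "k ^ 2 = q * m"
  then have "q dvd k" using assms(1) by (metis dvd_triv_left prime_dvd_power)
  then have "q * q dvd q * m" unfolding k[symmetric] power2_eq_square by (intro mult_dvd_mono)
  then show False using assms by (simp add: prime_gt_0_nat)
qed

text \<open>The auxiliary prime \<open>q\<close> has to make \<open>-t\<close> a square modulo every \<open>p\<close> in \<open>P\<close> and \<open>n\<close> a square modulo \<open>q\<close>. The first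
  condition prescribes \<open>(q/p)\<close>; as \<open>q \<equiv> 1\<close> modulo 4, reciprocity then determines
  \<open>(n/q)\<close> in terms of \<open>n\<close> modulo 8. It comes out right with \<open>t = q\<close>, except that \<open>n \<equiv> 3\<close> modulo 8 needs
  \<open>t = 2 q\<close> and that for even \<open>n\<close> the residue of \<open>q\<close> modulo 8 has to be adapted.\<close>

lemma three_squares_prime_product:
  fixes P :: "nat set"
  assumes P: "finite P" "\<And>p. p \<in> P \<Longrightarrow> prime p" "\<And>p. p \<in> P \<Longrightarrow> p > 2"
    and n: "n = \<Prod>P \<and> n mod 8 \<in> {1, 3, 5} \<or> n = 2 * \<Prod>P"
  shows "\<exists>a b c :: int. int n = a ^ 2 + b ^ 2 + c ^ 2"
proof -
  define N where "N = \<Prod>P"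
  define neg2 where "neg2 \<longleftrightarrow> n = N \<and> n mod 8 = 3"
  define e where "e p = (if neg2 then chi4 p * chi8 p else chi4 p)" for p
  define e2 where "e2 = (if n = N then 1 else chi4 N)"
  have oddp: "odd p" if "p \<in> P" for p using P(2,3)[OF that] prime_odd_nat by blast
  have "odd N"
    unfolding N_def using P(1) oddp by (induction P) auto
  then have chiN: "chi4 N = 1 \<or> chi4 N = - 1" by (simp add: chi4_def)
  have e1: "e p = 1 \<or> e p = - 1" if "p \<in> P" for p
    using oddp[OF that] by (simp add: e_def chi4_def chi8_def)
  have e2: "e2 = 1 \<or> e2 = - 1" using chiN by (simp add: e2_def)
  have "\<exists>q. prime q \<and> q > 2 \<and> q \<notin> P \<and> chi4 q = 1 \<and> chi8 q = e2 \<and> (\<forall>p\<in>P. Legendre q p = e p)"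
    by (rule exists_prime_with_symbols[of P e e2, OF P e1 e2]) blast+
  then obtain q where q: "prime q" "q > 2" "q \<notin> P" "chi4 q = 1" "chi8 q = e2"
      "\<And>p. p \<in> P \<Longrightarrow> Legendre q p = e p"
    by blast
  define t where "t = (if neg2 then 2 * q else q)"
  have "odd q" using q(1,2) prime_odd_nat by blast
  have "\<not> q dvd N"
  proof
    assume "q dvd N"
    then obtain p where "p \<in> P" "q dvd p" unfolding N_def using prime_dvd_prod_iff[OF P(1) q(1)] by auto
    then show False using primes_dvd_imp_eq[OF q(1) P(2)] q(3) by blast
  qed
  have nN: "n = N \<or> n = 2 * N" using n by (auto simp: N_def)
  have "N > 0" unfolding N_def using P(2) prime_gt_0_nat by (intro prod_pos) blast
  then have n0: "n > 0" using nN by auto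
  have q2: "\<not> q dvd 2" using q(2) dvd_imp_le[of q 2] by auto
  have qn: "\<not> q dvd n" using nN \<open>\<not> q dvd N\<close> q(1) q2 by (auto simp: prime_dvd_mult_iff)
  have cqn: "coprime n q" using qn q(1) by (metis coprime_commute prime_imp_coprime)
  have t0: "t > 0" using q by (simp add: t_def)
  have cop: "coprime n t"
    using cqn \<open>odd N\<close> by (auto simp: t_def neg2_def coprime_commute)
  have tsq: "k ^ 2 \<noteq> t" for k
  proof -
    have "\<not> q dvd 1" using q(2) by simp
    then have "k ^ 2 \<noteq> q * 1" "k ^ 2 \<noteq> q * 2"
      using not_square_if_simple_prime[OF q(1)] q2 by blast+
    then show ?thesis by (simp add: t_def mult.commute[of q])
  qed
  have ntsq: "k ^ 2 \<noteq> n * t" for k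
  proof -
    have "\<not> q dvd n * 2" using qn q2 q(1) by (simp add: prime_dvd_mult_iff)
    then have "k ^ 2 \<noteq> q * n" "k ^ 2 \<noteq> q * (n * 2)"
      using not_square_if_simple_prime[OF q(1)] qn by blast+
    then show ?thesis by (simp add: t_def mult_ac)
  qed
  obtain a b :: int where ab: "int q = a ^ 2 + b ^ 2" by (rule prime_1_mod_4_two_squares[OF q(1,2,4)])
  obtain a' b' :: int where ab': "int t = a' ^ 2 + b' ^ 2"
  proof (cases neg2)
    case True
    then have "int t = (a + b) ^ 2 + (a - b) ^ 2" using ab by (simp add: t_def power2_eq_square algebra_simps)
    then show ?thesis by (rule that)
  next
    case False
    then show ?thesis using ab that by (simp add: t_def)
  qed
  have rP: "QuadRes (int p) (- int t)" if p: "p \<in> P" for p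
  proof (rule QuadRes_of_Legendre)
    note pp = P(2,3)[OF p]
    have "Legendre (- int t) p = Legendre (if neg2 then - 1 * 2 else - 1) p * Legendre q p"
      by (simp add: Legendre_mult[OF pp, symmetric] t_def)
    also have "Legendre (if neg2 then - 1 * 2 else - 1) p = e p"
    proof -
      have "Legendre (- 2) p = chi4 p * chi8 p"
        using Legendre_mult[OF pp, of "- 1" 2] by (simp add: Legendre_minus_1[OF pp] Legendre_2[OF pp])
      then show ?thesis by (simp add: e_def Legendre_minus_1[OF pp])
    qed
    also have "e p * Legendre q p = 1"
      using q(6)[OF p] oddp[OF p] by (simp add: e_def chi4_def chi8_def)
    finally show "Legendre (- int t) p = 1" .
  qed
  have rN: "QuadRes (int N) (- int t)" unfolding N_def by (rule QuadRes_prod_primes[OF P(1,2) rP])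
  have r: "QuadRes n (- t)"
  proof (cases "n = N")
    case False
    then have "n = 2 * N" using nN by blast
    moreover have "coprime (2::int) (int N)" using \<open>odd N\<close> by simp
    then have "QuadRes (2 * int N) (- t)" using rN by (intro QuadRes_mult_coprime QuadRes_2)
    ultimately show ?thesis by simp
  qed (use rN in simp)
  have "Legendre p q = e p" if p: "p \<in> P" for p
  proof -
    note pp = P(2,3)[OF p]
    have "p \<noteq> q" using p q(3) by blast
    have "q mod 4 = 1" using q(4) by (auto simp: chi4_def split: if_splits)
    then have "even ((q - 1) div 2)" by presburger
    then have "Legendre p q * Legendre q p = 1"
      using Quadratic_Reciprocity[OF pp q(1,2) \<open>p \<noteq> q\<close>] by simp
    then show ?thesis using q(6)[OF p] Legendre_cases[of p q] oddp[OF p] by (auto simp: e_def chi4_def chi8_def split: if_splits)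
  qed
  then have LN: "Legendre N q = (\<Prod>p\<in>P. e p)"
    unfolding N_def of_nat_prod by (subst Legendre_prod[OF q(1,2) P(1)]) simp
  also have "\<dots> = (if neg2 then chi4 N * chi8 N else chi4 N)"
  proof -
    have "(\<Prod>p\<in>P. chi4 p) = chi4 N" "(\<Prod>p\<in>P. chi8 p) = chi8 N"
      unfolding N_def by (rule prod_multiplicative; simp add: P(1) chi48_mult; simp add: chi4_def chi8_def)+
    then show ?thesis by (simp add: e_def prod.distrib)
  qed
  finally have LN: "Legendre N q = (if neg2 then chi4 N * chi8 N else chi4 N)" .
  have "Legendre n q = 1"
  proof (cases "n = N")
    case True
    then have "N mod 8 \<in> {1, 3, 5}" using n P by (auto simp: N_def)
    then have "Legendre N q = 1" unfolding LN neg2_def True chi48_mod[of N, symmetric]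
      by (auto simp: chi4_def chi8_def)
    then show ?thesis by (simp add: True)
  next
    case False
    then have "n = 2 * N" using nN by blast
    then have "Legendre n q = Legendre 2 q * Legendre N q" using Legendre_mult[OF q(1,2), of 2 N] by simp
    also have "\<dots> = chi4 N * chi4 N" using Legendre_2[OF q(1,2)] q(5) LN False by (simp add: e2_def neg2_def)
    finally show ?thesis using chiN by auto
  qed
  then have sq: "QuadRes q n" by (rule QuadRes_of_Legendre)
  have s: "QuadRes t n"
  proof (cases neg2)
    case True
    have "coprime (2::int) (int q)" using \<open>odd q\<close> by simp
    then have "QuadRes (2 * int q) n" using sq by (intro QuadRes_mult_coprime QuadRes_2)
    then show ?thesis using True by (simp add: t_def)
  qed (use sq in \<open>simp add: t_def\<close>)
  show ?thesis by (rule three_squares_of_form[OF n0 t0 cop r s tsq ntsq ab'])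
qed

theorem three_squares:
  assumes "n mod 8 \<in> {1, 2, 3, 5, 6 :: nat}"
  shows "\<exists>a b c :: int. int n = a ^ 2 + b ^ 2 + c ^ 2"
  using assms
proof (induction n rule: less_induct)
  case (less n)
  have n0: "n > 0" using less.prems by (cases n) auto
  show ?case
  proof (cases "squarefree n")
    case False
    then obtain s where s: "s ^ 2 dvd n" "\<not> s dvd 1" by (auto simp: squarefree_def)
    then obtain m where m: "n = s ^ 2 * m" by blast
    have "odd s"
    proof
      assume "even s"
      then obtain u where "s = 2 * u" by blast
      then have "n mod 4 = 0" using m by (simp add: power_mult_distrib)
      then have "n mod 8 = 0 \<or> n mod 8 = 4" by presburger
      then show False using less.prems by auto
    qed
    then have "s mod 8 = 1 \<or> s mod 8 = 3 \<or> s mod 8 = 5 \<or> s mod 8 = 7" by presburger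
    then have "(s mod 8) ^ 2 mod 8 = 1" by auto
    then have "s ^ 2 mod 8 = 1" by (simp add: power_mod)
    then have "n mod 8 = m mod 8" unfolding m by (metis mod_mult_left_eq mult_1)
    moreover have "s > 1" using s n0 m by (cases s) (auto simp: less_Suc_eq)
    then have "s ^ 2 > 1" using less_1_mult[of s s] by (simp add: power2_eq_square)
    then have "m < n" using m n0 by simp
    ultimately obtain a b c :: int where "int m = a ^ 2 + b ^ 2 + c ^ 2" using less by metis
    then have "int n = (s * a) ^ 2 + (s * b) ^ 2 + (s * c) ^ 2"
      by (simp add: m power_mult_distrib distrib_left)
    then show ?thesis by blast
  next
    case True
    have prod: "m = \<Prod>(prime_factors m)" if "m dvd n" for m
    proof -
      have "m > 0" using that n0 by (simp add: dvd_pos_nat)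
      have "squarefree m" using True that unfolding squarefree_def by (meson dvd_trans)
      then have "\<forall>p\<in>prime_factors m. multiplicity p m = 1" 
        using \<open>m > 0\<close> squarefree_factorial_semiring'[of m] by simp
      then have "(\<Prod>p\<in>prime_factors m. p ^ multiplicity p m) = \<Prod>(prime_factors m)" by (intro prod.cong) auto
      then show ?thesis using prime_factorization_nat[OF \<open>m > 0\<close>] by simp
    qed
    \<comment> \<open>the odd part of \<open>n\<close>, since 4 does not divide \<open>n\<close>\<close>
    define m where "m = (if even n then n div 2 else n)"
    have "odd m"
    proof
      assume "even m"
      then have "n mod 4 = 0" by (auto simp: m_def split: if_splits)
      then have "n mod 8 = 0 \<or> n mod 8 = 4" by presburger
      then show False using less.prems by auto
    qed
    have "m dvd n" by (auto simp: m_def)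
    show ?thesis
    proof (rule three_squares_prime_product)
      show "finite (prime_factors m)" by simp
      show "prime p" if "p \<in> prime_factors m" for p using that by auto
      show "p > 2" if "p \<in> prime_factors m" for p
      proof -
        have "prime p" "p dvd m" using that by auto
        then have "p \<noteq> 2" using \<open>odd m\<close> by auto
        then show ?thesis using prime_ge_2_nat[OF \<open>prime p\<close>] by simp
      qed
      show "n = \<Prod>(prime_factors m) \<and> n mod 8 \<in> {1, 3, 5} \<or> n = 2 * \<Prod>(prime_factors m)"
      proof (cases "even n")
        case True
        then have "n = 2 * m" by (simp add: m_def)
        then show ?thesis using prod[OF \<open>m dvd n\<close>] by simp
      next
        case False
        then have "n = m" by (simp add: m_def)
        moreover have "n mod 8 \<noteq> 2" "n mod 8 \<noteq> 6" using False by presburger+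
        ultimately show ?thesis using prod[OF \<open>m dvd n\<close>] less.prems by auto
      qed
    qed
  qed
qed

lemma square_mod_8: "(x::int) ^ 2 mod 8 = (if odd x then 1 else if x mod 4 = 0 then 0 else 4)"
proof -
  have "x mod 8 = 0 \<or> x mod 8 = 1 \<or> x mod 8 = 2 \<or> x mod 8 = 3 \<or> x mod 8 = 4 \<or> x mod 8 = 5 \<or> x mod 8 = 6 \<or> x mod 8 = 7"
    by presburger
  moreover have "x mod 4 = (x mod 8) mod 4" by (simp add: mod_mod_cancel)
  moreover have "odd x \<longleftrightarrow> odd (x mod 8)" by presburger
  moreover have "x ^ 2 mod 8 = (x mod 8) ^ 2 mod 8" by (simp add: power_mod)
  ultimately show ?thesis by (elim disjE) simp_all
qed

text \<open>Squares are 0, 1 or 4 modulo 8, and \<open>17 \<equiv> 1\<close>. A value with \<open>x\<close>, \<open>y\<close>, \<open>z\<close> not all even is therefore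
  congruent to 1, 2, 3, 5 or 6 modulo 8; otherwise everything is divided by 4.\<close>

theorem form_1_1_17_three_squares:
  fixes x y z :: int
  shows "\<exists>a b c :: int. x ^ 2 + y ^ 2 + 17 * z ^ 2 = a ^ 2 + b ^ 2 + c ^ 2"
proof (induction "nat (x ^ 2 + y ^ 2 + 17 * z ^ 2)" arbitrary: x y z rule: less_induct)
  case less
  define n where "n = x ^ 2 + y ^ 2 + 17 * z ^ 2"
  have n0: "n \<ge> 0" by (simp add: n_def)
  have mod8: "n mod 8 = (x ^ 2 mod 8 + y ^ 2 mod 8 + z ^ 2 mod 8) mod 8"
  proof -
    have "n = x ^ 2 + y ^ 2 + z ^ 2 + 8 * (2 * z ^ 2)" by (simp add: n_def)
    then have "n mod 8 = (x ^ 2 + y ^ 2 + z ^ 2) mod 8" by (simp only: mod_mult_self2)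
    moreover have "(A + B + C) mod 8 = (A mod 8 + B mod 8 + C mod 8) mod 8" for A B C :: int
    proof -
      have "(A + B + C) mod 8 = ((A + B) mod 8 + C mod 8) mod 8" by (rule mod_add_eq[symmetric])
      also have "(A + B) mod 8 = (A mod 8 + B mod 8) mod 8" by (rule mod_add_eq[symmetric])
      also have "((A mod 8 + B mod 8) mod 8 + C mod 8) mod 8 = (A mod 8 + B mod 8 + C mod 8) mod 8"
        by (rule mod_add_left_eq)
      finally show ?thesis .
    qed
    ultimately show ?thesis by simp
  qed
  show ?case
  proof (cases "n = 0")
    case True
    then show ?thesis unfolding n_def by (intro exI[of _ 0]) simp
  next
    case nz: False
    show ?thesis
    proof (cases "even x \<and> even y \<and> even z")
      case True
      then obtain u v w where uvw: "x = 2 * u" "y = 2 * v" "z = 2 * w" by (elim conjE evenE)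
      define k where "k = u ^ 2 + v ^ 2 + 17 * w ^ 2"
      have eq: "n = 4 * k" by (simp add: n_def k_def uvw power_mult_distrib)
      then have "nat k < nat n" using nz n0 by simp
      then have "nat (u ^ 2 + v ^ 2 + 17 * w ^ 2) < nat (x ^ 2 + y ^ 2 + 17 * z ^ 2)"
        unfolding k_def n_def .
      then obtain a b c where "u ^ 2 + v ^ 2 + 17 * w ^ 2 = a ^ 2 + b ^ 2 + c ^ 2" using less by blast
      then have "n = (2 * a) ^ 2 + (2 * b) ^ 2 + (2 * c) ^ 2" by (simp add: eq k_def power_mult_distrib)
      then show ?thesis unfolding n_def by blast
    next
      case False
      have v: "u ^ 2 mod 8 = 0 \<or> u ^ 2 mod 8 = 1 \<or> u ^ 2 mod 8 = 4" for u :: int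
        by (simp add: square_mod_8)
      have "x ^ 2 mod 8 = 1 \<or> y ^ 2 mod 8 = 1 \<or> z ^ 2 mod 8 = 1"
        using False by (simp add: square_mod_8) blast
      then have "n mod 8 \<in> {1, 2, 3, 5, 6}"
        unfolding mod8 using v[of x] v[of y] v[of z] by (elim disjE) simp_all
      then have "nat (n mod 8) \<in> {1, 2, 3, 5, 6}" by auto
      moreover have "nat (n mod 8) = nat n mod 8" using n0 by (simp add: nat_mod_distrib)
      ultimately have "nat n mod 8 \<in> {1, 2, 3, 5, 6}" by simp
      from three_squares[OF this] show ?thesis using n0 unfolding n_def by simp
    qed
  qed
qed

section \<open>Isometries and Lebesgue measure\<close>

lemma isometry_groupD:
  assumes "S \<in> isometry_group"
  shows "surj S" "dist (S x) (S y) = dist x y"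
  using assms by (auto simp: isometry_group_def)

lemma isometry_group_inj: "S \<in> isometry_group \<Longrightarrow> inj S"
  using isometry_groupD(2) by (metis dist_eq_0_iff injI)

lemma isometry_group_inv:
  assumes S: "S \<in> isometry_group"
  shows "inv_into UNIV S \<in> isometry_group" "S (inv_into UNIV S x) = x" "inv_into UNIV S (S x) = x"
proof -
  show 1: "S (inv_into UNIV S x) = x" for x using isometry_groupD(1)[OF S] by (rule surj_f_inv_f)
  show 2: "inv_into UNIV S (S x) = x" for x using isometry_group_inj[OF S] by simp
  have "dist (inv_into UNIV S x) (inv_into UNIV S y) = dist x y" for x y
    using isometry_groupD(2)[OF S, of "inv_into UNIV S x" "inv_into UNIV S y"] by (simp add: 1)
  moreover have "surj (inv_into UNIV S)" by (rule surjI[of "inv_into UNIV S" S]) (rule 2)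
  ultimately show "inv_into UNIV S \<in> isometry_group" by (simp add: isometry_group_def)
qed

lemma isometry_group_comp:
  "S \<in> isometry_group \<Longrightarrow> T \<in> isometry_group \<Longrightarrow> S \<circ> T \<in> isometry_group"
  unfolding isometry_group_def using comp_surj[of T S] by (simp add: o_def)

lemma isometry_group_reflect: "(\<lambda>x. n - x :: 'a::real_normed_vector) \<in> isometry_group"
  unfolding isometry_group_def by (auto simp: dist_norm norm_minus_commute intro!: surjI[of _ "\<lambda>x. n - x"])

lemma isometry_linear_part:
  fixes S :: "'a::euclidean_space \<Rightarrow> 'a"
  assumes "S \<in> isometry_group"
  shows "orthogonal_transformation (\<lambda>y. S y - S 0)"
  unfolding orthogonal_transformation_isometry
  using isometry_groupD(2)[OF assms] by (simp add: dist_norm)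

lemma isometry_measurable:
  fixes S :: "'a::euclidean_space \<Rightarrow> 'a"
  assumes "S \<in> isometry_group"
  shows "S \<in> borel_measurable borel"
proof -
  have "continuous_on UNIV S"
    unfolding continuous_on_iff using isometry_groupD(2)[OF assms] by metis
  then show ?thesis by (rule borel_measurable_continuous_onI)
qed

lemma nn_integral_lborel_shift:
  fixes c :: "'a::euclidean_space"
  assumes [measurable]: "f \<in> borel_measurable borel"
  shows "(\<integral>\<^sup>+y. f (y + c) \<partial>lborel) = (\<integral>\<^sup>+y. f y \<partial>lborel)"
proof -
  have "(\<integral>\<^sup>+y. f y \<partial>lborel) = (\<integral>\<^sup>+y. f y \<partial>distr lborel borel ((+) c))" by (simp add: lborel_distr_plus)
  also have "\<dots> = (\<integral>\<^sup>+y. f (c + y) \<partial>lborel)" by (rule nn_integral_distr) auto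
  finally show ?thesis by (simp add: add.commute)
qed

text \<open>The image measure is translation invariant and agrees with Lebesgue measure on the unit ball \<open>U\<close>.
  Evaluating the integral of \<open>1 A (x + S u) * 1 U u\<close> over \<open>(x, u)\<close> in both orders shows that the two
  measures agree on every \<open>A\<close>.\<close>

lemma distr_lborel_isometry:
  fixes S :: "'a::euclidean_space \<Rightarrow> 'a"
  assumes S: "S \<in> isometry_group"
  shows "distr lborel borel S = lborel"
proof (rule measure_eqI)
  fix A assume "A \<in> sets (distr lborel borel S)"
  then have A[measurable]: "A \<in> sets borel" by simp
  note S_meas[measurable] = isometry_measurable[OF S]
  define L where "L y = S y - S 0" for y
  have orth: "orthogonal_transformation L" unfolding L_def by (rule isometry_linear_part[OF S])
  define U where "U = (cball 0 1 :: 'a set)"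
  have U[measurable]: "U \<in> sets borel" by (simp add: U_def)
  have Upos: "emeasure lborel U \<noteq> 0" "emeasure lborel U \<noteq> \<infinity>"
    using emeasure_lborel_cball_finite[of "0::'a" 1] content_cball_pos[of 1 "0::'a"]
    by (auto simp: U_def emeasure_eq_ennreal_measure)
  have inner: "(\<integral>\<^sup>+x. indicator U (v - inv_into UNIV L x) \<partial>lborel) = emeasure lborel U" for v
  proof -
    have "surj L" using orth by (rule orthogonal_transformation_surj)
    have "norm (v - inv_into UNIV L x) = norm (L v - x)" for x
      using orthogonal_transformation_norm[OF orth, of "v - inv_into UNIV L x"]
      by (simp add: linear_diff[OF orthogonal_transformation_linear[OF orth]] surj_f_inv_f[OF \<open>surj L\<close>])
    then have "(\<integral>\<^sup>+x. indicator U (v - inv_into UNIV L x) \<partial>lborel) = (\<integral>\<^sup>+x. indicator U (x + (- L v)) \<partial>lborel)"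
      by (intro nn_integral_cong) (auto simp: U_def indicator_def norm_minus_commute)
    also have "\<dots> = (\<integral>\<^sup>+x. indicator U x \<partial>lborel)" by (rule nn_integral_lborel_shift) simp
    finally show ?thesis by simp
  qed
  have Linv: "S (v - inv_into UNIV L x) = S v - x" for v x
  proof -
    have "L (v - inv_into UNIV L x) = L v - x"
      by (simp add: linear_diff[OF orthogonal_transformation_linear[OF orth]]
          surj_f_inv_f[OF orthogonal_transformation_surj[OF orth]])
    then show ?thesis by (simp add: L_def algebra_simps)
  qed
  have Lm[measurable]: "inv_into UNIV L \<in> borel_measurable borel"
    using orth orthogonal_transformation_inv orthogonal_transformation_linear
    by (intro borel_measurable_continuous_onI linear_continuous_on linear_conv_bounded_linear[THEN iffD1]) blast
  have "emeasure lborel A * emeasure lborel U = (\<integral>\<^sup>+u. (\<integral>\<^sup>+x. indicator A x \<partial>lborel) * indicator U u \<partial>lborel)"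
    by (simp add: nn_integral_cmult)
  also have "\<dots> = (\<integral>\<^sup>+u. (\<integral>\<^sup>+x. indicator A (x + S u) \<partial>lborel) * indicator U u \<partial>lborel)"
    by (intro nn_integral_cong) (simp add: nn_integral_lborel_shift)
  also have "\<dots> = (\<integral>\<^sup>+u. (\<integral>\<^sup>+x. indicator A (x + S u) * indicator U u \<partial>lborel) \<partial>lborel)"
    by (intro nn_integral_cong) (simp add: nn_integral_multc)
  also have "\<dots> = (\<integral>\<^sup>+x. (\<integral>\<^sup>+u. indicator A (x + S u) * indicator U u \<partial>lborel) \<partial>lborel)"
    by (rule lborel_pair.Fubini'[where f = "\<lambda>x u. indicator A (x + S u) * indicator U u"]) measurable
  also have "\<dots> = (\<integral>\<^sup>+x. (\<integral>\<^sup>+v. indicator A (S v) * indicator U (v - inv_into UNIV L x) \<partial>lborel) \<partial>lborel)"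
  proof (rule nn_integral_cong)
    fix x
    have "(\<integral>\<^sup>+u. indicator A (x + S u) * indicator U u \<partial>lborel)
        = (\<integral>\<^sup>+v. indicator A (x + S (v + (- inv_into UNIV L x))) * indicator U (v + (- inv_into UNIV L x)) \<partial>lborel)"
      by (rule nn_integral_lborel_shift[symmetric]) measurable
    then show "(\<integral>\<^sup>+u. indicator A (x + S u) * indicator U u \<partial>lborel)
        = (\<integral>\<^sup>+v. indicator A (S v) * indicator U (v - inv_into UNIV L x) \<partial>lborel)"
      by (simp add: Linv)
  qed
  also have "\<dots> = (\<integral>\<^sup>+v. (\<integral>\<^sup>+x. indicator A (S v) * indicator U (v - inv_into UNIV L x) \<partial>lborel) \<partial>lborel)"
    by (rule lborel_pair.Fubini'[where f = "\<lambda>v x. indicator A (S v) * indicator U (v - inv_into UNIV L x)"]) measurable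
  also have "\<dots> = (\<integral>\<^sup>+v. indicator A (S v) * emeasure lborel U \<partial>lborel)"
    by (intro nn_integral_cong) (simp add: nn_integral_cmult inner)
  also have "\<dots> = (\<integral>\<^sup>+v. indicator A (S v) \<partial>lborel) * emeasure lborel U" by (rule nn_integral_multc) measurable
  also have "(\<integral>\<^sup>+v. indicator A (S v) \<partial>lborel) = (\<integral>\<^sup>+v. indicator A v \<partial>distr lborel borel S)"
    by (rule nn_integral_distr[symmetric]) measurable
  also have "\<dots> = emeasure (distr lborel borel S) A" by simp
  finally have "emeasure lborel U * emeasure lborel A = emeasure lborel U * emeasure (distr lborel borel S) A"
    by (simp add: mult.commute)
  then show "emeasure (distr lborel borel S) A = emeasure lborel A"
    using Upos by (simp add: ennreal_mult_cancel_left)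
qed simp

lemma nn_integral_isometry:
  fixes S :: "'a::euclidean_space \<Rightarrow> 'a"
  assumes S: "S \<in> isometry_group" and [measurable]: "f \<in> borel_measurable borel"
  shows "(\<integral>\<^sup>+y. f (S y) \<partial>lborel) = (\<integral>\<^sup>+y. f y \<partial>lborel)"
proof -
  note isometry_measurable[OF S, measurable]
  have "(\<integral>\<^sup>+y. f y \<partial>distr lborel borel S) = (\<integral>\<^sup>+y. f (S y) \<partial>lborel)"
    by (rule nn_integral_distr) measurable
  then show ?thesis by (simp add: distr_lborel_isometry[OF S])
qed

lemma AE_isometry:
  fixes S :: "'a::euclidean_space \<Rightarrow> 'a"
  assumes S: "S \<in> isometry_group" and P: "AE x in lborel. P x"
  shows "AE x in lborel. P (S x)"
proof -
  note isometry_measurable[OF S, measurable]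
  obtain N where N: "{x \<in> space lborel. \<not> P x} \<subseteq> N" "emeasure lborel N = 0" "N \<in> sets lborel"
    using P by (rule AE_E)
  have "AE x in distr lborel borel S. x \<notin> N"
    unfolding distr_lborel_isometry[OF S] using N by (intro AE_not_in) auto
  then have "AE x in lborel. S x \<notin> N"
    using N by (subst (asm) AE_distr_iff) auto
  then show ?thesis by eventually_elim (use N in auto)
qed

section \<open>Periodization over the integer lattice\<close>

lemma countable_integer_lattice: "countable (integer_lattice :: (real ^ 'n) set)"
proof -
  have "(integer_lattice :: (real ^ 'n) set) \<subseteq> range (\<lambda>f :: 'n \<Rightarrow> int. \<chi> i. of_int (f i))"
  proof
    fix v :: "real ^ 'n" assume v: "v \<in> integer_lattice"
    then have "v = (\<chi> i. of_int \<lfloor>v $ i\<rfloor>)"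
      by (auto simp: vec_eq_iff integer_lattice_def elim!: Ints_cases)
    then show "v \<in> range (\<lambda>f :: 'n \<Rightarrow> int. \<chi> i. of_int (f i))" by (rule range_eqI[where x = "\<lambda>i. \<lfloor>v $ i\<rfloor>"])
  qed
  then show ?thesis by (rule countable_subset) simp
qed

lemma integer_lattice_simps:
  "0 \<in> integer_lattice" "m \<in> integer_lattice \<Longrightarrow> n \<in> integer_lattice \<Longrightarrow> m + n \<in> integer_lattice"
  "n \<in> integer_lattice \<Longrightarrow> - n \<in> integer_lattice" "m \<in> integer_lattice \<Longrightarrow> n \<in> integer_lattice \<Longrightarrow> m - n \<in> integer_lattice"
  by (auto simp: integer_lattice_def)

definition periodization :: "(real ^ 'n \<Rightarrow> ennreal) \<Rightarrow> real ^ 'n \<Rightarrow> ennreal" where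
  "periodization f y = (\<integral>\<^sup>+n. f (y + n) \<partial>count_space integer_lattice)"

definition lattice_periodic :: "(real ^ 'n \<Rightarrow> 'b) \<Rightarrow> bool" where
  "lattice_periodic p \<longleftrightarrow> (\<forall>y. \<forall>n\<in>integer_lattice. p (y + n) = p y)"

lemma borel_measurable_periodization [measurable]:
  fixes f :: "real ^ 'n \<Rightarrow> ennreal"
  assumes [measurable]: "f \<in> borel_measurable borel"
  shows "periodization f \<in> borel_measurable borel"
proof -
  interpret sigma_finite_measure "count_space (integer_lattice :: (real ^ 'n) set)"
    by (rule sigma_finite_measure_count_space_countable[OF countable_integer_lattice])
  have "(\<lambda>(n, y). f (y + n)) \<in> borel_measurable (count_space (integer_lattice :: (real ^ 'n) set) \<Otimes>\<^sub>M borel)"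
    by (rule measurable_pair_measure_countable1[OF countable_integer_lattice]) simp
  from measurable_pair_swap[OF this]
  have "(\<lambda>(y, n). f (y + n)) \<in> borel_measurable (borel \<Otimes>\<^sub>M count_space (integer_lattice :: (real ^ 'n) set))"
    by simp
  then show ?thesis unfolding periodization_def[abs_def] by measurable
qed

lemma lattice_periodic_periodization:
  fixes f :: "real ^ 'n \<Rightarrow> ennreal"
  shows "lattice_periodic (periodization f)"
  unfolding lattice_periodic_def periodization_def
proof safe
  fix y m :: "real ^ 'n" assume m: "m \<in> integer_lattice"
  have "bij_betw ((+) m) integer_lattice (integer_lattice :: (real ^ 'n) set)"
    by (rule bij_betwI[where g = "\<lambda>n. n - m"]) (auto simp: m integer_lattice_simps)
  from nn_integral_bij_count_space[OF this, of "\<lambda>n. f (y + n)"]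
  show "(\<integral>\<^sup>+n. f (y + m + n) \<partial>count_space integer_lattice) = (\<integral>\<^sup>+n. f (y + n) \<partial>count_space integer_lattice)"
    by (simp add: add.assoc)
qed

text \<open>Both sides sum \<open>f y * g (y + n) * p y\<close> over all pairs: shift \<open>y\<close> by \<open>n\<close>, which does not change \<open>p\<close>.\<close>

lemma periodization_swap:
  fixes f g p :: "real ^ 'n \<Rightarrow> ennreal"
  assumes [measurable]: "f \<in> borel_measurable borel" "g \<in> borel_measurable borel" "p \<in> borel_measurable borel"
    and p: "lattice_periodic p"
  shows "(\<integral>\<^sup>+y. f y * periodization g y * p y \<partial>lborel) = (\<integral>\<^sup>+y. periodization f y * g y * p y \<partial>lborel)"
proof -
  let ?Z = "integer_lattice :: (real ^ 'n) set"
  have neg: "bij_betw uminus ?Z ?Z"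
    by (rule bij_betwI[where g = uminus]) (auto simp: integer_lattice_simps)
  have "(\<integral>\<^sup>+y. f y * periodization g y * p y \<partial>lborel)
      = (\<integral>\<^sup>+y. (\<integral>\<^sup>+n. f y * g (y + n) * p y \<partial>count_space ?Z) \<partial>lborel)"
    unfolding periodization_def
    by (intro nn_integral_cong) (simp add: nn_integral_cmult nn_integral_multc)
  also have "\<dots> = (\<integral>\<^sup>+n. (\<integral>\<^sup>+y. f y * g (y + n) * p y \<partial>lborel) \<partial>count_space ?Z)"
    by (rule nn_integral_count_space_nn_integral[OF countable_integer_lattice]) measurable
  also have "\<dots> = (\<integral>\<^sup>+n. (\<integral>\<^sup>+y. f (y + - n) * g y * p y \<partial>lborel) \<partial>count_space ?Z)"
  proof (rule nn_integral_cong)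
    fix n :: "real ^ 'n" assume "n \<in> space (count_space ?Z)"
    then have n: "- n \<in> ?Z" by (simp add: integer_lattice_simps)
    have "(\<integral>\<^sup>+y. f y * g (y + n) * p y \<partial>lborel) = (\<integral>\<^sup>+y. f (y + - n) * g (y + - n + n) * p (y + - n) \<partial>lborel)"
      by (rule nn_integral_lborel_shift[symmetric]) measurable
    also have "\<dots> = (\<integral>\<^sup>+y. f (y + - n) * g y * p y \<partial>lborel)"
    proof -
      have "p (y - n) = p y" for y
        using p n unfolding lattice_periodic_def by (metis add_uminus_conv_diff)
      then show ?thesis by simp
    qed
    finally show "(\<integral>\<^sup>+y. f y * g (y + n) * p y \<partial>lborel) = (\<integral>\<^sup>+y. f (y + - n) * g y * p y \<partial>lborel)" .
  qed
  also have "\<dots> = (\<integral>\<^sup>+n. (\<integral>\<^sup>+y. f (y + n) * g y * p y \<partial>lborel) \<partial>count_space ?Z)"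
    by (rule nn_integral_bij_count_space[OF neg])
  also have "\<dots> = (\<integral>\<^sup>+y. (\<integral>\<^sup>+n. f (y + n) * g y * p y \<partial>count_space ?Z) \<partial>lborel)"
    by (rule nn_integral_count_space_nn_integral[OF countable_integer_lattice, symmetric]) measurable
  also have "\<dots> = (\<integral>\<^sup>+y. periodization f y * g y * p y \<partial>lborel)"
    unfolding periodization_def
    by (intro nn_integral_cong) (simp add: nn_integral_multc)
  finally show ?thesis .
qed

definition unit_cube :: "(real ^ 'n) set" where
  "unit_cube = {y. \<forall>i. 0 \<le> y $ i \<and> y $ i < 1}"

lemma unit_cube_measurable [measurable]: "unit_cube \<in> sets borel"
proof -
  have "unit_cube = (\<Inter>i\<in>UNIV. {y :: real ^ 'n. 0 \<le> y $ i} \<inter> {y. y $ i < 1})" by (auto simp: unit_cube_def)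
  also have "\<dots> \<in> sets borel"
    by (intro sets.countable_INT'' sets.Int borel_closed borel_open closed_Collect_le open_Collect_less
        continuous_intros) auto
  finally show ?thesis .
qed

lemma periodization_indicator:
  "periodization (indicator A) y = emeasure (count_space integer_lattice) {n \<in> integer_lattice. y + n \<in> A}"
proof -
  have "periodization (indicator A) y = (\<integral>\<^sup>+n. indicator {n \<in> integer_lattice. y + n \<in> A} n \<partial>count_space integer_lattice)"
    unfolding periodization_def by (intro nn_integral_cong) (auto simp: indicator_def)
  also have "\<dots> = emeasure (count_space integer_lattice) {n \<in> integer_lattice. y + n \<in> A}"
    by (rule nn_integral_indicator) auto
  finally show ?thesis .
qed

lemma periodization_unit_cube:
  fixes y :: "real ^ 'n"
  shows "periodization (indicator unit_cube) y = 1"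
proof -
  have "{n \<in> integer_lattice. y + n \<in> unit_cube} = {\<chi> i. - of_int \<lfloor>y $ i\<rfloor>}"
  proof (intro equalityI subsetI)
    fix n assume n: "n \<in> {n \<in> integer_lattice. y + n \<in> unit_cube}"
    have "n $ i = - of_int \<lfloor>y $ i\<rfloor>" for i
    proof -
      obtain k where k: "n $ i = of_int k" using n by (auto simp: integer_lattice_def elim: Ints_cases)
      have "0 \<le> y $ i + n $ i" "y $ i + n $ i < 1" using n by (auto simp: unit_cube_def)
      then have "\<lfloor>y $ i\<rfloor> = - k" unfolding k floor_eq_iff by simp
      then show ?thesis by (simp add: k)
    qed
    then show "n \<in> {\<chi> i. - of_int \<lfloor>y $ i\<rfloor>}" by (simp add: vec_eq_iff)
  next
    fix n assume "n \<in> {(\<chi> i. - of_int \<lfloor>y $ i\<rfloor>) :: real ^ 'n}"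
    then show "n \<in> {n \<in> integer_lattice. y + n \<in> unit_cube}"
      by (auto simp: integer_lattice_def unit_cube_def) linarith
  qed
  moreover have "(\<chi> i. - of_int \<lfloor>y $ i\<rfloor>) \<in> integer_lattice" by (simp add: integer_lattice_def)
  ultimately show ?thesis unfolding periodization_indicator by simp
qed

text \<open>The mean value of a lattice periodic function.\<close>

definition torus_mean :: "(real ^ 'n \<Rightarrow> ennreal) \<Rightarrow> ennreal" where
  "torus_mean p = (\<integral>\<^sup>+y. indicator unit_cube y * p y \<partial>lborel)"

lemma nn_integral_periodization:
  fixes f p :: "real ^ 'n \<Rightarrow> ennreal"
  assumes [measurable]: "f \<in> borel_measurable borel" "p \<in> borel_measurable borel" and p: "lattice_periodic p"
  shows "(\<integral>\<^sup>+y. f y * p y \<partial>lborel) = torus_mean (\<lambda>y. periodization f y * p y)"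
proof -
  have "(\<integral>\<^sup>+y. f y * periodization (indicator unit_cube) y * p y \<partial>lborel)
      = (\<integral>\<^sup>+y. periodization f y * indicator unit_cube y * p y \<partial>lborel)"
    by (rule periodization_swap) (use p in measurable)
  then show ?thesis by (simp add: periodization_unit_cube torus_mean_def mult_ac)
qed

lemma nn_integral_tile:
  fixes f p :: "real ^ 'n \<Rightarrow> ennreal"
  assumes [measurable]: "f \<in> borel_measurable borel" "p \<in> borel_measurable borel" and p: "lattice_periodic p"
    and tile: "AE y in lborel. periodization f y = 1"
  shows "(\<integral>\<^sup>+y. f y * p y \<partial>lborel) = torus_mean p"
  unfolding nn_integral_periodization[OF assms(1,2) p] torus_mean_def
  by (rule nn_integral_cong_AE, use tile in eventually_elim) simp

lemma torus_mean_shift: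
  fixes p :: "real ^ 'n \<Rightarrow> ennreal"
  assumes [measurable]: "p \<in> borel_measurable borel" and p: "lattice_periodic p"
  shows "torus_mean (\<lambda>y. p (y + t)) = torus_mean p"
proof -
  have "torus_mean (\<lambda>y. p (y + t)) = (\<integral>\<^sup>+y. indicator unit_cube (y + - t) * p (y + - t + t) \<partial>lborel)"
    unfolding torus_mean_def by (rule nn_integral_lborel_shift[symmetric]) measurable
  also have "\<dots> = (\<integral>\<^sup>+y. indicator unit_cube (y + - t) * p y \<partial>lborel)" by simp
  also have "\<dots> = torus_mean p"
  proof (rule nn_integral_tile[OF _ _ p])
    show "AE y in lborel. periodization (\<lambda>y. indicator unit_cube (y + - t) :: ennreal) y = 1"
    proof (rule AE_I2)
      fix y
      show "periodization (\<lambda>y. indicator unit_cube (y + - t) :: ennreal) y = 1"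
        using periodization_unit_cube[of "y - t"] by (simp add: periodization_def algebra_simps)
    qed
  qed measurable
  finally show ?thesis .
qed

section \<open>Zeros of the Fourier transform of a Steinhaus set\<close>

text \<open>The vanishing at \<open>\<xi>\<close> of the Fourier transform of the indicator of \<open>B\<close>: the phases 0 and \<open>- pi / 2\<close> give its real and imaginary part.\<close>

definition fourier_zero :: "('a::euclidean_space) set \<Rightarrow> 'a \<Rightarrow> bool" where
  "fourier_zero B \<xi> \<longleftrightarrow> (\<forall>\<theta>. (\<integral>z. indicator B z * cos (2 * pi * (\<xi> \<bullet> z) + \<theta>) \<partial>lborel) = 0)"

text \<open>The set \<open>E\<close> is replaced by a Borel set \<open>B\<close> that differs from it by a null set; for almost every \<open>x\<close> no
  lattice point is affected by the difference. A lattice point \<open>n\<close> lies in \<open>S E + x\<close> iff \<open>n - x\<close> lies in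
  \<open>S E\<close>, whence the reflection \<open>x \<mapsto> - x\<close>.\<close>

lemma steinhaus_tile:
  fixes S :: "real ^ 'n \<Rightarrow> real ^ 'n"
  assumes S: "S \<in> isometry_group" and E: "E = B \<union> N0" "N0 \<subseteq> N'" "N' \<in> null_sets lborel"
    and one: "AE x in lebesgue. card ((\<lambda>y. S y + x) ` E \<inter> integer_lattice) = 1"
  shows "AE y in lborel. periodization (indicator {y. inv_into UNIV S y \<in> B}) y = 1"
proof -
  note inv = isometry_group_inv[OF S]
  have "AE x in lborel. inv_into UNIV S (n - x) \<notin> N'" for n
  proof -
    have "AE x in lborel. x \<notin> N'" using E(3) by (rule AE_not_in)
    from AE_isometry[OF isometry_group_comp[OF inv(1) isometry_group_reflect[of n]] this] show ?thesis by simp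
  qed
  then have "AE x in lborel. \<forall>n\<in>integer_lattice. inv_into UNIV S (n - x) \<notin> N'"
    by (subst AE_ball_countable[OF countable_integer_lattice]) blast
  moreover have "AE x in lborel. card ((\<lambda>y. S y + x) ` E \<inter> integer_lattice) = 1"
    using one by (simp only: AE_completion_iff)
  ultimately have "AE x in lborel. periodization (indicator {y. inv_into UNIV S y \<in> B}) (- x) = 1"
  proof eventually_elim
    case (elim x)
    have "{n \<in> integer_lattice. - x + n \<in> {y. inv_into UNIV S y \<in> B}} = (\<lambda>y. S y + x) ` E \<inter> integer_lattice"
    proof (intro equalityI subsetI)
      fix n assume n: "n \<in> {n \<in> integer_lattice. - x + n \<in> {y. inv_into UNIV S y \<in> B}}"
      then have "n = S (inv_into UNIV S (- x + n)) + x" "inv_into UNIV S (- x + n) \<in> E" by (auto simp: inv E(1))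
      then show "n \<in> (\<lambda>y. S y + x) ` E \<inter> integer_lattice" using n by blast
    next
      fix n assume "n \<in> (\<lambda>y. S y + x) ` E \<inter> integer_lattice"
      then obtain y where y: "y \<in> E" "n = S y + x" "n \<in> integer_lattice" by blast
      then have "inv_into UNIV S (n - x) = y" by (simp add: inv)
      then have "y \<notin> N'" using y(3) elim(1) by auto
      then have "y \<in> B" using y(1) E(1,2) by blast
      then show "n \<in> {n \<in> integer_lattice. - x + n \<in> {y. inv_into UNIV S y \<in> B}}"
        using y by (simp add: inv)
    qed
    then have one: "card {n \<in> integer_lattice. - x + n \<in> {y. inv_into UNIV S y \<in> B}} = 1" using elim(2) by (simp only:)
    then have fin: "finite {n \<in> integer_lattice. - x + n \<in> {y. inv_into UNIV S y \<in> B}}"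
      by (intro card_ge_0_finite) (simp only: one zero_less_one)
    have "emeasure (count_space integer_lattice) {n \<in> integer_lattice. - x + n \<in> {y. inv_into UNIV S y \<in> B}}
        = of_nat (card {n \<in> integer_lattice. - x + n \<in> {y. inv_into UNIV S y \<in> B}})"
      by (rule emeasure_count_space_finite[OF _ fin]) blast
    then show ?case unfolding periodization_indicator by (simp only: one of_nat_1)
  qed
  from AE_isometry[OF isometry_group_reflect[of 0] this] show ?thesis by simp
qed

lemma emeasure_unit_cube: "emeasure lborel (unit_cube :: (real ^ 'n) set) = 1"
proof -
  define u :: "real ^ 'n" where "u = (\<chi> i. 1)"
  have u: "u \<bullet> b = 1" if "b \<in> Basis" for b
    using that by (auto simp: u_def Basis_vec_def inner_axis)
  have "emeasure lborel (box 0 u) = 1" "emeasure lborel (cbox 0 u) = 1"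
    by (subst emeasure_lborel_box emeasure_lborel_cbox; simp add: u)+
  moreover have "box 0 u \<subseteq> unit_cube" "unit_cube \<subseteq> cbox 0 u"
    by (auto simp: u_def unit_cube_def mem_box_cart less_imp_le)
  then have "emeasure lborel (box 0 u) \<le> emeasure lborel (unit_cube :: (real ^ 'n) set)"
    "emeasure lborel (unit_cube :: (real ^ 'n) set) \<le> emeasure lborel (cbox 0 u)"
    by (auto intro!: emeasure_mono)
  ultimately show ?thesis by simp
qed

lemma torus_mean_const: "torus_mean (\<lambda>_. c) = c"
  unfolding torus_mean_def by (simp add: nn_integral_cmult_indicator emeasure_unit_cube mult.commute[of _ c])

lemma torus_mean_add:
  assumes [measurable]: "p \<in> borel_measurable borel" "q \<in> borel_measurable borel"
  shows "torus_mean (\<lambda>y. p y + q y) = torus_mean p + torus_mean q"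
  unfolding torus_mean_def by (simp add: distrib_left nn_integral_add)

lemma lattice_periodic_cos:
  fixes k :: "real ^ 'n"
  assumes k: "k \<in> integer_lattice"
  shows "lattice_periodic (\<lambda>y. h (cos (2 * pi * (k \<bullet> y) + \<theta>)))"
  unfolding lattice_periodic_def
proof safe
  fix y n :: "real ^ 'n" assume n: "n \<in> integer_lattice"
  have "k \<bullet> n \<in> \<int>" using k n by (auto simp: inner_vec_def integer_lattice_def)
  then obtain m where m: "k \<bullet> n = of_int m" by (elim Ints_cases)
  have "2 * pi * (k \<bullet> (y + n)) + \<theta> = (2 * pi * (k \<bullet> y) + \<theta>) + 2 * pi * of_int m"
    by (simp add: inner_add_right m algebra_simps)
  moreover have "cos (x + 2 * pi * of_int m) = cos x" for x
    by (simp add: cos_add sin_int_2pin cos_int_2pin)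
  ultimately show "h (cos (2 * pi * (k \<bullet> (y + n)) + \<theta>)) = h (cos (2 * pi * (k \<bullet> y) + \<theta>))"
    by (simp only:)
qed

text \<open>Shifting by a vector \<open>t\<close> with \<open>k \<bullet> t = 1/2\<close> changes the sign of the cosine but not the mean. The summand 1 keeps the integrand nonnegative.\<close>

lemma torus_mean_cos:
  fixes k :: "real ^ 'n"
  assumes k: "k \<in> integer_lattice" "k \<noteq> 0"
  shows "torus_mean (\<lambda>y. ennreal (1 + cos (2 * pi * (k \<bullet> y) + \<theta>))) = 1"
proof -
  define p where "p y = ennreal (1 + cos (2 * pi * (k \<bullet> y) + \<theta>))" for y
  define t where "t = (1 / (2 * (k \<bullet> k))) *\<^sub>R k"
  have p[measurable]: "p \<in> borel_measurable borel" unfolding p_def by measurable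
  have per: "lattice_periodic p" unfolding p_def[abs_def] by (rule lattice_periodic_cos[OF k(1)])
  have kt: "k \<bullet> t = 1 / 2" using k(2) by (simp add: t_def)
  have "p y + p (y + t) = 2" for y
  proof -
    have "2 * pi * (k \<bullet> (y + t)) + \<theta> = (2 * pi * (k \<bullet> y) + \<theta>) + pi"
      by (simp add: inner_add_right kt algebra_simps)
    then have "cos (2 * pi * (k \<bullet> (y + t)) + \<theta>) = - cos (2 * pi * (k \<bullet> y) + \<theta>)"
      by (simp only: cos_periodic_pi)
    then have "p (y + t) = ennreal (1 - cos (2 * pi * (k \<bullet> y) + \<theta>))" by (simp add: p_def)
    moreover have "ennreal (1 + c) + ennreal (1 - c) = 2" if "- 1 \<le> c" "c \<le> 1" for c :: real
      using that by (subst ennreal_plus[symmetric]) auto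
    ultimately show ?thesis by (simp add: p_def)
  qed
  then have "torus_mean p + torus_mean (\<lambda>y. p (y + t)) = 2"
    by (subst torus_mean_add[symmetric]) (auto simp: torus_mean_const)
  then have two: "torus_mean p + torus_mean p = 2" by (simp add: torus_mean_shift per)
  have "torus_mean p \<noteq> \<infinity>" using two by auto
  then obtain r where r: "torus_mean p = ennreal r" "r \<ge> 0" by (cases "torus_mean p") auto
  then have "ennreal r + ennreal r = 2" using two by simp
  then have "ennreal (r + r) = ennreal 2" by (subst ennreal_plus[OF r(2) r(2)]) simp
  then have "r = 1" using r(2) by (subst (asm) ennreal_inj) auto
  then show ?thesis using r(1) unfolding p_def[abs_def] by simp
qed

lemma integral_zero_of_nn_integral:
  fixes B :: "'a::euclidean_space set"
  assumes [measurable]: "B \<in> sets borel" "c \<in> borel_measurable borel"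
    and B: "emeasure lborel B = ennreal v" "v \<ge> 0" and c: "\<And>z. \<bar>c z :: real\<bar> \<le> 1"
    and nn: "(\<integral>\<^sup>+z. indicator B z * ennreal (1 + c z) \<partial>lborel) = ennreal v"
  shows "(\<integral>z. indicator B z * c z \<partial>lborel) = 0"
proof -
  have ind: "integrable lborel (indicator B :: 'a \<Rightarrow> real)" using B by (simp add: integrable_indicator_iff)
  have int: "integrable lborel (\<lambda>z. indicator B z * c z)"
    by (rule Bochner_Integration.integrable_bound[OF ind]) (use c in \<open>auto simp: indicator_def\<close>)
  have "(\<integral>z. indicator B z * (1 + c z) \<partial>lborel) = enn2real (\<integral>\<^sup>+z. ennreal (indicator B z * (1 + c z)) \<partial>lborel)"
  proof (rule integral_eq_nn_integral)
    have "0 \<le> 1 + c z" for z using c[of z] by linarith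
    then show "AE z in lborel. 0 \<le> indicator B z * (1 + c z)" by simp
  qed measurable
  also have "(\<integral>\<^sup>+z. ennreal (indicator B z * (1 + c z)) \<partial>lborel) = (\<integral>\<^sup>+z. indicator B z * ennreal (1 + c z) \<partial>lborel)"
    by (intro nn_integral_cong) (auto simp: indicator_def)
  finally have "(\<integral>z. indicator B z * (1 + c z) \<partial>lborel) = v" using nn B by simp
  moreover have "(\<integral>z. indicator B z * (1 + c z) \<partial>lborel) = (\<integral>z. indicator B z \<partial>lborel) + (\<integral>z. indicator B z * c z \<partial>lborel)"
    using ind int by (subst Bochner_Integration.integral_add[symmetric]) (auto simp: distrib_left)
  moreover have "(\<integral>z. indicator B z \<partial>lborel) = v" using B by (simp add: measure_def)
  ultimately show ?thesis by simp
qed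

lemma tile_mean:
  fixes S :: "real ^ 'n \<Rightarrow> real ^ 'n"
  assumes S: "S \<in> isometry_group" and B[measurable]: "B \<in> sets borel"
    and tile: "AE y in lborel. periodization (indicator {y. inv_into UNIV S y \<in> B}) y = 1"
    and p[measurable]: "p \<in> borel_measurable borel" and per: "lattice_periodic p"
  shows "(\<integral>\<^sup>+z. indicator B z * p (S z) \<partial>lborel) = torus_mean p"
proof -
  note inv = isometry_group_inv[OF S]
  note [measurable] = isometry_measurable[OF S] isometry_measurable[OF inv(1)]
  have "(\<integral>\<^sup>+z. indicator B z * p (S z) \<partial>lborel) = (\<integral>\<^sup>+z. indicator {y. inv_into UNIV S y \<in> B} (S z) * p (S z) \<partial>lborel)"
    by (intro nn_integral_cong) (simp add: inv indicator_def)
  also have "\<dots> = (\<integral>\<^sup>+y. indicator {y. inv_into UNIV S y \<in> B} y * p y \<partial>lborel)"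
    by (rule nn_integral_isometry[OF S]) measurable
  also have "\<dots> = torus_mean p"
    by (rule nn_integral_tile[OF _ p per tile]) measurable
  finally show ?thesis .
qed

lemma tile_measure:
  fixes S :: "real ^ 'n \<Rightarrow> real ^ 'n"
  assumes S: "S \<in> isometry_group" and B: "B \<in> sets borel"
    and tile: "AE y in lborel. periodization (indicator {y. inv_into UNIV S y \<in> B}) y = 1"
  shows "emeasure lborel B = 1"
  using tile_mean[OF assms, of "\<lambda>_. 1"] B by (simp add: torus_mean_const lattice_periodic_def)

text \<open>The translation part of \<open>S\<close> only changes the phase, which is arbitrary.\<close>

lemma tile_fourier_zero:
  fixes S :: "real ^ 'n \<Rightarrow> real ^ 'n"
  assumes S: "S \<in> isometry_group" and B[measurable]: "B \<in> sets borel"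
    and tile: "AE y in lborel. periodization (indicator {y. inv_into UNIV S y \<in> B}) y = 1"
    and k: "k \<in> integer_lattice" "k \<noteq> 0" and eta: "S \<eta> - S 0 = k"
  shows "fourier_zero B \<eta>"
  unfolding fourier_zero_def
proof
  fix \<theta>
  define \<theta>' where "\<theta>' = \<theta> - 2 * pi * (k \<bullet> S 0)"
  have orth: "orthogonal_transformation (\<lambda>y. S y - S 0)" by (rule isometry_linear_part[OF S])
  have ks: "k \<bullet> S z = \<eta> \<bullet> z + k \<bullet> S 0" for z
  proof -
    have "(S \<eta> - S 0) \<bullet> (S z - S 0) = \<eta> \<bullet> z"
      using orth unfolding orthogonal_transformation_def by blast
    then show ?thesis unfolding eta by (simp add: inner_diff_right)
  qed
  have phase: "2 * pi * (k \<bullet> S z) + \<theta>' = 2 * pi * (\<eta> \<bullet> z) + \<theta>" for z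
    unfolding ks[of z] \<theta>'_def by (simp add: distrib_left)
  have "(\<integral>\<^sup>+z. indicator B z * ennreal (1 + cos (2 * pi * (k \<bullet> S z) + \<theta>')) \<partial>lborel) = 1"
    by (subst tile_mean[OF S B tile, of "\<lambda>y. ennreal (1 + cos (2 * pi * (k \<bullet> y) + \<theta>'))"])
       (auto intro: lattice_periodic_cos[OF k(1)] simp: torus_mean_cos[OF k])
  then show "(\<integral>z. indicator B z * cos (2 * pi * (\<eta> \<bullet> z) + \<theta>) \<partial>lborel) = 0"
    unfolding phase by (intro integral_zero_of_nn_integral[where v = 1]) (auto simp: tile_measure[OF S B tile])
qed

text \<open>Otherwise a neighbourhood of \<open>T\<close>, of the kind that compares the linear parts at \<open>\<xi>\<close>, would be a null set. By
  left invariance so would be the corresponding neighbourhood of every isometry, and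
  countably many of them cover the whole group, by the Lindelof property of the space of values at
  \<open>\<xi>\<close>.\<close>

lemma haar_isometry_dense:
  fixes \<mu> :: "('a::euclidean_space \<Rightarrow> 'a) measure"
  assumes haar: "haar_isometry \<mu>" and P: "AE S in \<mu>. P S" and T: "T \<in> isometry_group" and e: "e > 0"
  obtains S where "S \<in> isometry_group" "P S" "dist (S \<xi> - S 0) (T \<xi> - T 0) < e"
proof (rule ccontr)
  note found = that
  assume "\<not> thesis"
  then have none: "\<not> P S" if "S \<in> isometry_group" "dist (S \<xi> - S 0) (T \<xi> - T 0) < e" for S
    using found[of S] that by blast
  define W where "W R = {S \<in> isometry_group. dist (S \<xi> - S 0) (R \<xi> - R 0) < e}" for R :: "'a \<Rightarrow> 'a"
  have sets: "sets \<mu> = sets (restrict_space borel isometry_group)" using haar by (simp add: haar_isometry_def)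
  then have space: "space \<mu> = isometry_group" using sets_eq_imp_space_eq[OF sets] by (simp add: space_restrict_space)
  have W: "W R \<in> sets \<mu>" for R
  proof -
    have "open {S :: 'a \<Rightarrow> 'a. dist (S \<xi> - S 0) (R \<xi> - R 0) < e}"
      by (intro open_Collect_less continuous_intros continuous_on_product_coordinates)
    then have "{S :: 'a \<Rightarrow> 'a. dist (S \<xi> - S 0) (R \<xi> - R 0) < e} \<in> sets borel" by (rule borel_open)
    moreover have "W R = isometry_group \<inter> {S. dist (S \<xi> - S 0) (R \<xi> - R 0) < e}" by (auto simp: W_def)
    ultimately show ?thesis unfolding sets sets_restrict_space by blast
  qed
  obtain N where N: "{S \<in> space \<mu>. \<not> P S} \<subseteq> N" "emeasure \<mu> N = 0" "N \<in> sets \<mu>" using P by (rule AE_E)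
  have "W T \<subseteq> N" using none N(1) by (auto simp: W_def space)
  then have WT: "emeasure \<mu> (W T) = 0" using N(2,3) by (metis emeasure_mono le_zero_eq)
  have WR: "W R \<in> null_sets \<mu>" if R: "R \<in> isometry_group" for R
  proof -
    define Q where "Q = R \<circ> inv_into UNIV T"
    have Q: "Q \<in> isometry_group" unfolding Q_def by (intro isometry_group_comp R isometry_group_inv[OF T])
    have lin: "dist (Q x - Q y) (Q u - Q v) = dist (x - y) (u - v)" for x y u v
    proof -
      have o: "orthogonal_transformation (\<lambda>y. Q y - Q 0)" by (rule isometry_linear_part[OF Q])
      note l = orthogonal_transformation_linear[OF o]
      have "Q a - Q b = (\<lambda>y. Q y - Q 0) (a - b)" for a b using linear_diff[OF l, of a b] by simp
      then have "(Q x - Q y) - (Q u - Q v) = (\<lambda>y. Q y - Q 0) ((x - y) - (u - v))"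
        using linear_diff[OF l, of "x - y" "u - v"] by simp
      then show ?thesis using orthogonal_transformation_norm[OF o, of "(x - y) - (u - v)"] by (simp add: dist_norm)
    qed
    have QT: "Q (T x) = R x" for x by (simp add: Q_def isometry_group_inv[OF T])
    have "W R = (\<lambda>S. Q \<circ> S) ` W T"
    proof (intro equalityI subsetI)
      fix S assume S: "S \<in> W R"
      define S' where "S' = inv_into UNIV Q \<circ> S"
      have S': "S' \<in> isometry_group" using S unfolding S'_def W_def by (intro isometry_group_comp isometry_group_inv[OF Q]) auto
      have QS': "S = Q \<circ> S'" by (auto simp: S'_def isometry_group_inv[OF Q])
      have "dist (S' \<xi> - S' 0) (T \<xi> - T 0) = dist (S \<xi> - S 0) (R \<xi> - R 0)"
        using lin[of "S' \<xi>" "S' 0" "T \<xi>" "T 0"] by (simp add: QS' QT)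
      then have "S' \<in> W T" using S S' by (simp add: W_def)
      then show "S \<in> (\<lambda>S. Q \<circ> S) ` W T" using QS' by blast
    next
      fix S assume "S \<in> (\<lambda>S. Q \<circ> S) ` W T"
      then obtain S' where S': "S' \<in> W T" "S = Q \<circ> S'" by blast
      then have "dist (S \<xi> - S 0) (R \<xi> - R 0) = dist (S' \<xi> - S' 0) (T \<xi> - T 0)"
        using lin[of "S' \<xi>" "S' 0" "T \<xi>" "T 0"] by (simp add: QT)
      then show "S \<in> W R" using S' Q by (auto simp: W_def intro: isometry_group_comp)
    qed
    moreover have "emeasure \<mu> ((\<lambda>S. Q \<circ> S) ` W T) = emeasure \<mu> (W T)"
      using haar Q W unfolding haar_isometry_def by blast
    ultimately have "emeasure \<mu> (W R) = 0" using WT by simp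
    then show ?thesis by (intro null_setsI W)
  qed
  define F where "F = (\<lambda>R. ball (R \<xi> - R 0) e) ` isometry_group"
  obtain F' where F': "F' \<subseteq> F" "countable F'" "\<Union>F' = \<Union>F"
    by (rule Lindelof[of F]) (auto simp: F_def)
  then obtain G where G: "G \<subseteq> isometry_group" "countable G" "F' = (\<lambda>R. ball (R \<xi> - R 0) e) ` G"
    unfolding F_def by (auto dest: countable_subset_image[THEN iffD1, OF conjI])
  have "isometry_group \<subseteq> (\<Union>R\<in>G. W R)"
  proof
    fix S :: "'a \<Rightarrow> 'a" assume S: "S \<in> isometry_group"
    then have "S \<xi> - S 0 \<in> \<Union>F" using e by (force simp: F_def)
    then obtain R where "R \<in> G" "S \<xi> - S 0 \<in> ball (R \<xi> - R 0) e" unfolding F'(3)[symmetric] G(3) by blast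
    then show "S \<in> (\<Union>R\<in>G. W R)" using S by (auto simp: W_def dist_commute)
  qed
  moreover have "(\<Union>R\<in>G. W R) \<in> null_sets \<mu>" using G WR by (intro null_sets_UN') auto
  ultimately have "emeasure \<mu> isometry_group = 0"
    by (metis null_setsD1 null_setsD2 emeasure_mono le_zero_eq)
  then show False using haar by (simp add: haar_isometry_def)
qed

lemma fourier_zero_limit:
  fixes B :: "'a::euclidean_space set"
  assumes B[measurable]: "B \<in> sets borel" "emeasure lborel B < \<infinity>"
    and lim: "\<eta> \<longlonglongrightarrow> \<xi>" and zero: "\<And>j :: nat. fourier_zero B (\<eta> j)"
  shows "fourier_zero B \<xi>"
  unfolding fourier_zero_def
proof
  fix \<theta>
  have "(\<lambda>j. \<integral>z. indicator B z * cos (2 * pi * (\<eta> j \<bullet> z) + \<theta>) \<partial>lborel)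
     \<longlonglongrightarrow> (\<integral>z. indicator B z * cos (2 * pi * (\<xi> \<bullet> z) + \<theta>) \<partial>lborel)"
  proof (rule integral_dominated_convergence[where w = "indicator B"])
    show "integrable lborel (indicator B :: 'a \<Rightarrow> real)" using B by (simp add: integrable_indicator_iff)
    show "AE z in lborel. (\<lambda>j. indicator B z * cos (2 * pi * (\<eta> j \<bullet> z) + \<theta>)) \<longlonglongrightarrow> indicator B z * cos (2 * pi * (\<xi> \<bullet> z) + \<theta>)"
      by (intro AE_I2 tendsto_intros lim)
    show "AE z in lborel. norm (indicator B z * cos (2 * pi * (\<eta> j \<bullet> z) + \<theta>)) \<le> indicator B z" for j
      by (intro AE_I2) (simp add: indicator_def)
  qed measurable
  then have "(\<lambda>j. 0) \<longlonglongrightarrow> (\<integral>z. indicator B z * cos (2 * pi * (\<xi> \<bullet> z) + \<theta>) \<partial>lborel)"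
    using zero by (simp add: fourier_zero_def)
  then show "(\<integral>z. indicator B z * cos (2 * pi * (\<xi> \<bullet> z) + \<theta>) \<partial>lborel) = 0"
    by (simp add: LIMSEQ_const_iff)
qed

text \<open>Choose a linear isometry \<open>T\<close> with \<open>T \<xi> = k\<close> and isometries that satisfy the tiling condition and whose linear parts
  tend to \<open>T\<close> at \<open>\<xi>\<close>. The preimages of \<open>k\<close> under these linear parts are zeros that converge
  to \<open>\<xi>\<close>.\<close>

lemma steinhaus_fourier_zero:
  fixes \<mu> :: "(real ^ 'n \<Rightarrow> real ^ 'n) measure"
  assumes haar: "haar_isometry \<mu>" and st: "steinhaus_set \<mu> E"
  shows "\<exists>B\<in>sets borel. emeasure lborel B = 1 \<and>
    (\<forall>(k :: real ^ 'n) (\<xi> :: real ^ 'n). k \<in> integer_lattice \<longrightarrow> k \<noteq> 0 \<longrightarrow> norm \<xi> = norm k \<longrightarrow> fourier_zero B \<xi>)"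
proof -
  have "E \<in> sets (completion lborel)" using st by (simp add: steinhaus_set_def)
  then obtain B N0 N' where E: "E = B \<union> N0" "N0 \<subseteq> N'" "N' \<in> null_sets lborel" "B \<in> sets lborel"
    by (rule sets_completionE)
  have B: "B \<in> sets borel" using E(4) unfolding sets_lborel .
  define good where "good S \<longleftrightarrow> (AE x in lebesgue. card ((\<lambda>y. S y + x) ` E \<inter> integer_lattice) = 1)" for S :: "real ^ 'n \<Rightarrow> real ^ 'n"
  have AE_good: "AE S in \<mu>. good S" using st by (simp add: steinhaus_set_def good_def)
  have tile: "AE y in lborel. periodization (indicator {y. inv_into UNIV S y \<in> B}) y = 1"
    if "S \<in> isometry_group" "good S" for S
    using that steinhaus_tile[OF _ E(1-3)] unfolding good_def by blast
  have id: "(\<lambda>x. x) \<in> isometry_group" by (auto simp: isometry_group_def surj_def)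
  have measB: "emeasure lborel B = 1"
  proof -
    obtain S where "S \<in> isometry_group" "good S"
      by (rule haar_isometry_dense[OF haar AE_good id zero_less_one])
    then show ?thesis using tile_measure[OF _ B tile] by blast
  qed
  have all: "fourier_zero B \<xi>" if k: "k \<in> integer_lattice" "k \<noteq> 0" and n: "norm \<xi> = norm k" for k \<xi> :: "real ^ 'n"
  proof -
    obtain T where T: "orthogonal_transformation T" "T \<xi> = k" using orthogonal_transformation_exists[OF n] .
    have T0: "T 0 = 0" using T(1) orthogonal_transformation_isometry by blast
    have Tiso: "T \<in> isometry_group"
    proof -
      have "\<forall>x y. dist (T x) (T y) = dist x y" using T(1) orthogonal_transformation_isometry[of T] by blast
      then show ?thesis using orthogonal_transformation_surj[OF T(1)] by (simp add: isometry_group_def)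
    qed
    have "\<exists>\<eta>. fourier_zero B \<eta> \<and> dist \<eta> \<xi> < inverse (real (Suc j))" for j
    proof -
      obtain S where S: "S \<in> isometry_group" "good S" "dist (S \<xi> - S 0) (T \<xi> - T 0) < inverse (real (Suc j))"
        by (rule haar_isometry_dense[OF haar AE_good Tiso, of "inverse (real (Suc j))" \<xi>]) auto
      define \<eta> where "\<eta> = inv_into UNIV S (k + S 0)"
      have eta: "S \<eta> - S 0 = k" by (simp add: \<eta>_def isometry_group_inv[OF S(1)])
      have zero: "fourier_zero B \<eta>" by (rule tile_fourier_zero[OF S(1) B tile[OF S(1,2)] k eta])
      have "dist \<eta> \<xi> = dist (S \<eta>) (S \<xi>)" using isometry_groupD(2)[OF S(1)] by simp
      moreover have "dist (S \<xi> - S 0) (T \<xi> - T 0) = dist (S \<xi> - S 0) (S \<eta> - S 0)"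
        by (simp only: T(2) T0 eta diff_zero)
      moreover have "dist (S \<xi> - S 0) (S \<eta> - S 0) = dist (S \<eta>) (S \<xi>)"
        by (simp add: dist_norm norm_minus_commute)
      ultimately have "dist \<eta> \<xi> < inverse (real (Suc j))" using S(3) by linarith
      then show ?thesis using zero by blast
    qed
    then obtain \<eta> where \<eta>: "\<And>j. fourier_zero B (\<eta> j)" "\<And>j. dist (\<eta> j) \<xi> < inverse (real (Suc j))" by metis
    have conv: "\<eta> \<longlonglongrightarrow> \<xi>"
    proof (subst tendsto_dist_iff, rule tendsto_sandwich[OF _ _ tendsto_const LIMSEQ_inverse_real_of_nat])
      show "\<forall>\<^sub>F j in sequentially. 0 \<le> dist (\<eta> j) \<xi>" by simp
      show "\<forall>\<^sub>F j in sequentially. dist (\<eta> j) \<xi> \<le> inverse (real (Suc j))"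
        using \<eta>(2) by (intro always_eventually allI less_imp_le)
    qed
    have "emeasure lborel B < \<infinity>" unfolding measB by simp
    then show ?thesis by (rule fourier_zero_limit[OF B _ conv \<eta>(1)])
  qed
  show ?thesis
  proof (intro bexI[OF _ B] conjI measB allI impI)
    fix k \<xi> :: "real ^ 'n"
    assume "k \<in> integer_lattice" "k \<noteq> 0" "norm \<xi> = norm k"
    then show "fourier_zero B \<xi>" by (rule all)
  qed
qed

section \<open>Uniqueness of Fourier coefficients on the torus\<close>

text \<open>The torus as a compact subset of a Euclidean space, on which polynomials become trigonometric polynomials.\<close>

definition torus_embedding :: "real ^ 'n \<Rightarrow> complex ^ 'n" where
  "torus_embedding y = (\<chi> i. cis (2 * pi * (y $ i)))"

text \<open>A Borel left inverse of the embedding on the unit cube; through it every periodic Borel set is the preimage of a Borel set under the embedding.\<close>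

definition torus_unwrap :: "complex ^ 'n \<Rightarrow> real ^ 'n" where
  "torus_unwrap w = (\<chi> i. Arg2pi (w $ i) / (2 * pi))"

lemma cis_frac: "cis (2 * pi * frac t) = cis (2 * pi * t)"
proof -
  have "2 * pi * t = 2 * pi * frac t + 2 * pi * of_int \<lfloor>t\<rfloor>" by (simp add: frac_def algebra_simps)
  then have "cis (2 * pi * t) = cis (2 * pi * frac t) * cis (2 * pi * of_int \<lfloor>t\<rfloor>)" by (metis cis_mult)
  then show ?thesis by (simp add: cis_multiple_2pi)
qed

lemma torus_unwrap_embedding: "torus_unwrap (torus_embedding y) = (\<chi> i. frac (y $ i))"
proof -
  have "Arg2pi (cis (2 * pi * t)) = 2 * pi * frac t" for t
  proof (rule Arg2pi_unique[where r = 1])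
    show "of_real 1 * exp (\<i> * of_real (2 * pi * frac t)) = cis (2 * pi * t)"
      using cis_frac[of t] by (simp add: cis_conv_exp)
  qed (auto simp: frac_lt_1)
  then show ?thesis by (simp add: torus_unwrap_def torus_embedding_def vec_eq_iff)
qed

lemma torus_unwrap_measurable [measurable]:
  "(torus_unwrap :: complex ^ 'n \<Rightarrow> real ^ 'n) \<in> borel_measurable borel"
proof -
  have Arg: "Arg2pi \<in> borel_measurable borel"
    by (rule borel_measurableI_le) (simp add: borel_closed closed_Arg2pi2pi_le)
  have comp: "(\<lambda>w :: complex ^ 'n. w $ i) \<in> borel_measurable borel" for i
    by (intro borel_measurable_continuous_onI continuous_intros)
  show ?thesis
  proof (subst borel_measurable_euclidean_space, intro ballI)
    fix b :: "real ^ 'n" assume "b \<in> Basis"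
    then obtain i where b: "b = axis i 1" by (auto simp: Basis_vec_def)
    have "(\<lambda>w. Arg2pi (w $ i) / (2 * pi)) \<in> borel_measurable borel"
      using measurable_compose[OF comp Arg] by measurable
    then show "(\<lambda>w. torus_unwrap w \<bullet> b) \<in> borel_measurable borel"
      by (simp add: b torus_unwrap_def inner_axis)
  qed
qed

lemma torus_embedding_continuous: "continuous_on UNIV torus_embedding"
  unfolding torus_embedding_def by (intro continuous_intros)

lemma torus_embedding_measurable [measurable]: "torus_embedding \<in> borel_measurable borel"
  by (rule borel_measurable_continuous_onI[OF torus_embedding_continuous])

lemma compact_torus: "compact (range torus_embedding :: (complex ^ 'n) set)"
proof -
  define u :: "real ^ 'n" where "u = (\<chi> i. 1)"
  have "range torus_embedding = torus_embedding ` cbox 0 u"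
  proof (intro equalityI subsetI)
    fix w :: "complex ^ 'n" assume "w \<in> range torus_embedding"
    then obtain y where y: "w = torus_embedding y" by blast
    have "w = torus_embedding (\<chi> i. frac (y $ i))" by (simp add: y torus_embedding_def cis_frac vec_eq_iff)
    moreover have "(\<chi> i. frac (y $ i)) \<in> cbox 0 u"
      by (auto simp: mem_box_cart u_def frac_lt_1 less_imp_le)
    ultimately show "w \<in> torus_embedding ` cbox 0 u" by blast
  qed auto
  then show ?thesis
    by (metis compact_cbox compact_continuous_image continuous_on_subset subset_UNIV torus_embedding_continuous)
qed

inductive trig_poly :: "(real ^ 'n \<Rightarrow> real) \<Rightarrow> bool" where
  wave: "k \<in> integer_lattice \<Longrightarrow> trig_poly (\<lambda>y. c * cos (2 * pi * (k \<bullet> y) + \<theta>))"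
| add: "trig_poly f \<Longrightarrow> trig_poly g \<Longrightarrow> trig_poly (\<lambda>y. f y + g y)"

lemma trig_poly_const: "trig_poly (\<lambda>_. c)"
  using trig_poly.wave[of 0 c 0] by (simp add: integer_lattice_simps)

lemma trig_poly_sum: "finite I \<Longrightarrow> (\<And>i. i \<in> I \<Longrightarrow> trig_poly (f i)) \<Longrightarrow> trig_poly (\<lambda>y. \<Sum>i\<in>I. f i y)"
  by (induction I rule: finite_induct) (auto intro: trig_poly_const trig_poly.add)

lemma trig_poly_wave_mult:
  assumes "trig_poly f" "k \<in> integer_lattice"
  shows "trig_poly (\<lambda>y. c * cos (2 * pi * (k \<bullet> y) + \<theta>) * f y)"
  using assms(1)
proof induction
  case (wave m d \<phi>)
  have "c * cos (2 * pi * (k \<bullet> y) + \<theta>) * (d * cos (2 * pi * (m \<bullet> y) + \<phi>))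
      = (c * d / 2) * cos (2 * pi * ((k - m) \<bullet> y) + (\<theta> - \<phi>)) + (c * d / 2) * cos (2 * pi * ((k + m) \<bullet> y) + (\<theta> + \<phi>))" for y
  proof -
    have gen: "c * cos a * (d * cos b) = (c * d / 2) * cos (a - b) + (c * d / 2) * cos (a + b)" for a b :: real
    proof -
      have "c * cos a * (d * cos b) = c * d * (cos a * cos b)" by simp
      also have "\<dots> = (c * d / 2) * cos (a - b) + (c * d / 2) * cos (a + b)"
        unfolding cos_times_cos by (simp add: distrib_left)
      finally show ?thesis .
    qed
    have phases: "2 * pi * ((k - m) \<bullet> y) + (\<theta> - \<phi>) = (2 * pi * (k \<bullet> y) + \<theta>) - (2 * pi * (m \<bullet> y) + \<phi>)"
      "2 * pi * ((k + m) \<bullet> y) + (\<theta> + \<phi>) = (2 * pi * (k \<bullet> y) + \<theta>) + (2 * pi * (m \<bullet> y) + \<phi>)"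
      by (simp_all add: inner_diff_left inner_add_left algebra_simps)
    show ?thesis unfolding phases by (rule gen)
  qed
  then show ?case using assms(2) wave by (simp only:) (intro trig_poly.intros integer_lattice_simps)
next
  case (add f g)
  then have "trig_poly (\<lambda>y. c * cos (2 * pi * (k \<bullet> y) + \<theta>) * f y + c * cos (2 * pi * (k \<bullet> y) + \<theta>) * g y)"
    by (intro trig_poly.add)
  then show ?case by (simp add: distrib_left)
qed

lemma trig_poly_mult:
  assumes "trig_poly f" "trig_poly g"
  shows "trig_poly (\<lambda>y. f y * g y)"
  using assms(1)
proof induction
  case (wave k c \<theta>)
  then show ?case using trig_poly_wave_mult[OF assms(2)] by blast
next
  case (add f f')
  then have "trig_poly (\<lambda>y. f y * g y + f' y * g y)" by (intro trig_poly.add)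
  then show ?case by (simp add: distrib_right)
qed

lemma trig_poly_linear:
  fixes f :: "complex ^ 'n \<Rightarrow> real"
  assumes f: "bounded_linear f"
  shows "trig_poly (\<lambda>y. f (torus_embedding y))"
proof -
  interpret f: bounded_linear f by (rule f)
  have lat: "axis i 1 \<in> integer_lattice" for i :: 'n by (simp add: integer_lattice_def axis_def)
  have "f (torus_embedding y) = (\<Sum>i\<in>UNIV. f (axis i 1) * cos (2 * pi * (axis i 1 \<bullet> y) + 0)
        + f (axis i \<i>) * cos (2 * pi * (axis i 1 \<bullet> y) + (- pi / 2)))" for y
  proof -
    have "torus_embedding y = (\<Sum>i\<in>UNIV. cos (2 * pi * (y $ i)) *\<^sub>R axis i 1 + sin (2 * pi * (y $ i)) *\<^sub>R axis i \<i>)"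
      by (simp add: vec_eq_iff torus_embedding_def axis_def complex_eq_iff if_distrib[of "\<lambda>x. _ *\<^sub>R x"] sum.distrib
          cong: if_cong)
    then have "f (torus_embedding y) = (\<Sum>i\<in>UNIV. cos (2 * pi * (y $ i)) * f (axis i 1) + sin (2 * pi * (y $ i)) * f (axis i \<i>))"
      by (simp add: f.sum f.add f.scaleR)
    moreover have "cos (x + (- pi / 2)) = sin x" for x :: real
      using cos_diff[of x "pi / 2"] by simp
    ultimately show ?thesis by (simp add: inner_axis' mult.commute)
  qed
  then show ?thesis by (simp only:) (intro trig_poly_sum trig_poly.intros lat finite)
qed

lemma trig_poly_real_polynomial:
  fixes q :: "complex ^ 'n \<Rightarrow> real"
  assumes "real_polynomial_function q"
  shows "trig_poly (\<lambda>y. q (torus_embedding y))"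
  using assms
  by induction (auto intro: trig_poly_linear trig_poly_const trig_poly.add trig_poly_mult)

text \<open>By the Stone-Weierstrass theorem on the embedded torus, agreement on trigonometric polynomials
  gives agreement on continuous functions, then on open sets, and so on all Borel sets of the torus.\<close>

lemma measure_eq_on_periodic_sets:
  fixes M1 M2 :: "(real ^ 'n) measure"
  assumes fin1: "finite_measure M1" and fin2: "finite_measure M2"
    and sets1[measurable_cong]: "sets M1 = sets borel" and sets2[measurable_cong]: "sets M2 = sets borel"
    and eq: "\<And>(k :: real ^ 'n) \<theta>. k \<in> integer_lattice \<Longrightarrow>
      (\<integral>y. cos (2 * pi * (k \<bullet> y) + \<theta>) \<partial>M1) = (\<integral>y. cos (2 * pi * (k \<bullet> y) + \<theta>) \<partial>M2)"
    and A: "A \<in> sets borel" and per: "\<And>y n. n \<in> integer_lattice \<Longrightarrow> y + n \<in> A \<longleftrightarrow> y \<in> A"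
  shows "emeasure M1 A = emeasure M2 A"
proof -
  let ?e = "torus_embedding :: real ^ 'n \<Rightarrow> complex ^ 'n"
  interpret M1: finite_measure M1 by (rule fin1)
  interpret M2: finite_measure M2 by (rule fin2)
  have trig: "integrable M1 h \<and> integrable M2 h \<and> (\<integral>y. h y \<partial>M1) = (\<integral>y. h y \<partial>M2)" if "trig_poly h" for h
    using that
  proof induction
    case (wave k c \<theta>)
    have "integrable M1 (\<lambda>y. cos (2 * pi * (k \<bullet> y) + \<theta>))" "integrable M2 (\<lambda>y. cos (2 * pi * (k \<bullet> y) + \<theta>))"
      by (rule M1.integrable_const_bound[where B = 1] M2.integrable_const_bound[where B = 1]; simp)+
    then show ?case using eq[OF wave] by simp
  qed auto
  have total: "measure M1 UNIV = measure M2 UNIV"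
    using eq[of 0 0] sets_eq_imp_space_eq[OF sets1] sets_eq_imp_space_eq[OF sets2] by (simp add: integer_lattice_simps)
  have cont: "(\<integral>y. \<phi> (?e y) \<partial>M1) = (\<integral>y. \<phi> (?e y) \<partial>M2)"
    if \<phi>: "continuous_on UNIV \<phi>" for \<phi> :: "complex ^ 'n \<Rightarrow> real"
  proof (rule ccontr)
    note [measurable] = borel_measurable_continuous_onI[OF \<phi>]
    define m where "m = measure M1 UNIV + measure M2 UNIV + 1"
    define d where "d = \<bar>(\<integral>y. \<phi> (?e y) \<partial>M1) - (\<integral>y. \<phi> (?e y) \<partial>M2)\<bar>"
    assume "(\<integral>y. \<phi> (?e y) \<partial>M1) \<noteq> (\<integral>y. \<phi> (?e y) \<partial>M2)"
    then have d: "d > 0" by (simp add: d_def)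
    have m: "m > 0" by (simp add: m_def add_nonneg_pos)
    obtain q where q: "real_polynomial_function q" "\<And>w. w \<in> range ?e \<Longrightarrow> \<bar>\<phi> w - q w\<bar> < d / m"
      using Stone_Weierstrass_real_polynomial_function[OF compact_torus continuous_on_subset[OF \<phi> subset_UNIV], of "d / m"] d m
      by (metis divide_pos_pos)
    note tq = trig[OF trig_poly_real_polynomial[OF q(1)]]
    have approx: "integrable M (\<lambda>y. \<phi> (?e y)) \<and> \<bar>(\<integral>y. \<phi> (?e y) \<partial>M) - (\<integral>y. q (?e y) \<partial>M)\<bar> \<le> d / m * measure M UNIV"
      if M: "finite_measure M" "sets M = sets borel" "integrable M (\<lambda>y. q (?e y))" for M
    proof -
      interpret finite_measure M by (rule M)
      note [measurable_cong] = M(2)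
      have [simp]: "space M = UNIV" using sets_eq_imp_space_eq[OF M(2)] by simp
      have bnd: "\<bar>\<phi> (?e y) - q (?e y)\<bar> \<le> d / m" for y using q(2)[of "?e y"] by auto
      have meas: "(\<lambda>y. \<phi> (?e y) - q (?e y)) \<in> borel_measurable M"
      proof (rule borel_measurable_diff)
        show "(\<lambda>y. \<phi> (?e y)) \<in> borel_measurable M" by measurable
      qed (rule borel_measurable_integrable[OF M(3)])
      then have int: "integrable M (\<lambda>y. \<phi> (?e y) - q (?e y))"
        by (intro integrable_const_bound[where B = "d / m"]) (use bnd in auto)
      have "integrable M (\<lambda>y. (\<phi> (?e y) - q (?e y)) + q (?e y))"
        by (rule Bochner_Integration.integrable_add[OF int M(3)])
      then have i\<phi>: "integrable M (\<lambda>y. \<phi> (?e y))" by (simp only: diff_add_cancel)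
      have "\<bar>\<integral>y. \<phi> (?e y) - q (?e y) \<partial>M\<bar> \<le> (\<integral>y. \<bar>\<phi> (?e y) - q (?e y)\<bar> \<partial>M)" by (rule integral_abs_bound)
      also have "\<dots> \<le> (\<integral>y. d / m \<partial>M)" using int bnd by (intro integral_mono) auto
      also have "\<dots> = d / m * measure M UNIV" by simp
      finally show ?thesis using i\<phi> M(3) by simp
    qed
    have "d \<le> d / m * measure M1 UNIV + d / m * measure M2 UNIV"
      using approx[OF fin1 sets1] approx[OF fin2 sets2] tq unfolding d_def by linarith
    also have "\<dots> = d * ((measure M1 UNIV + measure M2 UNIV) / m)"
      by (simp add: add_divide_distrib distrib_left)
    also have "\<dots> = d * ((m - 1) / m)" by (simp add: m_def)
    also have "\<dots> < d * 1" using d m by (intro mult_strict_left_mono) auto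
    finally show False by simp
  qed
  have "distr M1 borel ?e = distr M2 borel ?e"
  proof (rule measure_eqI_generator_eq[where E = "{U. open U}" and \<Omega> = UNIV and A = "\<lambda>_. UNIV"])
    show "Int_stable {U :: (complex ^ 'n) set. open U}" by (auto simp: Int_stable_def)
    show "sets (distr M1 borel ?e) = sigma_sets UNIV {U. open U}" "sets (distr M2 borel ?e) = sigma_sets UNIV {U. open U}"
      by (simp_all add: borel_def)
    show "emeasure (distr M1 borel ?e) UNIV \<noteq> \<infinity>" for i :: nat
      by (subst emeasure_distr) auto
    fix U :: "(complex ^ 'n) set" assume "U \<in> {U. open U}"
    then have U: "open U" by simp
    then have [measurable]: "U \<in> sets borel" by simp
    have "measure M1 (?e -` U) = measure M2 (?e -` U)"
    proof (cases "U = UNIV")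
      case True
      then show ?thesis using total by simp
    next
      case False
      \<comment> \<open>continuous functions increasing to the indicator of \<open>U\<close>; \<open>infdist\<close> needs the complement to be nonempty\<close>
      define \<phi> where "\<phi> j w = min 1 (real j * infdist w (- U))" for j w
      have lim: "(\<lambda>j. \<phi> j w) \<longlonglongrightarrow> indicator U w" for w
      proof (cases "w \<in> U")
        case True
        then have "infdist w (- U) > 0"
          using False U by (subst infdist_pos_not_in_closed) auto
        then obtain J :: nat where J: "real J * infdist w (- U) > 1" using reals_Archimedean3 by blast
        have "\<phi> j w = 1" if "j \<ge> J" for j
        proof -
          have "real J * infdist w (- U) \<le> real j * infdist w (- U)" using that by (intro mult_right_mono) (auto simp: infdist_nonneg)
          then show ?thesis using J by (simp add: \<phi>_def)
        qed
        then show ?thesis using True by (auto intro!: tendsto_eventually exI[of _ J] simp: eventually_sequentially)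
      qed (auto simp: \<phi>_def)
      have c\<phi>: "continuous_on UNIV (\<phi> j)" for j unfolding \<phi>_def by (intro continuous_intros)
      note [measurable] = borel_measurable_continuous_onI[OF c\<phi>]
      have conv: "(\<lambda>j. \<integral>y. \<phi> j (?e y) \<partial>M) \<longlonglongrightarrow> measure M (?e -` U)"
        if M: "finite_measure M" "sets M = sets borel" for M
      proof -
        interpret finite_measure M by (rule M)
        note [measurable_cong] = M(2)
        have [simp]: "space M = UNIV" using sets_eq_imp_space_eq[OF M(2)] by simp
        have "(\<lambda>j. \<integral>y. \<phi> j (?e y) \<partial>M) \<longlonglongrightarrow> (\<integral>y. indicator U (?e y) \<partial>M)"
        proof (rule integral_dominated_convergence[where w = "\<lambda>_. 1"])
          show "AE y in M. (\<lambda>j. \<phi> j (?e y)) \<longlonglongrightarrow> indicator U (?e y)" using lim by simp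
          show "AE y in M. norm (\<phi> j (?e y)) \<le> 1" for j
            by (intro AE_I2) (simp add: \<phi>_def infdist_nonneg)
        qed auto
        also have "(\<integral>y. indicator U (?e y) \<partial>M) = (\<integral>y. indicator (?e -` U) y \<partial>M)"
          by (intro Bochner_Integration.integral_cong) (auto simp: indicator_def)
        also have "\<dots> = measure M (?e -` U)" by simp
        finally show ?thesis .
      qed
      show ?thesis using conv[OF fin1 sets1] conv[OF fin2 sets2] cont[OF c\<phi>] by (simp add: LIMSEQ_unique)
    qed
    then show "emeasure (distr M1 borel ?e) U = emeasure (distr M2 borel ?e) U"
      using sets_eq_imp_space_eq[OF sets1] sets_eq_imp_space_eq[OF sets2]
      by (simp add: emeasure_distr M1.emeasure_eq_measure M2.emeasure_eq_measure)
  qed auto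
  then have D: "emeasure (distr M1 borel ?e) (torus_unwrap -` A) = emeasure (distr M2 borel ?e) (torus_unwrap -` A)"
    by simp
  have [measurable]: "torus_unwrap -` A \<in> sets borel"
    using measurable_sets[OF torus_unwrap_measurable A] by simp
  have "?e -` (torus_unwrap -` A) = A"
  proof (rule Set.set_eqI)
    fix y :: "real ^ 'n"
    have "(\<chi> i. frac (y $ i)) = y + (\<chi> i. - of_int \<lfloor>y $ i\<rfloor>)" by (simp add: vec_eq_iff frac_def)
    moreover have "(\<chi> i. - of_int \<lfloor>y $ i\<rfloor>) \<in> integer_lattice" by (simp add: integer_lattice_def)
    ultimately show "y \<in> ?e -` (torus_unwrap -` A) \<longleftrightarrow> y \<in> A" by (simp add: torus_unwrap_embedding per)
  qed
  then show ?thesis using D sets_eq_imp_space_eq[OF sets1] sets_eq_imp_space_eq[OF sets2]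
    by (simp add: emeasure_distr)
qed

section \<open>A lattice of covolume the square root of 17\<close>

definition stretch :: "'n::finite \<Rightarrow> real \<Rightarrow> real ^ 'n \<Rightarrow> real ^ 'n" where
  "stretch i0 s x = (\<chi> i. (if i = i0 then s else 1) * x $ i)"

lemma stretch_inverse: "s \<noteq> 0 \<Longrightarrow> stretch i0 (1 / s) (stretch i0 s x) = x"
  by (simp add: stretch_def vec_eq_iff)

lemma stretch_inner: "k \<bullet> stretch i0 s x = stretch i0 s k \<bullet> x"
  by (simp add: stretch_def inner_vec_def mult_ac)

lemma stretch_measurable [measurable]: "(stretch i0 s :: real ^ 'n \<Rightarrow> real ^ 'n) \<in> borel_measurable borel"
  unfolding stretch_def[abs_def] by (intro borel_measurable_continuous_onI continuous_intros)

lemma lborel_stretch: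
  fixes i0 :: "'n::finite"
  assumes s: "s > 0"
  shows "lborel = density (distr lborel borel (stretch i0 s :: real ^ 'n \<Rightarrow> real ^ 'n)) (\<lambda>_. ennreal s)"
proof -
  define c where "c j = (if j = axis i0 1 then s else 1)" for j :: "real ^ 'n"
  have T: "stretch i0 s x = 0 + (\<Sum>j\<in>Basis. (c j * (x \<bullet> j)) *\<^sub>R j)" for x :: "real ^ 'n"
  proof -
    have "stretch i0 s x = (\<Sum>j\<in>Basis. (stretch i0 s x \<bullet> j) *\<^sub>R j)" by (rule euclidean_representation[symmetric])
    also have "\<dots> = (\<Sum>j\<in>Basis. (c j * (x \<bullet> j)) *\<^sub>R j)"
    proof (rule sum.cong[OF refl])
      fix j :: "real ^ 'n" assume "j \<in> Basis"
      then obtain i where j: "j = axis i 1" by (auto simp: Basis_vec_def)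
      then show "(stretch i0 s x \<bullet> j) *\<^sub>R j = (c j * (x \<bullet> j)) *\<^sub>R j"
        by (simp add: stretch_def c_def inner_axis axis_eq_axis)
    qed
    finally show ?thesis by simp
  qed
  have "stretch i0 s = (\<lambda>x :: real ^ 'n. 0 + (\<Sum>j\<in>Basis. (c j * (x \<bullet> j)) *\<^sub>R j))" by (rule ext) (rule T)
  moreover have "c j \<noteq> 0" for j using s by (simp add: c_def)
  ultimately have "lborel = density (distr lborel borel (stretch i0 s)) (\<lambda>_. ennreal (\<Prod>j\<in>Basis. \<bar>c j\<bar>))"
    using lborel_affine_euclidean[of c 0] by simp
  then have "lborel = density (distr lborel borel (stretch i0 s)) (\<lambda>_. (\<Prod>j\<in>Basis. ennreal \<bar>c j\<bar>))"
    by (simp add: prod_ennreal)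
  also have "(\<Prod>j\<in>Basis. ennreal \<bar>c j\<bar>) = ennreal s"
  proof -
    have "axis i0 1 \<in> (Basis :: (real ^ 'n) set)" by (simp add: axis_in_Basis_iff)
    then have "(\<Prod>j\<in>Basis. ennreal \<bar>c j\<bar>) = ennreal \<bar>c (axis i0 1)\<bar> * (\<Prod>j\<in>Basis - {axis i0 1}. ennreal \<bar>c j\<bar>)"
      by (intro prod.remove) auto
    also have "(\<Prod>j\<in>Basis - {axis i0 1}. ennreal \<bar>c j\<bar>) = 1"
      by (intro prod.neutral) (auto simp: c_def)
    finally show ?thesis using s by (simp add: c_def)
  qed
  finally show ?thesis .
qed

lemma nn_integral_stretch:
  fixes i0 :: "'n::finite"
  assumes s: "s > 0" and [measurable]: "f \<in> borel_measurable borel"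
  shows "(\<integral>\<^sup>+y. f y \<partial>lborel) = ennreal s * (\<integral>\<^sup>+x. f (stretch i0 s x) \<partial>(lborel :: (real ^ 'n) measure))"
  by (subst lborel_stretch[OF s, of i0]) (simp add: nn_integral_density nn_integral_distr nn_integral_cmult)

lemma integral_stretch:
  fixes i0 :: "'n::finite" and f :: "real ^ 'n \<Rightarrow> real"
  assumes s: "s > 0" and [measurable]: "f \<in> borel_measurable borel"
  shows "(\<integral>y. f y \<partial>lborel) = s * (\<integral>x. f (stretch i0 s x) \<partial>lborel)"
proof -
  have "(\<integral>y. f y \<partial>lborel) = (\<integral>y. f y \<partial>density (distr lborel borel (stretch i0 s)) (\<lambda>_. ennreal s))"
    by (subst lborel_stretch[OF s, of i0]) (rule refl)
  also have "\<dots> = (\<integral>y. s *\<^sub>R f y \<partial>distr lborel borel (stretch i0 s))"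
    using s by (intro integral_density) auto
  also have "\<dots> = (\<integral>x. s *\<^sub>R f (stretch i0 s x) \<partial>lborel)"
    by (intro integral_distr) measurable
  finally show ?thesis by simp
qed

text \<open>The coordinate \<open>i0\<close> and two others carry a value of \<open>x\<^sup>2 + y\<^sup>2 + 17 z\<^sup>2\<close>, which is replaced by a sum of three integer squares.\<close>

lemma stretched_lattice_norm:
  fixes k :: "real ^ 'n"
  assumes card: "CARD('n) \<ge> 3" and k: "k \<in> integer_lattice" "k \<noteq> 0"
  obtains m :: "real ^ 'n" where "m \<in> integer_lattice" "m \<noteq> 0" "norm (stretch i0 (sqrt 17) k) = norm m"
proof -
  obtain i1 where i1: "i1 \<noteq> i0" 
  proof -
    have "card {i0} < card (UNIV :: 'n set)" using card by simp
    then have "{i0} \<noteq> UNIV" by (metis less_irrefl)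
    then show ?thesis using that by blast
  qed
  obtain i2 where i2: "i2 \<noteq> i0" "i2 \<noteq> i1"
  proof -
    have "card {i0, i1} \<le> 2" by (simp add: card_insert_if)
    then have "card {i0, i1} < card (UNIV :: 'n set)" using card by linarith
    then have "{i0, i1} \<noteq> UNIV" by (metis less_irrefl)
    then show ?thesis using that by blast
  qed
  define f where "f i = \<lfloor>k $ i\<rfloor>" for i
  have f: "k $ i = of_int (f i)" for i
    using k(1) unfolding f_def integer_lattice_def by (auto elim: Ints_cases)
  obtain a b c :: int where abc: "f i1 ^ 2 + f i2 ^ 2 + 17 * f i0 ^ 2 = a ^ 2 + b ^ 2 + c ^ 2"
    using form_1_1_17_three_squares by blast
  define m :: "real ^ 'n" where "m = (\<chi> i. of_int (if i = i0 then a else if i = i1 then b else if i = i2 then c else f i))"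
  have split: "(\<Sum>i\<in>UNIV. g i) = g i0 + g i1 + g i2 + (\<Sum>i\<in>UNIV - {i0, i1, i2}. g i)" for g :: "'n \<Rightarrow> real"
  proof -
    have "(\<Sum>i\<in>UNIV. g i) = (\<Sum>i\<in>UNIV - {i0, i1, i2}. g i) + (\<Sum>i\<in>{i0, i1, i2}. g i)"
      by (rule sum.subset_diff) auto
    then show ?thesis using i1 i2 by simp
  qed
  have "(norm (stretch i0 (sqrt 17) k)) ^ 2 = (norm m) ^ 2"
  proof -
    have "real_of_int (f i1 ^ 2 + f i2 ^ 2 + 17 * f i0 ^ 2) = real_of_int (a ^ 2 + b ^ 2 + c ^ 2)" by (simp only: abc)
    then have "17 * (k $ i0) ^ 2 + (k $ i1) ^ 2 + (k $ i2) ^ 2 = a ^ 2 + b ^ 2 + c ^ 2" by (simp add: f)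
    moreover have "(\<Sum>i\<in>UNIV - {i0, i1, i2}. (stretch i0 (sqrt 17) k $ i) ^ 2) = (\<Sum>i\<in>UNIV - {i0, i1, i2}. (m $ i) ^ 2)"
      by (intro sum.cong) (auto simp: stretch_def m_def f)
    ultimately show ?thesis
      unfolding power2_norm_eq_inner inner_vec_def inner_real_def power2_eq_square[symmetric]
      unfolding split using i1 i2 by (simp add: stretch_def m_def power_mult_distrib)
  qed
  then have norm: "norm (stretch i0 (sqrt 17) k) = norm m" by (simp add: power2_eq_iff_nonneg)
  have "stretch i0 (sqrt 17) k \<noteq> 0"
    using k(2) by (auto simp: stretch_def vec_eq_iff)
  then have "m \<noteq> 0" using norm by auto
  moreover have "m \<in> integer_lattice" by (simp add: m_def integer_lattice_def)
  ultimately show ?thesis using that norm by blast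
qed

lemma periodization_indicator_integral:
  assumes "periodization (indicator A) y < 5"
  shows "periodization (indicator A) y \<le> 4"
proof -
  let ?X = "{n \<in> integer_lattice. y + n \<in> A}"
  have eq: "periodization (indicator A) y = (if finite ?X then of_nat (card ?X) else \<infinity>)"
    unfolding periodization_indicator by (rule emeasure_count_space) blast
  then have fin: "finite ?X" using assms by (auto split: if_splits)
  then have "of_nat (card ?X) < (of_nat 5 :: ennreal)" using assms eq by simp
  then have "card ?X \<le> 4" by (simp only: of_nat_less_iff)
  then have "of_nat (card ?X) \<le> (of_nat 4 :: ennreal)" by (simp only: of_nat_le_iff)
  then show ?thesis using eq fin by simp
qed

theorem mainTheorem1:
  fixes \<mu> :: "(real ^ 'n \<Rightarrow> real ^ 'n) measure"
  assumes "CARD('n) \<ge> 3"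
    and "haar_isometry \<mu>"
  shows "\<not> (\<exists>E. steinhaus_set \<mu> E)"
proof
  assume "\<exists>E. steinhaus_set \<mu> E"
  then obtain E where "steinhaus_set \<mu> E" ..
  from steinhaus_fourier_zero[OF assms(2) this]
  obtain B where B[measurable]: "B \<in> sets borel" and B1: "emeasure lborel B = 1"
    and zero: "\<And>(k :: real ^ 'n) (\<xi> :: real ^ 'n). k \<in> integer_lattice \<Longrightarrow> k \<noteq> 0 \<Longrightarrow> norm \<xi> = norm k \<Longrightarrow> fourier_zero B \<xi>"
    by (elim bexE conjE) blast
  define s where "s = sqrt 17"
  have s: "s > 0" "4 < s" "s < 5" by (auto simp: s_def real_less_rsqrt real_sqrt_less_iff intro: real_less_lsqrt)
  define i0 :: 'n where "i0 = undefined"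
  define E' where "E' = stretch i0 (1 / s) -` B"
  have E'[measurable]: "E' \<in> sets borel"
    unfolding E'_def using measurable_sets[OF stretch_measurable B] by simp
  have ind: "indicator E' (stretch i0 s x) = indicator B x" for x
    using s by (simp add: E'_def indicator_def stretch_inverse)
  have E's: "emeasure lborel E' = ennreal s"
    using nn_integral_stretch[OF s(1), of "indicator E'" i0] B1 by (simp add: ind)
  define M1 where "M1 = density lborel (indicator E' :: real ^ 'n \<Rightarrow> ennreal)"
  define M2 where "M2 = density lborel (\<lambda>y :: real ^ 'n. ennreal (s * indicator unit_cube y))"
  have M2A: "emeasure M2 A = ennreal s * emeasure lborel (unit_cube \<inter> A)" if [measurable]: "A \<in> sets borel" for A
  proof -
    have "emeasure M2 A = (\<integral>\<^sup>+y. ennreal (s * indicator unit_cube y) * indicator A y \<partial>lborel)"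
      unfolding M2_def by (rule emeasure_density) auto
    also have "\<dots> = (\<integral>\<^sup>+y. ennreal s * indicator (unit_cube \<inter> A) y \<partial>lborel)"
      by (intro nn_integral_cong) (auto simp: indicator_def)
    finally show ?thesis by (simp add: nn_integral_cmult_indicator)
  qed
  have M1A: "emeasure M1 A = (\<integral>\<^sup>+y. indicator E' y * indicator A y \<partial>lborel)" if "A \<in> sets borel" for A
    unfolding M1_def using that by (intro emeasure_density) auto
  have mass: "emeasure M1 (space M1) = ennreal s" "emeasure M2 (space M2) = ennreal s"
    using M1A[of UNIV] M2A[of UNIV] E's by (simp_all add: M1_def M2_def emeasure_unit_cube)
  then have fin: "finite_measure M1" "finite_measure M2" by (auto intro!: finite_measureI)
  have eq: "(\<integral>y. cos (2 * pi * (k \<bullet> y) + \<theta>) \<partial>M1) = (\<integral>y. cos (2 * pi * (k \<bullet> y) + \<theta>) \<partial>M2)"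
    if k: "k \<in> integer_lattice" for k :: "real ^ 'n" and \<theta>
  proof -
    have "(\<integral>y. cos (2 * pi * (k \<bullet> y) + \<theta>) \<partial>M1) = (\<integral>y. indicator E' y * cos (2 * pi * (k \<bullet> y) + \<theta>) \<partial>lborel)"
    proof -
      have "M1 = density lborel (\<lambda>y. ennreal (indicator E' y))" unfolding M1_def by (simp add: ennreal_indicator)
      then show ?thesis by (simp add: integral_density)
    qed
    also have "\<dots> = s * (\<integral>x. indicator B x * cos (2 * pi * (stretch i0 s k \<bullet> x) + \<theta>) \<partial>lborel)"
      by (subst integral_stretch[OF s(1), of _ i0]) (simp_all add: ind stretch_inner)
    finally have L: "(\<integral>y. cos (2 * pi * (k \<bullet> y) + \<theta>) \<partial>M1) = s * (\<integral>x. indicator B x * cos (2 * pi * (stretch i0 s k \<bullet> x) + \<theta>) \<partial>lborel)" .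
    have "(\<integral>y. cos (2 * pi * (k \<bullet> y) + \<theta>) \<partial>M2) = (\<integral>y. (s * indicator unit_cube y) * cos (2 * pi * (k \<bullet> y) + \<theta>) \<partial>lborel)"
      unfolding M2_def using s by (subst integral_density) auto
    also have "\<dots> = s * (\<integral>y. indicator unit_cube y * cos (2 * pi * (k \<bullet> y) + \<theta>) \<partial>lborel)"
      by (simp add: mult.assoc)
    finally have R: "(\<integral>y. cos (2 * pi * (k \<bullet> y) + \<theta>) \<partial>M2) = s * (\<integral>y. indicator unit_cube y * cos (2 * pi * (k \<bullet> y) + \<theta>) \<partial>lborel)" .
    show ?thesis
    proof (cases "k = 0")
      case True
      then show ?thesis by (simp add: measure_def mass)
    next
      case False
      obtain m :: "real ^ 'n" where "m \<in> integer_lattice" "m \<noteq> 0" "norm (stretch i0 s k) = norm m"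
        unfolding s_def by (rule stretched_lattice_norm[OF assms(1) k False, of i0])
      then have "fourier_zero B (stretch i0 s k)" by (rule zero)
      moreover have "(\<integral>y. indicator unit_cube y * cos (2 * pi * (k \<bullet> y) + \<theta>) \<partial>lborel) = 0"
        by (rule integral_zero_of_nn_integral[where v = 1])
           (use torus_mean_cos[OF k False] in \<open>auto simp: emeasure_unit_cube torus_mean_def\<close>)
      ultimately show ?thesis unfolding L R fourier_zero_def by simp
    qed
  qed
  define G where "G = periodization (indicator E' :: real ^ 'n \<Rightarrow> ennreal)"
  have G[measurable]: "G \<in> borel_measurable borel" unfolding G_def by measurable
  have Gper: "G (y + n) = G y" if "n \<in> integer_lattice" for y n
    using lattice_periodic_periodization that unfolding G_def lattice_periodic_def by blast
  have key: "ennreal s * emeasure lborel (unit_cube \<inter> A) = (\<integral>\<^sup>+y. indicator (unit_cube \<inter> A) y * G y \<partial>lborel)"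
    if A[measurable]: "A \<in> sets borel" and per: "\<And>y n. n \<in> integer_lattice \<Longrightarrow> y + n \<in> A \<longleftrightarrow> y \<in> A" for A
  proof -
    have "ennreal s * emeasure lborel (unit_cube \<inter> A) = emeasure M1 A"
      unfolding M2A[OF A, symmetric]
      by (rule measure_eq_on_periodic_sets[OF fin _ _ eq A per, symmetric]) (auto simp: M1_def M2_def)
    also have "\<dots> = (\<integral>\<^sup>+y. indicator E' y * indicator A y \<partial>lborel)" by (rule M1A[OF A])
    also have "\<dots> = torus_mean (\<lambda>y. G y * indicator A y)"
      unfolding G_def using per by (intro nn_integral_periodization) (auto simp: lattice_periodic_def indicator_def)
    also have "\<dots> = (\<integral>\<^sup>+y. indicator (unit_cube \<inter> A) y * G y \<partial>lborel)"
      unfolding torus_mean_def by (intro nn_integral_cong) (auto simp: indicator_def)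
    finally show ?thesis .
  qed
  \<comment> \<open>the mean of \<open>G\<close> over any periodic set is \<open>s\<close>, which lies strictly between 4 and 5; so neither \<open>5 \<le> G\<close> nor \<open>G \<le> 4\<close> is possible on a set of positive measure\<close>
  define A where "A = {y. 5 \<le> G y}"
  have A[measurable]: "A \<in> sets borel" unfolding A_def by measurable
  have Aper: "y + n \<in> A \<longleftrightarrow> y \<in> A" if "n \<in> integer_lattice" for y n using Gper[OF that] by (simp add: A_def)
  have cube_le: "emeasure lborel (unit_cube \<inter> C) \<le> 1" if "C \<in> sets borel" for C :: "(real ^ 'n) set"
    using emeasure_mono[of "unit_cube \<inter> C" unit_cube lborel] by (simp add: emeasure_unit_cube)
  have A0: "emeasure lborel (unit_cube \<inter> A) = 0"
  proof -
    have "5 * emeasure lborel (unit_cube \<inter> A) = (\<integral>\<^sup>+y. 5 * indicator (unit_cube \<inter> A) y \<partial>lborel)"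
      by (rule nn_integral_cmult_indicator[symmetric]) simp
    also have "\<dots> \<le> (\<integral>\<^sup>+y. indicator (unit_cube \<inter> A) y * G y \<partial>lborel)"
      by (intro nn_integral_mono) (auto simp: indicator_def A_def)
    also have "\<dots> = ennreal s * emeasure lborel (unit_cube \<inter> A)" by (rule key[OF A Aper, symmetric])
    finally have le: "5 * emeasure lborel (unit_cube \<inter> A) \<le> ennreal s * emeasure lborel (unit_cube \<inter> A)" .
    obtain r where r: "emeasure lborel (unit_cube \<inter> A) = ennreal r" "r \<ge> 0"
      using cube_le[OF A] by (cases "emeasure lborel (unit_cube \<inter> A)") (auto simp: top_unique)
    have "ennreal (5 * r) \<le> ennreal (s * r)" using le s r by (simp add: ennreal_mult)
    then have "5 * r \<le> s * r" using s r by (subst (asm) ennreal_le_iff) auto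
    then have "r = 0" using s r by (metis linorder_not_le mult_le_cancel_right order_antisym)
    then show ?thesis using r by simp
  qed
  have "emeasure lborel (unit_cube \<inter> (- A)) = 1"
  proof -
    have "emeasure lborel (unit_cube \<inter> A) + emeasure lborel (unit_cube \<inter> (- A)) = emeasure lborel ((unit_cube \<inter> A) \<union> (unit_cube \<inter> (- A)))"
      by (rule plus_emeasure) auto
    also have "(unit_cube \<inter> A) \<union> (unit_cube \<inter> (- A)) = unit_cube" by blast
    finally show ?thesis by (simp add: A0 emeasure_unit_cube)
  qed
  then have "ennreal s = (\<integral>\<^sup>+y. indicator (unit_cube \<inter> (- A)) y * G y \<partial>lborel)"
    using key[of "- A"] Aper by simp
  also have "\<dots> \<le> (\<integral>\<^sup>+y. 4 * indicator (unit_cube \<inter> (- A)) y \<partial>lborel)"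
    using periodization_indicator_integral[of E'] 
    by (intro nn_integral_mono) (auto simp: indicator_def A_def G_def not_le)
  also have "\<dots> = 4 * emeasure lborel (unit_cube \<inter> (- A))"
    by (rule nn_integral_cmult_indicator) simp
  also have "\<dots> = ennreal 4" using \<open>emeasure lborel (unit_cube \<inter> (- A)) = 1\<close> by simp
  finally show False using s by (subst (asm) ennreal_le_iff) auto
qed

end
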